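(* Let $A$ be a tracial von Neumann algebra and let $\mathcal{S}$ be the set-theoretic model associated to $A$. Then $\mathcal{S}\models\mathcal{T}_{\mathrm{vN},m}$.
   Context: A tracial von Neumann algebra is a (complex) von Neumann algebra $A$ (a $C^*$-algebra admitting a predual), with $C^*$-norm $\|\cdot\|_\infty$, equipped with a $\mathbb{C}$-linear functional $\mathrm{tr}:A\to\mathbb{C}$ such that $\mathrm{tr}(x^* )=\overline{\mathrm{tr}(x)}$, $\mathrm{tr}(x^*x)\ge0$ with equality iff $x=0$, $\mathrm{tr}(1)=1$, $\mathrm{tr}$ commutes with limits of increasing nets, and $\mathrm{tr}(xy)=\mathrm{tr}(yx)$; $\|x\|_2:=\sqrt{\mathrm{tr}(x^*x)}$. Types: $\mathbb{T}^X$ is the set of finite types generated from two distinct base types $0$ and $X$ by $\rho,\tau\mapsto(\rho\to\tau)$; $1:=0\to0$; for $\rho\in\mathbb{T}^X$, $\widehat{\rho}$ is $\rho$ with every occurrence of $X$ replaced by $0$. Real numbers are represented by type-1 objects as in Kohlenbach's "Applied Proof Theory" (rationals coded via the Cantor pairing $j$: $j(n,m)$ codes $n/(2m+2)$ if $n$ is even, $-(n+1)/(2m+2)$ if $n$ is odd), with $=_{\mathbb{R}}$, $\le_{\mathbb{R}}$ purely universal formulas and natural numbers/rationals embedded as constant functions ($(t)_{\mathbb{R}}$); complex numbers are pairs of type-1 terms, $=_{\mathbb{C}}$ componentwise, with conjugation $*_{\mathbb{C}}$, modulus $|\cdot|_{\mathbb{C}}$ etc. defined as usual. The system $\mathcal{T}_{\mathrm{vN},i}$: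 language of Kohlenbach's weakly extensional intuitionistic arithmetic in all finite types $\mathsf{WE\text{-}HA}^\omega$ (variant of strength around first-order arithmetic) with variables, combinators, recursors for all types in $\mathbb{T}^X$, plus constants $0_X:X$, $+_X:X\to(X\to X)$, $-_X:X\to X$, scalar multiplication $\cdot:\mathbb{C}\to(X\to X)$, $\cdot_X:X\to(X\to X)$, $1_X:X$, $*_X:X\to X$, $\|\cdot\|_\infty,\|\cdot\|_2:X\to1$, and $\mathrm{tr}$ (a pair of constants of type $X\to1$). $s=_Xt$ abbreviates $\|s-_Xt\|_\infty=_{\mathbb{R}}0_{\mathbb{R}}$; higher-type equality is extensional. Majorization between a term of type $\rho$ and one of type $\widehat\rho$: $s\lesssim_0t$ is $s\le t$; $s\lesssim_Xt$ is $\|s\|_\infty\le_{\mathbb{R}}(t)_{\mathbb{R}}$; $s\lesssim_{\rho\to\tau}t$ is $\forall x^\rho\forall y^{\widehat\rho}(x\lesssim_\rho y\to sx\lesssim_\tau ty)$. Axioms: $\mathsf{WE\text{-}HA}^\omega+\mathsf{QF\text{-}AC}$ for all types of $\mathbb{T}^X$, plus the purely universal axioms: complex vector space, ring, algebra axioms; normed space axioms for $\|\cdot\|_\infty$ and $\|xy\|_\infty\le\|x\|_\infty\|y\|_\infty$; $\mathrm{tr}$ $\mathbb{C}$-linear, $\mathrm{tr}(x^* )=\overline{\mathrm{tr}(x)}$, $\mathrm{tr}(1_X)=1$, $\mathrm{tr}(xy)=\mathrm{tr}(yx)$; $(\|x\|_2\cdot\|x\|_2,0)=_{\mathbb{C}}\mathrm{tr}(x^*x)$;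 normed space axioms for $\|\cdot\|_2$; $\|xy\|_2\le\|x\|_\infty\|y\|_2$; $\|x^*-y^*\|_\infty=\|x-y\|_\infty$; $\|x(y-z)\|_\infty=\|xy-xz\|_\infty$; $\|(x-y)z\|_\infty=\|xz-yz\|_\infty$; $\|x\|_2\le\|x\|_\infty$; $|\mathrm{tr}(x)|_{\mathbb{C}}\le\|x\|_2$; and for all $n\ge1$, $k\in\mathbb{N}$: $\forall x^X(q_{n,k}(x/\max(\|x\|_\infty,n))\le_{\mathbb{R}}1_{\mathbb{R}})$, where $(q_{n,k})_k$ is a fixed sequence of polynomials converging from below on $[0,n]$ to $t_n$ ($t_n(x)=1$ for $x\le1$, $1/\sqrt x$ otherwise). $\mathcal{T}_{\mathrm{vN},c}$ is $\mathcal{T}_{\mathrm{vN},i}$ plus excluded middle; $\mathcal{T}_{\mathrm{vN},m}$ is $\mathcal{T}_{\mathrm{vN},c}$ plus, for each of the constants $c$ of type $\rho$ listed above ($0_X,\dots,\mathrm{tr}$), a new constant $m_c$ of type $\widehat\rho$ and the axiom $c\lesssim_\rho m_c$. Set-theoretic models: for a set $A$, the universe is $\mathcal{S}_0=\mathbb{N}$, $\mathcal{S}_X=A$, $\mathcal{S}_{\rho\to\tau}=\mathcal{S}_\tau^{\mathcal{S}_\rho}$; a model interprets each constant of type $\rho$ by an element of $\mathcal{S}_\rho$ (Tarskian semantics) and must satisfy all axioms and rules of the system. For $x\ge0$ define $(x)_\circ(n):=j(2\max\{k\in\mathbb{N}: k/2^{n+1}\le x\},2^{n+1}-1)$; for $x\in\mathbb{R}$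 define $(x)_+:=(x)_\circ$ if $x\ge0$ and otherwise $(x)_+(n):=j(2\max\{k: k/2^{n+1}\le -x\}-1,2^{n+1}-1)$. The model associated to a tracial von Neumann algebra $A$ has $\mathcal{S}_X=A$, interprets the base-system constants standardly, $0_X,+_X,-_X,\cdot,\cdot_X,1_X,*_X$ as the obvious algebra operations, $\|\cdot\|_\infty$ as $x\mapsto(\|x\|_\infty)_\circ$, $\|\cdot\|_2$ as $x\mapsto(\|x\|_2)_\circ$, $\mathrm{tr}$ as $x\mapsto((\Re\,\mathrm{tr}(x))_+,(\Im\,\mathrm{tr}(x))_+)$, and $m_{0_X}:=0$, $m_{+_X}:=$ addition on $\mathbb{N}$, $m_{-_X}:=\mathrm{id}_{\mathbb{N}}$, $m_{\cdot}:=f\mapsto(g\mapsto(x\mapsto(f(0)+g(0)+2)\cdot x))$, $m_{\cdot_X}:=n\mapsto(m\mapsto nm)$, $m_{1_X}:=1$, $m_{*_X}:=\mathrm{id}_{\mathbb{N}}$, $m_{\|\cdot\|_\infty}:=m_{\|\cdot\|_2}:=n\mapsto(n)_\circ$, $m_{\mathrm{tr}}:=n\mapsto((n)_\circ,(n)_\circ)$.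
   Formalization: The axiom on q_{n,k} is read with the norm ‖q_{n,k}(x/max(‖x‖,n))‖ ≤ 1; the fixed q_{n,k} have rational coefficients and must satisfy |q_{n,k}(z)| ≤ 1 for complex |z| ≤ 1, since otherwise the axiom fails already for scalars x (e.g. n=1, q=1−x/(k+1), x=−1). *)

theory Defs
  imports "HOL-Analysis.Analysis" "HOL-Library.Nat_Bijection"
begin

section \<open>Types, terms and formulas\<close>

datatype ty = Nt | Xt | Fn ty ty

abbreviation T1 :: ty where "T1 \<equiv> Fn Nt Nt"

fun hatty :: "ty \<Rightarrow> ty" where
  "hatty Nt = Nt"
| "hatty Xt = Nt"
| "hatty (Fn \<rho> \<tau>) = Fn (hatty \<rho>) (hatty \<tau>)"

abbreviation fns :: "ty list \<Rightarrow> ty \<Rightarrow> ty" where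
  "fns \<rho>s \<tau> \<equiv> foldr Fn \<rho>s \<tau>"

text \<open>The complex-valued trace is a pair of constants, and scalar multiplication takes the real and
  the imaginary part of the scalar as two separate arguments.\<close>

datatype vnc = ZeroX | PlusX | MinusX | ScaleX | TimesX | OneX | StarX | NormInf | Norm2 | TrRe | TrIm

fun vnty :: "vnc \<Rightarrow> ty" where
  "vnty ZeroX = Xt"
| "vnty PlusX = Fn Xt (Fn Xt Xt)"
| "vnty MinusX = Fn Xt Xt"
| "vnty ScaleX = Fn T1 (Fn T1 (Fn Xt Xt))"
| "vnty TimesX = Fn Xt (Fn Xt Xt)"
| "vnty OneX = Xt"
| "vnty StarX = Fn Xt Xt"
| "vnty NormInf = Fn Xt T1"
| "vnty Norm2 = Fn Xt T1"
| "vnty TrRe = Fn Xt T1"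
| "vnty TrIm = Fn Xt T1"

text \<open>\<open>Rec \<rho>s i\<close> is the \<open>i\<close>-th of the simultaneous recursors for the tuple of types \<open>\<rho>s\<close>; a singleton
  list gives the ordinary recursor. \<open>Maj c\<close> is the constant \<open>m\<^sub>c\<close>.\<close>

datatype cst = Zero | Succ | Pi ty ty | Sig ty ty ty | Rec "ty list" nat | VN vnc | Maj vnc

abbreviation stepty :: "ty list \<Rightarrow> ty \<Rightarrow> ty" where
  "stepty \<rho>s \<rho> \<equiv> fns (\<rho>s @ [Nt]) \<rho>"

fun cty :: "cst \<Rightarrow> ty" where
  "cty Zero = Nt"
| "cty Succ = Fn Nt Nt"
| "cty (Pi \<rho> \<tau>) = Fn \<rho> (Fn \<tau> \<rho>)"
| "cty (Sig \<delta> \<rho> \<tau>) = Fn (Fn \<delta> (Fn \<rho> \<tau>)) (Fn (Fn \<delta> \<rho>) (Fn \<delta> \<tau>))"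
| "cty (Rec \<rho>s i) = fns (Nt # \<rho>s @ map (stepty \<rho>s) \<rho>s) (\<rho>s ! i)"
| "cty (VN c) = vnty c"
| "cty (Maj c) = hatty (vnty c)"

fun cst_ok :: "cst \<Rightarrow> bool" where
  "cst_ok (Rec \<rho>s i) \<longleftrightarrow> i < length \<rho>s"
| "cst_ok _ \<longleftrightarrow> True"

type_synonym var = "nat \<times> ty"

datatype trm = Var var | Cst cst | App trm trm (infixl "\<cdot>" 130)

text \<open>\<open>ty_of\<close> is only meaningful on well-typed terms.\<close>

fun ty_of :: "trm \<Rightarrow> ty" where
  "ty_of (Var v) = snd v"
| "ty_of (Cst c) = cty c"
| "ty_of (s \<cdot> t) = (case ty_of s of Fn \<rho> \<tau> \<Rightarrow> \<tau> | _ \<Rightarrow> Nt)"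

text \<open>The types of all subterms have to lie in \<open>D\<close>; \<open>D = UNIV\<close> gives the full language. See the
  remarks on universes below for the purpose of \<open>D\<close>.\<close>

fun wt :: "ty set \<Rightarrow> trm \<Rightarrow> bool" where
  "wt D (Var v) \<longleftrightarrow> snd v \<in> D"
| "wt D (Cst c) \<longleftrightarrow> cst_ok c \<and> cty c \<in> D"
| "wt D (s \<cdot> t) \<longleftrightarrow> wt D s \<and> wt D t \<and> (\<exists>\<tau>. ty_of s = Fn (ty_of t) \<tau>)"

datatype fm =
    Eq trm trm (infix "\<doteq>" 65)
  | And fm fm (infixr "\<^bold>\<and>" 60)
  | Or fm fm (infixr "\<^bold>\<or>" 58)
  | Imp fm fm (infixr "\<^bold>\<rightarrow>" 55)
  | Forall var fm
  | Exists var fm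

fun wff :: "ty set \<Rightarrow> fm \<Rightarrow> bool" where
  "wff D (s \<doteq> t) \<longleftrightarrow> wt D s \<and> wt D t \<and> ty_of s = Nt \<and> ty_of t = Nt"
| "wff D (A \<^bold>\<and> B) \<longleftrightarrow> wff D A \<and> wff D B"
| "wff D (A \<^bold>\<or> B) \<longleftrightarrow> wff D A \<and> wff D B"
| "wff D (A \<^bold>\<rightarrow> B) \<longleftrightarrow> wff D A \<and> wff D B"
| "wff D (Forall v A) \<longleftrightarrow> snd v \<in> D \<and> wff D A"
| "wff D (Exists v A) \<longleftrightarrow> snd v \<in> D \<and> wff D A"

fun qfree :: "fm \<Rightarrow> bool" where
  "qfree (s \<doteq> t) \<longleftrightarrow> True"
| "qfree (A \<^bold>\<and> B) \<longleftrightarrow> qfree A \<and> qfree B"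
| "qfree (A \<^bold>\<or> B) \<longleftrightarrow> qfree A \<and> qfree B"
| "qfree (A \<^bold>\<rightarrow> B) \<longleftrightarrow> qfree A \<and> qfree B"
| "qfree (Forall v A) \<longleftrightarrow> False"
| "qfree (Exists v A) \<longleftrightarrow> False"

fun fvt :: "trm \<Rightarrow> var set" where
  "fvt (Var v) = {v}"
| "fvt (Cst c) = {}"
| "fvt (s \<cdot> t) = fvt s \<union> fvt t"

fun fvf :: "fm \<Rightarrow> var set" where
  "fvf (s \<doteq> t) = fvt s \<union> fvt t"
| "fvf (A \<^bold>\<and> B) = fvf A \<union> fvf B"
| "fvf (A \<^bold>\<or> B) = fvf A \<union> fvf B"
| "fvf (A \<^bold>\<rightarrow> B) = fvf A \<union> fvf B"
| "fvf (Forall v A) = fvf A - {v}"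
| "fvf (Exists v A) = fvf A - {v}"

text \<open>Simultaneous substitution. It does not rename bound variables, so the schemas
  using it require \<open>free_for\<close> where a capture could occur.\<close>

fun substt :: "(var \<Rightarrow> trm) \<Rightarrow> trm \<Rightarrow> trm" where
  "substt \<sigma> (Var v) = \<sigma> v"
| "substt \<sigma> (Cst c) = Cst c"
| "substt \<sigma> (s \<cdot> t) = substt \<sigma> s \<cdot> substt \<sigma> t"

fun substf :: "(var \<Rightarrow> trm) \<Rightarrow> fm \<Rightarrow> fm" where
  "substf \<sigma> (s \<doteq> t) = (substt \<sigma> s \<doteq> substt \<sigma> t)"
| "substf \<sigma> (A \<^bold>\<and> B) = substf \<sigma> A \<^bold>\<and> substf \<sigma> B"
| "substf \<sigma> (A \<^bold>\<or> B) = substf \<sigma> A \<^bold>\<or> substf \<sigma> B"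
| "substf \<sigma> (A \<^bold>\<rightarrow> B) = substf \<sigma> A \<^bold>\<rightarrow> substf \<sigma> B"
| "substf \<sigma> (Forall v A) = Forall v (substf (\<sigma>(v := Var v)) A)"
| "substf \<sigma> (Exists v A) = Exists v (substf (\<sigma>(v := Var v)) A)"

fun free_for :: "(var \<Rightarrow> trm) \<Rightarrow> fm \<Rightarrow> bool" where
  "free_for \<sigma> (s \<doteq> t) \<longleftrightarrow> True"
| "free_for \<sigma> (A \<^bold>\<and> B) \<longleftrightarrow> free_for \<sigma> A \<and> free_for \<sigma> B"
| "free_for \<sigma> (A \<^bold>\<or> B) \<longleftrightarrow> free_for \<sigma> A \<and> free_for \<sigma> B"
| "free_for \<sigma> (A \<^bold>\<rightarrow> B) \<longleftrightarrow> free_for \<sigma> A \<and> free_for \<sigma> B"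
| "free_for \<sigma> (Forall v A) \<longleftrightarrow> (\<forall>w \<in> fvf A - {v}. v \<notin> fvt (\<sigma> w)) \<and> free_for (\<sigma>(v := Var v)) A"
| "free_for \<sigma> (Exists v A) \<longleftrightarrow> (\<forall>w \<in> fvf A - {v}. v \<notin> fvt (\<sigma> w)) \<and> free_for (\<sigma>(v := Var v)) A"

abbreviation sub1 :: "var \<Rightarrow> trm \<Rightarrow> var \<Rightarrow> trm" where
  "sub1 v t \<equiv> Var(v := t)"

definition fresh :: "trm list \<Rightarrow> nat" where
  "fresh ts = Suc (Max (insert 0 (fst ` (\<Union>t\<in>set ts. fvt t))))"

abbreviation zero :: trm where "zero \<equiv> Cst Zero"
abbreviation suc :: "trm \<Rightarrow> trm" where "suc t \<equiv> Cst Succ \<cdot> t"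

fun num_trm :: "nat \<Rightarrow> trm" where
  "num_trm 0 = zero"
| "num_trm (Suc n) = suc (num_trm n)"

abbreviation Falsum :: fm where "Falsum \<equiv> zero \<doteq> suc zero"
abbreviation Neg :: "fm \<Rightarrow> fm" where "Neg A \<equiv> A \<^bold>\<rightarrow> Falsum"

section \<open>Lambda abstraction and primitive recursive arithmetic as terms of the language\<close>

text \<open>The usual bracket abstraction; \<open>\<Sigma>\<^bsub>\<rho>,\<rho>\<rightarrow>\<rho>,\<rho>\<^esub> \<Pi>\<^bsub>\<rho>,\<rho>\<rightarrow>\<rho>\<^esub> \<Pi>\<^bsub>\<rho>,\<rho>\<^esub>\<close> is the identity.\<close>

fun lam :: "var \<Rightarrow> trm \<Rightarrow> trm" where
  "lam v (Var w) =
     (if v = w then let \<rho> = snd v in Cst (Sig \<rho> (Fn \<rho> \<rho>) \<rho>) \<cdot> Cst (Pi \<rho> (Fn \<rho> \<rho>)) \<cdot> Cst (Pi \<rho> \<rho>)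
      else Cst (Pi (snd w) (snd v)) \<cdot> Var w)"
| "lam v (Cst c) = Cst (Pi (cty c) (snd v)) \<cdot> Cst c"
| "lam v (s \<cdot> t) =
     (if v \<in> fvt s \<union> fvt t then Cst (Sig (snd v) (ty_of t) (ty_of (s \<cdot> t))) \<cdot> lam v s \<cdot> lam v t
      else Cst (Pi (ty_of (s \<cdot> t)) (snd v)) \<cdot> (s \<cdot> t))"

abbreviation vN :: "nat \<Rightarrow> trm" where "vN i \<equiv> Var (i, Nt)"
abbreviation vF :: "nat \<Rightarrow> trm" where "vF i \<equiv> Var (i, T1)"
abbreviation lamN :: "nat \<Rightarrow> trm \<Rightarrow> trm" where "lamN i t \<equiv> lam (i, Nt) t"
abbreviation lamF :: "nat \<Rightarrow> trm \<Rightarrow> trm" where "lamF i t \<equiv> lam (i, T1) t"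

text \<open>\<open>recN n a u k b\<close> iterates \<open>\<lambda>u k. b\<close> from \<open>a\<close>, with \<open>k\<close> running through \<open>0, \<dots>, n - 1\<close>.\<close>

definition recN :: "trm \<Rightarrow> trm \<Rightarrow> nat \<Rightarrow> nat \<Rightarrow> trm \<Rightarrow> trm" where
  "recN n a u k b = Cst (Rec [Nt] 0) \<cdot> n \<cdot> a \<cdot> lamN u (lamN k b)"

definition "c_pred = lamN 0 (recN (vN 0) zero 1 2 (vN 2))"
abbreviation "prd s \<equiv> c_pred \<cdot> s"

definition "c_monus = lamN 0 (lamN 1 (recN (vN 1) (vN 0) 2 3 (prd (vN 2))))"
abbreviation monus (infixl "-\<^sub>0" 110) where "s -\<^sub>0 t \<equiv> c_monus \<cdot> s \<cdot> t"

definition "c_add = lamN 0 (lamN 1 (recN (vN 1) (vN 0) 2 3 (suc (vN 2))))"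
abbreviation plus0 (infixl "+\<^sub>0" 110) where "s +\<^sub>0 t \<equiv> c_add \<cdot> s \<cdot> t"

definition "c_mul = lamN 0 (lamN 1 (recN (vN 1) zero 2 3 (vN 2 +\<^sub>0 vN 0)))"
abbreviation times0 (infixl "*\<^sub>0" 120) where "s *\<^sub>0 t \<equiv> c_mul \<cdot> s \<cdot> t"

text \<open>Characteristic functions take the value \<open>0\<close> for truth: \<open>ifz c a b\<close> is \<open>a\<close> if \<open>c = 0\<close>, else \<open>b\<close>.\<close>

definition "c_ifz = lamN 0 (lamN 1 (lamN 2 (recN (vN 0) (vN 1) 3 4 (vN 2))))"
abbreviation "ifz c a b \<equiv> c_ifz \<cdot> c \<cdot> a \<cdot> b"

definition "c_parity = lamN 0 (recN (vN 0) zero 1 2 (suc zero -\<^sub>0 vN 1))"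
abbreviation "parity0 s \<equiv> c_parity \<cdot> s"

definition "c_half = lamN 0 (recN (vN 0) zero 1 2 (vN 1 +\<^sub>0 parity0 (vN 2)))"
abbreviation "half0 s \<equiv> c_half \<cdot> s"

definition "c_pow2 = lamN 0 (recN (vN 0) (suc zero) 1 2 (vN 1 +\<^sub>0 vN 1))"
abbreviation "pow2 s \<equiv> c_pow2 \<cdot> s"

definition "c_div = lamN 0 (lamN 1
  (recN (vN 0) zero 2 3 (ifz (suc (vN 2) *\<^sub>0 vN 1 -\<^sub>0 vN 0) (suc (vN 2)) (vN 2))))"
abbreviation "div0 s t \<equiv> c_div \<cdot> s \<cdot> t"

definition "c_isqrt = lamN 0
  (recN (vN 0) zero 1 2 (ifz (suc (vN 1) *\<^sub>0 suc (vN 1) -\<^sub>0 vN 0) (suc (vN 1)) (vN 1)))"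
abbreviation "isqrt s \<equiv> c_isqrt \<cdot> s"

text \<open>The Cantor pairing \<open>j\<close> (which is \<open>prod_encode\<close>) and its projections.\<close>

definition "c_tri = lamN 0 (recN (vN 0) zero 1 2 (vN 1 +\<^sub>0 suc (vN 2)))"

definition "c_j = lamN 0 (lamN 1 (c_tri \<cdot> (vN 0 +\<^sub>0 vN 1) +\<^sub>0 vN 0))"
abbreviation "jpair s t \<equiv> c_j \<cdot> s \<cdot> t"

definition "c_diag = lamN 0
  (recN (vN 0) zero 1 2 (ifz (c_tri \<cdot> suc (vN 1) -\<^sub>0 vN 0) (suc (vN 1)) (vN 1)))"

definition "c_j1 = lamN 0 (vN 0 -\<^sub>0 c_tri \<cdot> (c_diag \<cdot> vN 0))"
definition "c_j2 = lamN 0 (c_diag \<cdot> vN 0 -\<^sub>0 c_j1 \<cdot> vN 0)"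

text \<open>The code \<open>j(n,m)\<close> stands for \<open>n/(2m+2)\<close> if \<open>n\<close> is even and for \<open>-(n+1)/(2m+2)\<close> if \<open>n\<close> is odd.
  Numerators are split into a positive and a negative part, one of which is \<open>0\<close>; \<open>mkq a b d\<close> is a
  code of \<open>(a - b)/d\<close> for \<open>d > 0\<close>.\<close>

definition "c_qpos = lamN 0 (ifz (parity0 (c_j1 \<cdot> vN 0)) (half0 (c_j1 \<cdot> vN 0)) zero)"
abbreviation "qpos s \<equiv> c_qpos \<cdot> s"

definition "c_qneg = lamN 0 (ifz (parity0 (c_j1 \<cdot> vN 0)) zero (half0 (suc (c_j1 \<cdot> vN 0))))"
abbreviation "qneg s \<equiv> c_qneg \<cdot> s"

definition "c_qden = lamN 0 (suc (c_j2 \<cdot> vN 0))"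
abbreviation "qden s \<equiv> c_qden \<cdot> s"

definition "c_mkq = lamN 0 (lamN 1 (lamN 2
  (ifz (vN 1 -\<^sub>0 vN 0)
     (jpair ((vN 0 -\<^sub>0 vN 1) +\<^sub>0 (vN 0 -\<^sub>0 vN 1)) (prd (vN 2)))
     (jpair (prd ((vN 1 -\<^sub>0 vN 0) +\<^sub>0 (vN 1 -\<^sub>0 vN 0))) (prd (vN 2))))))"
abbreviation "mkq a b d \<equiv> c_mkq \<cdot> a \<cdot> b \<cdot> d"

definition "c_addq = lamN 0 (lamN 1
  (mkq (qpos (vN 0) *\<^sub>0 qden (vN 1) +\<^sub>0 qpos (vN 1) *\<^sub>0 qden (vN 0))
       (qneg (vN 0) *\<^sub>0 qden (vN 1) +\<^sub>0 qneg (vN 1) *\<^sub>0 qden (vN 0))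
       (qden (vN 0) *\<^sub>0 qden (vN 1))))"
abbreviation plusq (infixl "+\<^sub>q" 110) where "s +\<^sub>q t \<equiv> c_addq \<cdot> s \<cdot> t"

definition "c_minusq = lamN 0 (mkq (qneg (vN 0)) (qpos (vN 0)) (qden (vN 0)))"
abbreviation "minusq s \<equiv> c_minusq \<cdot> s"

definition "c_mulq = lamN 0 (lamN 1
  (mkq (qpos (vN 0) *\<^sub>0 qpos (vN 1) +\<^sub>0 qneg (vN 0) *\<^sub>0 qneg (vN 1))
       (qpos (vN 0) *\<^sub>0 qneg (vN 1) +\<^sub>0 qneg (vN 0) *\<^sub>0 qpos (vN 1))
       (qden (vN 0) *\<^sub>0 qden (vN 1))))"
abbreviation timesq (infixl "*\<^sub>q" 120) where "s *\<^sub>q t \<equiv> c_mulq \<cdot> s \<cdot> t"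

definition "c_absq = lamN 0 (mkq (qpos (vN 0) +\<^sub>0 qneg (vN 0)) zero (qden (vN 0)))"
abbreviation "absq s \<equiv> c_absq \<cdot> s"

text \<open>\<open>s <\<^sub>q t\<close> is a term with value \<open>0\<close> iff the rational coded by \<open>s\<close> is less than the one coded by \<open>t\<close>.\<close>

definition "c_lessq = lamN 0 (lamN 1
  (suc (qpos (vN 0) *\<^sub>0 qden (vN 1) +\<^sub>0 qneg (vN 1) *\<^sub>0 qden (vN 0)) -\<^sub>0
   (qpos (vN 1) *\<^sub>0 qden (vN 0) +\<^sub>0 qneg (vN 0) *\<^sub>0 qden (vN 1))))"
abbreviation lessq (infix "<\<^sub>q" 105) where "s <\<^sub>q t \<equiv> c_lessq \<cdot> s \<cdot> t"

definition "c_maxq = lamN 0 (lamN 1 (ifz (vN 0 <\<^sub>q vN 1) (vN 1) (vN 0)))"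
abbreviation "maxq s t \<equiv> c_maxq \<cdot> s \<cdot> t"

text \<open>The reciprocal, used for positive rationals only.\<close>

definition "c_recipq = lamN 0 (mkq (qden (vN 0)) zero (qpos (vN 0)))"
abbreviation "recipq s \<equiv> c_recipq \<cdot> s"

text \<open>The rational \<open>2\<^sup>-\<^sup>n\<close>.\<close>

definition "c_epsq = lamN 0 (mkq (suc zero) zero (pow2 (vN 0)))"
abbreviation "epsq s \<equiv> c_epsq \<cdot> s"

section \<open>Real and complex numbers inside the language\<close>

text \<open>A function \<open>f\<close> with \<open>|f n - f (n+1)| < 2\<^sup>-\<^sup>n\<^sup>-\<^sup>1\<close> for all \<open>n\<close> represents the limit of \<open>f\<close>. An arbitrary
  \<open>f\<close> represents the same real number as \<open>f\<^sup>^\<close>, which is \<open>f\<close> made constant from the first place on where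
  this inequality fails; the recursion in \<open>c_hat\<close> computes the place \<open>k \<le> n\<close> with \<open>f\<^sup>^ n = f k\<close>.\<close>

definition "c_hat = lamF 0 (lamN 0 (vF 0 \<cdot> recN (vN 0) zero 1 2
  (ifz ((vN 1 -\<^sub>0 vN 2) +\<^sub>0 (vN 2 -\<^sub>0 vN 1) +\<^sub>0
        (absq (vF 0 \<cdot> vN 2 +\<^sub>q minusq (vF 0 \<cdot> suc (vN 2))) <\<^sub>q epsq (suc (vN 2))))
     (suc (vN 2)) (vN 1))))"
abbreviation "hat s n \<equiv> c_hat \<cdot> s \<cdot> n"

definition "c_natr = lamN 0 (lamN 1 (jpair (vN 0 +\<^sub>0 vN 0) zero))"
abbreviation "natr s \<equiv> c_natr \<cdot> s"
abbreviation "zeror \<equiv> natr zero"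
abbreviation "oner \<equiv> natr (suc zero)"

definition ratr :: "rat \<Rightarrow> trm" where
  "ratr r = (case quotient_of r of (a, b) \<Rightarrow>
     lamN 0 (mkq (num_trm (nat a)) (num_trm (nat (- a))) (num_trm (nat b))))"

definition eqr :: "trm \<Rightarrow> trm \<Rightarrow> fm" (infix "=\<^sub>r" 65) where
  "s =\<^sub>r t = (let n = fresh [s, t] in
     Forall (n, Nt) (absq (hat s (suc (vN n)) +\<^sub>q minusq (hat t (suc (vN n)))) <\<^sub>q epsq (vN n) \<doteq> zero))"

definition ler :: "trm \<Rightarrow> trm \<Rightarrow> fm" (infix "\<le>\<^sub>r" 65) where
  "s \<le>\<^sub>r t = (let n = fresh [s, t] in
     Forall (n, Nt) (hat s (suc (vN n)) +\<^sub>q minusq (hat t (suc (vN n))) <\<^sub>q epsq (vN n) \<doteq> zero))"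

definition "c_addr = lamF 0 (lamF 1 (lamN 0 (hat (vF 0) (suc (vN 0)) +\<^sub>q hat (vF 1) (suc (vN 0)))))"
abbreviation plusr (infixl "+\<^sub>r" 110) where "s +\<^sub>r t \<equiv> c_addr \<cdot> s \<cdot> t"

definition "c_minusr = lamF 0 (lamN 0 (minusq (hat (vF 0) (vN 0))))"
abbreviation "minusr s \<equiv> c_minusr \<cdot> s"

definition "c_absr = lamF 0 (lamN 0 (absq (hat (vF 0) (vN 0))))"
abbreviation "absr s \<equiv> c_absr \<cdot> s"

definition "c_maxr = lamF 0 (lamF 1 (lamN 0 (maxq (hat (vF 0) (vN 0)) (hat (vF 1) (vN 0)))))"
abbreviation "maxr s t \<equiv> c_maxr \<cdot> s \<cdot> t"

text \<open>A code of a rational is at least its absolute value, so \<open>k = f 0 + g 0 + 2\<close> satisfies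
  \<open>2\<^sup>k \<ge> (|f\<^sup>^ 0| + 1) + (|g\<^sup>^ 0| + 1)\<close> and the shift by \<open>k\<close> makes the product converge fast enough.\<close>

definition "c_mulr = lamF 0 (lamF 1 (lamN 0
  (hat (vF 0) (vN 0 +\<^sub>0 suc (suc (vF 0 \<cdot> zero +\<^sub>0 vF 1 \<cdot> zero))) *\<^sub>q
   hat (vF 1) (vN 0 +\<^sub>0 suc (suc (vF 0 \<cdot> zero +\<^sub>0 vF 1 \<cdot> zero))))))"
abbreviation timesr (infixl "*\<^sub>r" 120) where "s *\<^sub>r t \<equiv> c_mulr \<cdot> s \<cdot> t"

text \<open>The reciprocal of \<open>max f 1\<close>; it is only applied to reals \<open>\<ge> 1\<close>. The truncation at \<open>1\<close> makes it
  nonexpansive.\<close>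

definition "c_recipr = lamF 0 (lamN 0 (recipq (maxq (hat (vF 0) (vN 0)) (epsq zero))))"
abbreviation "recipr s \<equiv> c_recipr \<cdot> s"

text \<open>With \<open>a/d\<close> the positive part of \<open>f\<^sup>^ (2p)\<close> for \<open>p = n + 3\<close>, the \<open>n\<close>-th approximation of the square root is
  \<open>\<lfloor>\<surd>(a/d) \<cdot> 2\<^sup>p\<rfloor> / 2\<^sup>p\<close>.\<close>

definition "c_sqrtr = lamF 0 (lamN 0
  (mkq (isqrt (div0
          (qpos (hat (vF 0) (suc (suc (suc (vN 0))) +\<^sub>0 suc (suc (suc (vN 0))))) *\<^sub>0
             pow2 (suc (suc (suc (vN 0))) +\<^sub>0 suc (suc (suc (vN 0)))))
          (qden (hat (vF 0) (suc (suc (suc (vN 0))) +\<^sub>0 suc (suc (suc (vN 0))))))))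
       zero
       (pow2 (suc (suc (suc (vN 0)))))))"
abbreviation "sqrtr s \<equiv> c_sqrtr \<cdot> s"

type_synonym ctrm = "trm \<times> trm"

fun eqc :: "ctrm \<Rightarrow> ctrm \<Rightarrow> fm" (infix "=\<^sub>c" 65) where
  "(a, b) =\<^sub>c (c, d) = (a =\<^sub>r c) \<^bold>\<and> (b =\<^sub>r d)"
fun plusc :: "ctrm \<Rightarrow> ctrm \<Rightarrow> ctrm" (infixl "+\<^sub>c" 110) where
  "(a, b) +\<^sub>c (c, d) = (a +\<^sub>r c, b +\<^sub>r d)"
fun diffc :: "ctrm \<Rightarrow> ctrm \<Rightarrow> ctrm" (infixl "-\<^sub>c" 110) where
  "(a, b) -\<^sub>c (c, d) = (a +\<^sub>r minusr c, b +\<^sub>r minusr d)"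
fun timesc :: "ctrm \<Rightarrow> ctrm \<Rightarrow> ctrm" (infixl "*\<^sub>c" 120) where
  "(a, b) *\<^sub>c (c, d) = (a *\<^sub>r c +\<^sub>r minusr (b *\<^sub>r d), a *\<^sub>r d +\<^sub>r b *\<^sub>r c)"
fun conjc :: "ctrm \<Rightarrow> ctrm" where
  "conjc (a, b) = (a, minusr b)"
fun absc :: "ctrm \<Rightarrow> trm" where
  "absc (a, b) = sqrtr (a *\<^sub>r a +\<^sub>r b *\<^sub>r b)"

section \<open>The constants of the algebra, equality and majorization\<close>

abbreviation zerox :: trm ("0\<^sub>X") where "0\<^sub>X \<equiv> Cst (VN ZeroX)"
abbreviation onex :: trm ("1\<^sub>X") where "1\<^sub>X \<equiv> Cst (VN OneX)"
abbreviation plusx (infixl "+\<^sub>X" 110) where "s +\<^sub>X t \<equiv> Cst (VN PlusX) \<cdot> s \<cdot> t"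
abbreviation minusx where "minusx s \<equiv> Cst (VN MinusX) \<cdot> s"
abbreviation diffx (infixl "-\<^sub>X" 110) where "s -\<^sub>X t \<equiv> s +\<^sub>X minusx t"
abbreviation timesx (infixl "*\<^sub>X" 120) where "s *\<^sub>X t \<equiv> Cst (VN TimesX) \<cdot> s \<cdot> t"
fun scalex :: "ctrm \<Rightarrow> trm \<Rightarrow> trm" (infixr "\<odot>" 125) where
  "(a, b) \<odot> t = Cst (VN ScaleX) \<cdot> a \<cdot> b \<cdot> t"
abbreviation starx where "starx s \<equiv> Cst (VN StarX) \<cdot> s"
abbreviation ninf ("\<parallel>_\<parallel>") where "\<parallel>s\<parallel> \<equiv> Cst (VN NormInf) \<cdot> s"
abbreviation n2 where "n2 s \<equiv> Cst (VN Norm2) \<cdot> s"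
abbreviation trx :: "trm \<Rightarrow> ctrm" where "trx s \<equiv> (Cst (VN TrRe) \<cdot> s, Cst (VN TrIm) \<cdot> s)"

fun eqf :: "ty \<Rightarrow> trm \<Rightarrow> trm \<Rightarrow> fm" where
  "eqf Nt s t = (s \<doteq> t)"
| "eqf Xt s t = (\<parallel>s -\<^sub>X t\<parallel> =\<^sub>r zeror)"
| "eqf (Fn \<rho> \<tau>) s t = (let y = (fresh [s, t], \<rho>) in Forall y (eqf \<tau> (s \<cdot> Var y) (t \<cdot> Var y)))"

abbreviation eqx (infix "=\<^sub>X" 65) where "s =\<^sub>X t \<equiv> eqf Xt s t"

fun majf :: "ty \<Rightarrow> trm \<Rightarrow> trm \<Rightarrow> fm" where
  "majf Nt s t = (s -\<^sub>0 t \<doteq> zero)"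
| "majf Xt s t = (\<parallel>s\<parallel> \<le>\<^sub>r natr t)"
| "majf (Fn \<rho> \<tau>) s t =
     (let n = fresh [s, t]; x = (n, \<rho>); y = (Suc n, hatty \<rho>)
      in Forall x (Forall y (majf \<rho> (Var x) (Var y) \<^bold>\<rightarrow> majf \<tau> (s \<cdot> Var x) (t \<cdot> Var y))))"

section \<open>The systems\<close>

text \<open>Axioms are given as open formulas and validity is truth under all assignments.\<close>

inductive logic_axiom :: "fm \<Rightarrow> bool" where
  "logic_axiom (A \<^bold>\<or> A \<^bold>\<rightarrow> A)"
| "logic_axiom (A \<^bold>\<rightarrow> A \<^bold>\<and> A)"
| "logic_axiom (A \<^bold>\<rightarrow> A \<^bold>\<or> B)"
| "logic_axiom (A \<^bold>\<and> B \<^bold>\<rightarrow> A)"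
| "logic_axiom (A \<^bold>\<or> B \<^bold>\<rightarrow> B \<^bold>\<or> A)"
| "logic_axiom (A \<^bold>\<and> B \<^bold>\<rightarrow> B \<^bold>\<and> A)"
| "logic_axiom (Falsum \<^bold>\<rightarrow> A)"
| "ty_of t = snd v \<Longrightarrow> free_for (sub1 v t) A \<Longrightarrow> logic_axiom (Forall v A \<^bold>\<rightarrow> substf (sub1 v t) A)"
| "ty_of t = snd v \<Longrightarrow> free_for (sub1 v t) A \<Longrightarrow> logic_axiom (substf (sub1 v t) A \<^bold>\<rightarrow> Exists v A)"

abbreviation apps :: "trm \<Rightarrow> trm list \<Rightarrow> trm" where "apps \<equiv> foldl App"

inductive arith_axiom :: "fm \<Rightarrow> bool" where
  "arith_axiom (vN 0 \<doteq> vN 0)"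
| "arith_axiom ((vN 0 \<doteq> vN 1) \<^bold>\<rightarrow> (vN 1 \<doteq> vN 0))"
| "arith_axiom ((vN 0 \<doteq> vN 1) \<^bold>\<and> (vN 1 \<doteq> vN 2) \<^bold>\<rightarrow> (vN 0 \<doteq> vN 2))"
| "arith_axiom (Neg (suc (vN 0) \<doteq> zero))"
| "arith_axiom ((suc (vN 0) \<doteq> suc (vN 1)) \<^bold>\<rightarrow> (vN 0 \<doteq> vN 1))"
| induction: "x = (n, Nt) \<Longrightarrow>
    arith_axiom (substf (sub1 x zero) A \<^bold>\<and> Forall x (A \<^bold>\<rightarrow> substf (sub1 x (suc (Var x))) A) \<^bold>\<rightarrow> Forall x A)"
| pi: "x = Var (0, \<rho>) \<Longrightarrow> y = Var (1, \<tau>) \<Longrightarrow> arith_axiom (eqf \<rho> (Cst (Pi \<rho> \<tau>) \<cdot> x \<cdot> y) x)"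
| sigma: "x = Var (0, Fn \<delta> (Fn \<rho> \<tau>)) \<Longrightarrow> y = Var (1, Fn \<delta> \<rho>) \<Longrightarrow> z = Var (2, \<delta>) \<Longrightarrow>
    arith_axiom (eqf \<tau> (Cst (Sig \<delta> \<rho> \<tau>) \<cdot> x \<cdot> y \<cdot> z) (x \<cdot> z \<cdot> (y \<cdot> z)))"
| rec_zero: "i < length \<rho>s \<Longrightarrow>
    ys = map (\<lambda>k. Var (k, \<rho>s ! k)) [0..<length \<rho>s] \<Longrightarrow>
    zs = map (\<lambda>k. Var (length \<rho>s + k, stepty \<rho>s (\<rho>s ! k))) [0..<length \<rho>s] \<Longrightarrow>
    arith_axiom (eqf (\<rho>s ! i) (apps (Cst (Rec \<rho>s i)) (zero # ys @ zs)) (ys ! i))"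
| rec_suc: "i < length \<rho>s \<Longrightarrow>
    x = Var (2 * length \<rho>s, Nt) \<Longrightarrow>
    ys = map (\<lambda>k. Var (k, \<rho>s ! k)) [0..<length \<rho>s] \<Longrightarrow>
    zs = map (\<lambda>k. Var (length \<rho>s + k, stepty \<rho>s (\<rho>s ! k))) [0..<length \<rho>s] \<Longrightarrow>
    arith_axiom (eqf (\<rho>s ! i) (apps (Cst (Rec \<rho>s i)) (suc x # ys @ zs))
      (apps (zs ! i) (map (\<lambda>k. apps (Cst (Rec \<rho>s k)) (x # ys @ zs)) [0..<length \<rho>s] @ [x])))"

text \<open>Quantifier-free choice for tuples of variables of arbitrary types.\<close>

inductive qfac_axiom :: "fm \<Rightarrow> bool" where
  "qfree A \<Longrightarrow> distinct (xs @ ys @ Ys) \<Longrightarrow> set Ys \<inter> fvf A = {} \<Longrightarrow>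
   map snd Ys = map (\<lambda>y. fns (map snd xs) (snd y)) ys \<Longrightarrow>
   \<sigma> = (\<lambda>v. case map_of (zip ys Ys) v of None \<Rightarrow> Var v | Some Y \<Rightarrow> apps (Var Y) (map Var xs)) \<Longrightarrow>
   qfac_axiom (foldr Forall xs (foldr Exists ys A) \<^bold>\<rightarrow> foldr Exists Ys (foldr Forall xs (substf \<sigma> A)))"

inductive rule_inst :: "fm set \<Rightarrow> fm \<Rightarrow> bool" where
  mp: "rule_inst {A, A \<^bold>\<rightarrow> B} B"
| syll: "rule_inst {A \<^bold>\<rightarrow> B, B \<^bold>\<rightarrow> E} (A \<^bold>\<rightarrow> E)"
| exportation: "rule_inst {A \<^bold>\<and> B \<^bold>\<rightarrow> E} (A \<^bold>\<rightarrow> B \<^bold>\<rightarrow> E)"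
| importation: "rule_inst {A \<^bold>\<rightarrow> B \<^bold>\<rightarrow> E} (A \<^bold>\<and> B \<^bold>\<rightarrow> E)"
| expansion: "rule_inst {A \<^bold>\<rightarrow> B} (E \<^bold>\<or> A \<^bold>\<rightarrow> E \<^bold>\<or> B)"
| all_intro: "v \<notin> fvf B \<Longrightarrow> rule_inst {B \<^bold>\<rightarrow> A} (B \<^bold>\<rightarrow> Forall v A)"
| ex_elim: "v \<notin> fvf B \<Longrightarrow> rule_inst {A \<^bold>\<rightarrow> B} (Exists v A \<^bold>\<rightarrow> B)"
| qf_er: "qfree A \<Longrightarrow> ty_of s = snd x \<Longrightarrow> ty_of t = snd x \<Longrightarrow>
    rule_inst {A \<^bold>\<rightarrow> eqf (snd x) s t}
      (A \<^bold>\<rightarrow> eqf (ty_of r) (substt (sub1 x s) r) (substt (sub1 x t) r))"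

abbreviation vX :: "nat \<Rightarrow> trm" where "vX i \<equiv> Var (i, Xt)"
abbreviation vZ :: "nat \<Rightarrow> ctrm" where "vZ i \<equiv> (vF (2 * i), vF (2 * i + 1))"

inductive algebra_axiom :: "fm \<Rightarrow> bool" where
  "algebra_axiom (vX 0 +\<^sub>X (vX 1 +\<^sub>X vX 2) =\<^sub>X (vX 0 +\<^sub>X vX 1) +\<^sub>X vX 2)"
| "algebra_axiom (vX 0 +\<^sub>X vX 1 =\<^sub>X vX 1 +\<^sub>X vX 0)"
| "algebra_axiom (vX 0 +\<^sub>X 0\<^sub>X =\<^sub>X vX 0)"
| "algebra_axiom (vX 0 +\<^sub>X minusx (vX 0) =\<^sub>X 0\<^sub>X)"
| "algebra_axiom (vZ 0 \<odot> (vX 0 +\<^sub>X vX 1) =\<^sub>X vZ 0 \<odot> vX 0 +\<^sub>X vZ 0 \<odot> vX 1)"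
| "algebra_axiom ((vZ 0 +\<^sub>c vZ 1) \<odot> vX 0 =\<^sub>X vZ 0 \<odot> vX 0 +\<^sub>X vZ 1 \<odot> vX 0)"
| "algebra_axiom ((vZ 0 *\<^sub>c vZ 1) \<odot> vX 0 =\<^sub>X vZ 0 \<odot> vZ 1 \<odot> vX 0)"
| "algebra_axiom ((oner, zeror) \<odot> vX 0 =\<^sub>X vX 0)"
| "algebra_axiom (vX 0 *\<^sub>X (vX 1 *\<^sub>X vX 2) =\<^sub>X (vX 0 *\<^sub>X vX 1) *\<^sub>X vX 2)"
| "algebra_axiom (vX 0 *\<^sub>X (vX 1 +\<^sub>X vX 2) =\<^sub>X vX 0 *\<^sub>X vX 1 +\<^sub>X vX 0 *\<^sub>X vX 2)"
| "algebra_axiom ((vX 0 +\<^sub>X vX 1) *\<^sub>X vX 2 =\<^sub>X vX 0 *\<^sub>X vX 2 +\<^sub>X vX 1 *\<^sub>X vX 2)"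
| "algebra_axiom (1\<^sub>X *\<^sub>X vX 0 =\<^sub>X vX 0)"
| "algebra_axiom (vX 0 *\<^sub>X 1\<^sub>X =\<^sub>X vX 0)"
| "algebra_axiom (vZ 0 \<odot> (vX 0 *\<^sub>X vX 1) =\<^sub>X (vZ 0 \<odot> vX 0) *\<^sub>X vX 1)"
| "algebra_axiom (vZ 0 \<odot> (vX 0 *\<^sub>X vX 1) =\<^sub>X vX 0 *\<^sub>X (vZ 0 \<odot> vX 1))"

text \<open>Homogeneity and the triangle inequality, together with the further purely universal
  axioms that Kohlenbach uses to make the vector space operations provably extensional. Definiteness is
  not purely universal; for \<open>\<parallel>_\<parallel>\<close> it is built into \<open>=\<^sub>X\<close>.\<close>

inductive normed_axiom :: "(trm \<Rightarrow> trm) \<Rightarrow> fm \<Rightarrow> bool" for n :: "trm \<Rightarrow> trm" where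
  "normed_axiom n (n (vZ 0 \<odot> vX 0) =\<^sub>r absc (vZ 0) *\<^sub>r n (vX 0))"
| "normed_axiom n (n (vX 0 +\<^sub>X vX 1) \<le>\<^sub>r n (vX 0) +\<^sub>r n (vX 1))"
| "normed_axiom n (n (vX 0 -\<^sub>X vX 0) =\<^sub>r zeror)"
| "normed_axiom n (n (vX 0 -\<^sub>X vX 1) =\<^sub>r n (vX 1 -\<^sub>X vX 0))"
| "normed_axiom n (n (vX 0 -\<^sub>X vX 2) \<le>\<^sub>r n (vX 0 -\<^sub>X vX 1) +\<^sub>r n (vX 1 -\<^sub>X vX 2))"
| "normed_axiom n (n (vZ 0 \<odot> vX 0 -\<^sub>X vZ 0 \<odot> vX 1) =\<^sub>r absc (vZ 0) *\<^sub>r n (vX 0 -\<^sub>X vX 1))"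
| "normed_axiom n (n (vZ 0 \<odot> vX 0 -\<^sub>X vZ 1 \<odot> vX 0) =\<^sub>r absc (vZ 0 -\<^sub>c vZ 1) *\<^sub>r n (vX 0))"
| "normed_axiom n (n ((vX 0 +\<^sub>X vX 1) -\<^sub>X (vX 2 +\<^sub>X vX 3)) \<le>\<^sub>r n (vX 0 -\<^sub>X vX 2) +\<^sub>r n (vX 1 -\<^sub>X vX 3))"
| "normed_axiom n (n (minusx (vX 0) -\<^sub>X minusx (vX 1)) =\<^sub>r n (vX 0 -\<^sub>X vX 1))"
| "normed_axiom n (absr (n (vX 0) +\<^sub>r minusr (n (vX 1))) \<le>\<^sub>r n (vX 0 -\<^sub>X vX 1))"

inductive tracial_axiom :: "fm \<Rightarrow> bool" where
  "tracial_axiom (\<parallel>vX 0 *\<^sub>X vX 1\<parallel> \<le>\<^sub>r \<parallel>vX 0\<parallel> *\<^sub>r \<parallel>vX 1\<parallel>)"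
| "tracial_axiom (trx (vX 0 +\<^sub>X vX 1) =\<^sub>c trx (vX 0) +\<^sub>c trx (vX 1))"
| "tracial_axiom (trx (vZ 0 \<odot> vX 0) =\<^sub>c vZ 0 *\<^sub>c trx (vX 0))"
| "tracial_axiom (trx (starx (vX 0)) =\<^sub>c conjc (trx (vX 0)))"
| "tracial_axiom (trx 1\<^sub>X =\<^sub>c (oner, zeror))"
| "tracial_axiom (trx (vX 0 *\<^sub>X vX 1) =\<^sub>c trx (vX 1 *\<^sub>X vX 0))"
| "tracial_axiom ((n2 (vX 0) *\<^sub>r n2 (vX 0), zeror) =\<^sub>c trx (starx (vX 0) *\<^sub>X vX 0))"
| "tracial_axiom (n2 (vX 0 *\<^sub>X vX 1) \<le>\<^sub>r \<parallel>vX 0\<parallel> *\<^sub>r n2 (vX 1))"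
| "tracial_axiom (\<parallel>starx (vX 0) -\<^sub>X starx (vX 1)\<parallel> =\<^sub>r \<parallel>vX 0 -\<^sub>X vX 1\<parallel>)"
| "tracial_axiom (\<parallel>vX 0 *\<^sub>X (vX 1 -\<^sub>X vX 2)\<parallel> =\<^sub>r \<parallel>vX 0 *\<^sub>X vX 1 -\<^sub>X vX 0 *\<^sub>X vX 2\<parallel>)"
| "tracial_axiom (\<parallel>(vX 0 -\<^sub>X vX 1) *\<^sub>X vX 2\<parallel> =\<^sub>r \<parallel>vX 0 *\<^sub>X vX 2 -\<^sub>X vX 1 *\<^sub>X vX 2\<parallel>)"
| "tracial_axiom (n2 (vX 0) \<le>\<^sub>r \<parallel>vX 0\<parallel>)"
| "tracial_axiom (absc (trx (vX 0)) \<le>\<^sub>r n2 (vX 0))"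

text \<open>The value of a polynomial at a term of type \<open>X\<close>. The coefficients are rational so that they are
  denoted by closed terms.\<close>

definition polyx :: "rat poly \<Rightarrow> trm \<Rightarrow> trm" where
  "polyx p t = foldr (\<lambda>c s. (ratr c, zeror) \<odot> 1\<^sub>X +\<^sub>X t *\<^sub>X s) (coeffs p) 0\<^sub>X"

text \<open>\<open>\<parallel>q\<^sub>n\<^sub>,\<^sub>k(x / max(\<parallel>x\<parallel>, n))\<parallel> \<le> 1\<close>: the polynomial is evaluated in the algebra, and it is the
  norm of the result that is compared with the real number \<open>1\<close>.\<close>

inductive ball_axiom :: "(nat \<Rightarrow> nat \<Rightarrow> rat poly) \<Rightarrow> fm \<Rightarrow> bool" for q where
  "n \<ge> 1 \<Longrightarrow>
   ball_axiom q (\<parallel>polyx (q n k) ((recipr (maxr \<parallel>vX 0\<parallel> (natr (num_trm n))), zeror) \<odot> vX 0)\<parallel> \<le>\<^sub>r oner)"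

definition t_fun :: "real \<Rightarrow> real" where
  "t_fun x = (if x \<le> 1 then 1 else 1 / sqrt x)"

text \<open>Convergence from below of \<open>q n k\<close> to \<open>t_fun\<close> on \<open>{0..n}\<close>. The bound on the closed unit disc
  says exactly that \<open>ball_axiom\<close> is true in the one-dimensional algebra of complex numbers, and it is not
  a consequence of the convergence. Such sequences exist by Mergelyan's theorem for the union of the
  disc and \<open>{1..n}\<close>, applied to the continuous extension of \<open>t_fun\<close> by \<open>1\<close> to the disc.\<close>

definition admissible :: "(nat \<Rightarrow> nat \<Rightarrow> rat poly) \<Rightarrow> bool" where
  "admissible q \<longleftrightarrow> (\<forall>n\<ge>1.
     (\<forall>k. \<forall>x\<in>{0..real n}. poly (map_poly of_rat (q n k)) x \<le> t_fun x) \<and>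
     (\<forall>x\<in>{0..real n}. (\<lambda>k. poly (map_poly of_rat (q n k)) x) \<longlonglongrightarrow> t_fun x) \<and>
     (\<forall>k. \<forall>z::complex. cmod z \<le> 1 \<longrightarrow> cmod (poly (map_poly of_rat (q n k)) z) \<le> 1))"

text \<open>A system is a pair of a set of axioms and a set of rules.\<close>

type_synonym system = "fm set \<times> (fm set \<times> fm) set"

definition rules :: "ty set \<Rightarrow> (fm set \<times> fm) set" where
  "rules D = {(P, A). rule_inst P A \<and> (\<forall>B\<in>P. wff D B) \<and> wff D A}"

definition TvNi :: "(nat \<Rightarrow> nat \<Rightarrow> rat poly) \<Rightarrow> ty set \<Rightarrow> system" where
  "TvNi q D = ({A. wff D A \<and> (logic_axiom A \<or> arith_axiom A \<or> qfac_axiom A \<or> algebra_axiom A \<or>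
      normed_axiom ninf A \<or> normed_axiom n2 A \<or> tracial_axiom A \<or> ball_axiom q A)}, rules D)"

definition TvNc :: "(nat \<Rightarrow> nat \<Rightarrow> rat poly) \<Rightarrow> ty set \<Rightarrow> system" where
  "TvNc q D = (fst (TvNi q D) \<union> {A. wff D A \<and> (\<exists>B. A = B \<^bold>\<or> Neg B)}, snd (TvNi q D))"

text \<open>All schemas range over the language with the constants \<open>Maj c\<close>.\<close>

definition TvNm :: "(nat \<Rightarrow> nat \<Rightarrow> rat poly) \<Rightarrow> ty set \<Rightarrow> system" where
  "TvNm q D = (fst (TvNc q D) \<union> {A. wff D A \<and> (\<exists>c. A = majf (vnty c) (Cst (VN c)) (Cst (Maj c)))},
     snd (TvNc q D))"

section \<open>Set-theoretic models\<close>

record 'u model =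
  mcar :: "ty \<Rightarrow> 'u set"
  mapp :: "'u \<Rightarrow> 'u \<Rightarrow> 'u"
  mint :: "cst \<Rightarrow> 'u"

fun tval :: "'u model \<Rightarrow> (var \<Rightarrow> 'u) \<Rightarrow> trm \<Rightarrow> 'u" where
  "tval M e (Var v) = e v"
| "tval M e (Cst c) = mint M c"
| "tval M e (s \<cdot> t) = mapp M (tval M e s) (tval M e t)"

fun sat :: "'u model \<Rightarrow> (var \<Rightarrow> 'u) \<Rightarrow> fm \<Rightarrow> bool" where
  "sat M e (s \<doteq> t) \<longleftrightarrow> tval M e s = tval M e t"
| "sat M e (A \<^bold>\<and> B) \<longleftrightarrow> sat M e A \<and> sat M e B"
| "sat M e (A \<^bold>\<or> B) \<longleftrightarrow> sat M e A \<or> sat M e B"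
| "sat M e (A \<^bold>\<rightarrow> B) \<longleftrightarrow> (sat M e A \<longrightarrow> sat M e B)"
| "sat M e (Forall v A) \<longleftrightarrow> (\<forall>a\<in>mcar M (snd v). sat M (e(v := a)) A)"
| "sat M e (Exists v A) \<longleftrightarrow> (\<exists>a\<in>mcar M (snd v). sat M (e(v := a)) A)"

definition valid :: "ty set \<Rightarrow> 'u model \<Rightarrow> fm \<Rightarrow> bool" where
  "valid D M A \<longleftrightarrow> (\<forall>e. (\<forall>v. snd v \<in> D \<longrightarrow> e v \<in> mcar M (snd v)) \<longrightarrow> sat M e A)"

definition is_model :: "ty set \<Rightarrow> 'u model \<Rightarrow> system \<Rightarrow> bool" where
  "is_model D M T \<longleftrightarrow>
     (\<forall>c. cst_ok c \<and> cty c \<in> D \<longrightarrow> mint M c \<in> mcar M (cty c)) \<and>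
     (\<forall>A\<in>fst T. valid D M A) \<and>
     (\<forall>(P, A)\<in>snd T. (\<forall>B\<in>P. valid D M B) \<longrightarrow> valid D M A)"

text \<open>The universe \<open>S\<^sub>0 = \<nat>\<close>, \<open>S\<^sub>X = A\<close>, \<open>S\<^bsub>\<rho>\<rightarrow>\<tau>\<^esub> = S\<^sub>\<tau>\<^bsup>S\<^sub>\<rho>\<^esup>\<close>, where \<open>A\<close> is the type \<open>'a\<close>. All \<open>S\<^sub>\<rho>\<close> are
  represented within one type \<open>'u\<close>: \<open>num\<close> and \<open>elt\<close> are bijections from \<open>\<nat>\<close> and \<open>A\<close> to the sets
  representing \<open>S\<^sub>0\<close> and \<open>S\<^sub>X\<close>, and \<open>app\<close> is a bijection from the set representing \<open>S\<^bsub>\<rho>\<rightarrow>\<tau>\<^esub>\<close> to the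
  set of all functions from \<open>S\<^sub>\<rho>\<close> to \<open>S\<^sub>\<tau>\<close>.

  The set of types \<open>tys\<close> is arbitrary, up to closure under subtypes. With \<open>tys = UNIV\<close> this is the
  whole universe at once. Its size is the supremum of the iterated powers of \<open>A\<close>, and HOL does not
  prove that a type of this size exists. But a formula or an instance of a rule only involves finitely
  many types, so its truth in the universe is already determined on a finite set \<open>tys\<close>. For finite \<open>tys\<close> a
  type \<open>'u\<close> does exist, by iterating the lemmas below.\<close>

record ('u, 'a) universe =
  tys :: "ty set"
  car :: "ty \<Rightarrow> 'u set"
  app :: "'u \<Rightarrow> 'u \<Rightarrow> 'u"
  num :: "nat \<Rightarrow> 'u"
  elt :: "'a \<Rightarrow> 'u"

definition full_universe :: "('u, 'a) universe \<Rightarrow> bool" where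
  "full_universe U \<longleftrightarrow>
     Nt \<in> tys U \<and> Xt \<in> tys U \<and> (\<forall>\<rho> \<tau>. Fn \<rho> \<tau> \<in> tys U \<longrightarrow> \<rho> \<in> tys U \<and> \<tau> \<in> tys U) \<and>
     bij_betw (num U) UNIV (car U Nt) \<and>
     bij_betw (elt U) UNIV (car U Xt) \<and>
     (\<forall>\<rho> \<tau>. Fn \<rho> \<tau> \<in> tys U \<longrightarrow>
        bij_betw (\<lambda>f. restrict (app U f) (car U \<rho>)) (car U (Fn \<rho> \<tau>)) (car U \<rho> \<rightarrow>\<^sub>E car U \<tau>))"

lemma full_universe_base:
  "full_universe \<lparr>tys = {Nt, Xt}, car = (\<lambda>\<rho>. if \<rho> = Nt then range Inl else range Inr),
     app = (\<lambda>_. undefined), num = Inl, elt = Inr :: 'a \<Rightarrow> nat + 'a\<rparr>"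
  by (auto simp: full_universe_def bij_betw_def)

definition extend :: "('u, 'a) universe \<Rightarrow> ('u + ('u \<Rightarrow> 'u), 'a) universe" where
  "extend U = \<lparr>tys = tys U \<union> {Fn \<rho> \<tau> | \<rho> \<tau>. \<rho> \<in> tys U \<and> \<tau> \<in> tys U},
     car = (\<lambda>\<sigma>. if \<sigma> \<in> tys U then Inl ` car U \<sigma>
                else case \<sigma> of Fn \<rho> \<tau> \<Rightarrow> Inr ` (car U \<rho> \<rightarrow>\<^sub>E car U \<tau>) | _ \<Rightarrow> {}),
     app = (\<lambda>f x. case f of Inl g \<Rightarrow> Inl (app U g (projl x)) | Inr g \<Rightarrow> Inl (g (projl x))),
     num = Inl \<circ> num U, elt = Inl \<circ> elt U\<rparr>"

lemma bij_betw_restrict_Inl: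
  "bij_betw (\<lambda>g. restrict (\<lambda>x. Inl (g (projl x))) (Inl ` A)) (A \<rightarrow>\<^sub>E B) (Inl ` A \<rightarrow>\<^sub>E Inl ` B)"
proof (rule bij_betwI[where g = "\<lambda>h. restrict (\<lambda>x. projl (h (Inl x))) A"])
  show "(\<lambda>g. restrict (\<lambda>x. Inl (g (projl x))) (Inl ` A)) \<in> (A \<rightarrow>\<^sub>E B) \<rightarrow> (Inl ` A \<rightarrow>\<^sub>E Inl ` B)"
    by auto
  show "(\<lambda>h. restrict (\<lambda>x. projl (h (Inl x))) A) \<in> (Inl ` A \<rightarrow>\<^sub>E Inl ` B) \<rightarrow> (A \<rightarrow>\<^sub>E B)"
  proof (rule funcsetI)
    fix h assume h: "h \<in> Inl ` A \<rightarrow>\<^sub>E Inl ` B"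
    have "projl (h (Inl x)) \<in> B" if "x \<in> A" for x
      using PiE_mem[OF h imageI[OF that]] by auto
    then show "restrict (\<lambda>x. projl (h (Inl x))) A \<in> A \<rightarrow>\<^sub>E B"
      by simp
  qed
next
  fix g assume "g \<in> A \<rightarrow>\<^sub>E B"
  then show "restrict (\<lambda>x. projl (restrict (\<lambda>x. Inl (g (projl x))) (Inl ` A) (Inl x))) A = g"
    by (auto simp: fun_eq_iff PiE_iff extensional_def)
next
  fix h assume h: "h \<in> Inl ` A \<rightarrow>\<^sub>E Inl ` B"
  show "restrict (\<lambda>x. Inl (restrict (\<lambda>x. projl (h (Inl x))) A (projl x))) (Inl ` A) = h"
  proof
    fix x
    show "restrict (\<lambda>x. Inl (restrict (\<lambda>x. projl (h (Inl x))) A (projl x))) (Inl ` A) x = h x"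
    proof (cases "x \<in> Inl ` A")
      case True
      with h have "h x \<in> Inl ` B" by auto
      with True show ?thesis by auto
    next
      case False
      with h have "h x = undefined" by (rule PiE_arb)
      with False show ?thesis by simp
    qed
  qed
qed

lemma full_universe_extend:
  fixes U :: "('u, 'a) universe"
  assumes U: "full_universe U"
  shows "full_universe (extend U)"
proof -
  have Inl: "bij_betw Inl A (Inl ` A)" for A :: "'u set"
    by (simp add: bij_betw_def)
  have bij_base: "bij_betw (num U) UNIV (car U Nt)" "bij_betw (elt U) UNIV (car U Xt)"
    and base: "Nt \<in> tys U" "Xt \<in> tys U"
    using U unfolding full_universe_def by blast+
  have clo: "\<And>\<rho> \<tau>. Fn \<rho> \<tau> \<in> tys U \<Longrightarrow> \<rho> \<in> tys U \<and> \<tau> \<in> tys U"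
    and bij: "\<And>\<rho> \<tau>. Fn \<rho> \<tau> \<in> tys U \<Longrightarrow>
      bij_betw (\<lambda>f. restrict (app U f) (car U \<rho>)) (car U (Fn \<rho> \<tau>)) (car U \<rho> \<rightarrow>\<^sub>E car U \<tau>)"
    using U unfolding full_universe_def by blast+
  have "bij_betw (\<lambda>f. restrict (app (extend U) f) (car (extend U) \<rho>))
          (car (extend U) (Fn \<rho> \<tau>)) (car (extend U) \<rho> \<rightarrow>\<^sub>E car (extend U) \<tau>)"
    if in_tys: "Fn \<rho> \<tau> \<in> tys (extend U)" for \<rho> \<tau>
  proof -
    let ?h = "\<lambda>g. restrict (\<lambda>x. Inl (g (projl x))) (Inl ` car U \<rho>)"
    have sub: "\<rho> \<in> tys U" "\<tau> \<in> tys U"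
      using in_tys by (auto simp: extend_def dest: clo)
    have h: "bij_betw ?h (car U \<rho> \<rightarrow>\<^sub>E car U \<tau>) (Inl ` car U \<rho> \<rightarrow>\<^sub>E Inl ` car U \<tau>)"
      by (rule bij_betw_restrict_Inl)
    show ?thesis
    proof (cases "Fn \<rho> \<tau> \<in> tys U")
      case True
      have "bij_betw projl (Inl ` car U (Fn \<rho> \<tau>)) (car U (Fn \<rho> \<tau>))"
        by (rule bij_betwI[where g = Inl]) auto
      note b = bij_betw_trans[OF bij_betw_trans[OF this bij[OF True]] h]
      have eq: "(?h \<circ> ((\<lambda>f. restrict (app U f) (car U \<rho>)) \<circ> projl)) f =
          restrict (app (extend U) f) (car (extend U) \<rho>)" if "f \<in> Inl ` car U (Fn \<rho> \<tau>)" for f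
        using that sub by (auto simp: extend_def fun_eq_iff)
      have "bij_betw (\<lambda>f. restrict (app (extend U) f) (car (extend U) \<rho>))
          (Inl ` car U (Fn \<rho> \<tau>)) (Inl ` car U \<rho> \<rightarrow>\<^sub>E Inl ` car U \<tau>)"
        by (rule iffD1[OF bij_betw_cong[OF eq] b])
      then show ?thesis
        using True sub by (simp add: extend_def)
    next
      case False
      have "bij_betw projr (Inr ` (car U \<rho> \<rightarrow>\<^sub>E car U \<tau>)) (car U \<rho> \<rightarrow>\<^sub>E car U \<tau>)"
        by (rule bij_betwI[where g = Inr]) auto
      note b = bij_betw_trans[OF this h]
      have eq: "(?h \<circ> projr) f = restrict (app (extend U) f) (car (extend U) \<rho>)"
        if "f \<in> Inr ` (car U \<rho> \<rightarrow>\<^sub>E car U \<tau>)" for f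
        using that sub by (auto simp: extend_def fun_eq_iff)
      have "bij_betw (\<lambda>f. restrict (app (extend U) f) (car (extend U) \<rho>))
          (Inr ` (car U \<rho> \<rightarrow>\<^sub>E car U \<tau>)) (Inl ` car U \<rho> \<rightarrow>\<^sub>E Inl ` car U \<tau>)"
        by (rule iffD1[OF bij_betw_cong[OF eq] b])
      then show ?thesis
        using False sub by (simp add: extend_def)
    qed
  qed
  moreover from bij_base[THEN bij_betw_trans[OF _ Inl]] base
  have "bij_betw (num (extend U)) UNIV (car (extend U) Nt)"
    "bij_betw (elt (extend U)) UNIV (car (extend U) Xt)"
    by (simp_all add: extend_def)
  moreover have "Nt \<in> tys (extend U)" "Xt \<in> tys (extend U)"
    using base by (simp_all add: extend_def)
  moreover have "\<rho> \<in> tys (extend U) \<and> \<tau> \<in> tys (extend U)" if "Fn \<rho> \<tau> \<in> tys (extend U)" for \<rho> \<tau>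
    using that by (auto simp: extend_def dest: clo)
  ultimately show ?thesis
    unfolding full_universe_def by blast
qed

section \<open>Tracial von Neumann algebras\<close>

locale complex_scaling =
  fixes sc :: "complex \<Rightarrow> 'v::real_normed_vector \<Rightarrow> 'v"
  assumes sc_add_right: "sc a (x + y) = sc a x + sc a y"
    and sc_add_left: "sc (a + b) x = sc a x + sc b x"
    and sc_sc: "sc a (sc b x) = sc (a * b) x"
    and sc_of_real: "sc (complex_of_real r) x = r *\<^sub>R x"
    and norm_sc: "norm (sc a x) = cmod a * norm x"

text \<open>Unital \<open>C\<^sup>*\<close>-algebras; the class contributes a real Banach algebra with \<open>\<parallel>1\<parallel> = 1\<close>.\<close>

locale cstar_algebra = complex_scaling sc
  for sc :: "complex \<Rightarrow> 'a::{real_normed_algebra_1, banach} \<Rightarrow> 'a" +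
  fixes star :: "'a \<Rightarrow> 'a"
  assumes sc_mult_left: "sc a x * y = sc a (x * y)"
    and sc_mult_right: "x * sc a y = sc a (x * y)"
    and star_star: "star (star x) = x"
    and star_add: "star (x + y) = star x + star y"
    and star_sc: "star (sc a x) = sc (cnj a) (star x)"
    and star_mult: "star (x * y) = star y * star x"
    and cstar: "norm (star x * x) = (norm x)\<^sup>2"
begin

definition le :: "'a \<Rightarrow> 'a \<Rightarrow> bool" where
  "le x y \<longleftrightarrow> (\<exists>z. y - x = star z * z)"

text \<open>An upward directed set of self-adjoint elements, as a net indexed by itself.\<close>

definition increasing_net :: "'a set \<Rightarrow> bool" where
  "increasing_net I \<longleftrightarrow> I \<noteq> {} \<and> (\<forall>x\<in>I. star x = x) \<and> (\<forall>x\<in>I. \<forall>y\<in>I. \<exists>z\<in>I. le x z \<and> le y z)"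

definition is_sup :: "'a set \<Rightarrow> 'a \<Rightarrow> bool" where
  "is_sup I s \<longleftrightarrow> (\<forall>x\<in>I. le x s) \<and> (\<forall>b. star b = b \<and> (\<forall>x\<in>I. le x b) \<longrightarrow> le s b)"

end

text \<open>The complex Banach space \<open>'p\<close> is a predual: \<open>J\<close> is an isometric complex-linear isomorphism onto the
  Banach space of bounded complex-linear functionals on \<open>'p\<close>.\<close>

locale von_neumann_algebra = cstar_algebra sc star + predual: complex_scaling scp
  for sc :: "complex \<Rightarrow> 'a::{real_normed_algebra_1, banach} \<Rightarrow> 'a" and star
    and scp :: "complex \<Rightarrow> 'p::banach \<Rightarrow> 'p" +
  fixes J :: "'a \<Rightarrow> 'p \<Rightarrow>\<^sub>L complex"
  assumes J_add: "J (x + y) = J x + J y"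
    and J_sc: "blinfun_apply (J (sc a x)) v = a * blinfun_apply (J x) v"
    and J_range: "range J = {f. \<forall>a v. blinfun_apply f (scp a v) = a * blinfun_apply f v}"
    and J_norm: "norm (J x) = norm x"

locale tracial_von_neumann_algebra = von_neumann_algebra sc star scp J
  for sc :: "complex \<Rightarrow> 'a::{real_normed_algebra_1, banach} \<Rightarrow> 'a" and star
    and scp :: "complex \<Rightarrow> 'p::banach \<Rightarrow> 'p" and J +
  fixes tr :: "'a \<Rightarrow> complex"
  assumes tr_add: "tr (x + y) = tr x + tr y"
    and tr_sc: "tr (sc a x) = a * tr x"
    and tr_star: "tr (star x) = cnj (tr x)"
    and tr_pos: "tr (star x * x) \<in> \<real>\<^sub>\<ge>\<^sub>0"
    and tr_faithful: "tr (star x * x) = 0 \<longleftrightarrow> x = 0"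
    and tr_one: "tr 1 = 1"
    and tr_normal: "increasing_net I \<Longrightarrow> is_sup I s \<Longrightarrow> \<epsilon> > 0 \<Longrightarrow>
      \<exists>x\<in>I. \<forall>y\<in>I. le x y \<longrightarrow> cmod (tr y - tr s) < \<epsilon>"
    and tr_commute: "tr (x * y) = tr (y * x)"

definition norm2 :: "('a::ring \<Rightarrow> 'a) \<Rightarrow> ('a \<Rightarrow> complex) \<Rightarrow> 'a \<Rightarrow> real" where
  "norm2 star tr x = sqrt (Re (tr (star x * x)))"

section \<open>The model associated to a tracial von Neumann algebra\<close>

definition circ :: "real \<Rightarrow> nat \<Rightarrow> nat" where
  "circ x n = prod_encode (2 * Max {k::nat. real k / 2 ^ (n + 1) \<le> x}, 2 ^ (n + 1) - 1)"

text \<open>If the maximum is \<open>0\<close>, then the subtraction of \<open>1\<close> from \<open>2 \<cdot> 0\<close> gives \<open>0\<close>, hence a code of \<open>0\<close>.\<close>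

definition circ_plus :: "real \<Rightarrow> nat \<Rightarrow> nat" where
  "circ_plus x n = (if x \<ge> 0 then circ x n
     else prod_encode (2 * Max {k::nat. real k / 2 ^ (n + 1) \<le> - x} - 1, 2 ^ (n + 1) - 1))"

definition rat_of_code :: "nat \<Rightarrow> real" where
  "rat_of_code c = (case prod_decode c of (n, m) \<Rightarrow>
     if even n then real n / (2 * real m + 2) else - (real n + 1) / (2 * real m + 2))"

definition hat_fun :: "(nat \<Rightarrow> nat) \<Rightarrow> nat \<Rightarrow> nat" where
  "hat_fun f n = f (LEAST k. k = n \<or>
     k < n \<and> \<bar>rat_of_code (f k) - rat_of_code (f (k + 1))\<bar> \<ge> 1 / 2 ^ (k + 1))"

definition real_of_code :: "(nat \<Rightarrow> nat) \<Rightarrow> real" where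
  "real_of_code f = lim (\<lambda>n. rat_of_code (hat_fun f n))"

text \<open>The element of \<open>S\<^bsub>\<rho>\<rightarrow>\<tau>\<^esub>\<close> representing the function \<open>f\<close>, and its curried version.\<close>

definition fun_code :: "('u, 'a) universe \<Rightarrow> ty \<Rightarrow> ty \<Rightarrow> ('u \<Rightarrow> 'u) \<Rightarrow> 'u" where
  "fun_code U \<rho> \<tau> f = (THE g. g \<in> car U (Fn \<rho> \<tau>) \<and> (\<forall>x\<in>car U \<rho>. app U g x = f x))"

fun funs_code :: "('u, 'a) universe \<Rightarrow> ty list \<Rightarrow> ty \<Rightarrow> ('u list \<Rightarrow> 'u) \<Rightarrow> 'u" where
  "funs_code U [] \<tau> f = f []"
| "funs_code U (\<rho> # \<rho>s) \<tau> f = fun_code U \<rho> (fns \<rho>s \<tau>) (\<lambda>x. funs_code U \<rho>s \<tau> (\<lambda>xs. f (x # xs)))"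

definition the_num :: "('u, 'a) universe \<Rightarrow> 'u \<Rightarrow> nat" where
  "the_num U = inv (num U)"

definition the_elt :: "('u, 'a) universe \<Rightarrow> 'u \<Rightarrow> 'a" where
  "the_elt U = inv (elt U)"

definition code1 :: "('u, 'a) universe \<Rightarrow> (nat \<Rightarrow> nat) \<Rightarrow> 'u" where
  "code1 U f = fun_code U Nt Nt (\<lambda>n. num U (f (the_num U n)))"

definition decode1 :: "('u, 'a) universe \<Rightarrow> 'u \<Rightarrow> nat \<Rightarrow> nat" where
  "decode1 U f n = the_num U (app U f (num U n))"

fun rec_val :: "('u, 'a) universe \<Rightarrow> 'u list \<Rightarrow> 'u list \<Rightarrow> nat \<Rightarrow> 'u list" where
  "rec_val U ys zs 0 = ys"
| "rec_val U ys zs (Suc n) = map (\<lambda>z. foldl (app U) z (rec_val U ys zs n @ [num U n])) zs"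

fun vn_int :: "('u, 'a::{real_normed_algebra_1, banach}) universe \<Rightarrow> (complex \<Rightarrow> 'a \<Rightarrow> 'a) \<Rightarrow>
    ('a \<Rightarrow> 'a) \<Rightarrow> ('a \<Rightarrow> complex) \<Rightarrow> vnc \<Rightarrow> 'u" where
  "vn_int U sc star tr ZeroX = elt U 0"
| "vn_int U sc star tr PlusX =
     fun_code U Xt (Fn Xt Xt) (\<lambda>x. fun_code U Xt Xt (\<lambda>y. elt U (the_elt U x + the_elt U y)))"
| "vn_int U sc star tr MinusX = fun_code U Xt Xt (\<lambda>x. elt U (- the_elt U x))"
| "vn_int U sc star tr ScaleX =
     fun_code U T1 (Fn T1 (Fn Xt Xt)) (\<lambda>f. fun_code U T1 (Fn Xt Xt) (\<lambda>g. fun_code U Xt Xt (\<lambda>x.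
       elt U (sc (Complex (real_of_code (decode1 U f)) (real_of_code (decode1 U g))) (the_elt U x)))))"
| "vn_int U sc star tr TimesX =
     fun_code U Xt (Fn Xt Xt) (\<lambda>x. fun_code U Xt Xt (\<lambda>y. elt U (the_elt U x * the_elt U y)))"
| "vn_int U sc star tr OneX = elt U 1"
| "vn_int U sc star tr StarX = fun_code U Xt Xt (\<lambda>x. elt U (star (the_elt U x)))"
| "vn_int U sc star tr NormInf = fun_code U Xt T1 (\<lambda>x. code1 U (circ (norm (the_elt U x))))"
| "vn_int U sc star tr Norm2 = fun_code U Xt T1 (\<lambda>x. code1 U (circ (norm2 star tr (the_elt U x))))"
| "vn_int U sc star tr TrRe = fun_code U Xt T1 (\<lambda>x. code1 U (circ_plus (Re (tr (the_elt U x)))))"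
| "vn_int U sc star tr TrIm = fun_code U Xt T1 (\<lambda>x. code1 U (circ_plus (Im (tr (the_elt U x)))))"

fun maj_int :: "('u, 'a) universe \<Rightarrow> vnc \<Rightarrow> 'u" where
  "maj_int U ZeroX = num U 0"
| "maj_int U PlusX =
     fun_code U Nt T1 (\<lambda>n. fun_code U Nt Nt (\<lambda>m. num U (the_num U n + the_num U m)))"
| "maj_int U MinusX = fun_code U Nt Nt (\<lambda>n. n)"
| "maj_int U ScaleX =
     fun_code U T1 (Fn T1 T1) (\<lambda>f. fun_code U T1 T1 (\<lambda>g. fun_code U Nt Nt (\<lambda>n.
       num U ((decode1 U f 0 + decode1 U g 0 + 2) * the_num U n))))"
| "maj_int U TimesX =
     fun_code U Nt T1 (\<lambda>n. fun_code U Nt Nt (\<lambda>m. num U (the_num U n * the_num U m)))"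
| "maj_int U OneX = num U 1"
| "maj_int U StarX = fun_code U Nt Nt (\<lambda>n. n)"
| "maj_int U NormInf = fun_code U Nt T1 (\<lambda>n. code1 U (circ (real (the_num U n))))"
| "maj_int U Norm2 = fun_code U Nt T1 (\<lambda>n. code1 U (circ (real (the_num U n))))"
| "maj_int U TrRe = fun_code U Nt T1 (\<lambda>n. code1 U (circ (real (the_num U n))))"
| "maj_int U TrIm = fun_code U Nt T1 (\<lambda>n. code1 U (circ (real (the_num U n))))"

fun cst_int :: "('u, 'a::{real_normed_algebra_1, banach}) universe \<Rightarrow> (complex \<Rightarrow> 'a \<Rightarrow> 'a) \<Rightarrow>
    ('a \<Rightarrow> 'a) \<Rightarrow> ('a \<Rightarrow> complex) \<Rightarrow> cst \<Rightarrow> 'u" where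
  "cst_int U sc star tr Zero = num U 0"
| "cst_int U sc star tr Succ = fun_code U Nt Nt (\<lambda>n. num U (Suc (the_num U n)))"
| "cst_int U sc star tr (Pi \<rho> \<tau>) = fun_code U \<rho> (Fn \<tau> \<rho>) (\<lambda>x. fun_code U \<tau> \<rho> (\<lambda>y. x))"
| "cst_int U sc star tr (Sig \<delta> \<rho> \<tau>) =
     fun_code U (Fn \<delta> (Fn \<rho> \<tau>)) (Fn (Fn \<delta> \<rho>) (Fn \<delta> \<tau>)) (\<lambda>x.
       fun_code U (Fn \<delta> \<rho>) (Fn \<delta> \<tau>) (\<lambda>y. fun_code U \<delta> \<tau> (\<lambda>z. app U (app U x z) (app U y z))))"
| "cst_int U sc star tr (Rec \<rho>s i) =
     funs_code U (Nt # \<rho>s @ map (stepty \<rho>s) \<rho>s) (\<rho>s ! i) (\<lambda>as.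
       rec_val U (take (length \<rho>s) (tl as)) (drop (length \<rho>s) (tl as)) (the_num U (hd as)) ! i)"
| "cst_int U sc star tr (VN c) = vn_int U sc star tr c"
| "cst_int U sc star tr (Maj c) = maj_int U c"

definition assoc_model :: "('u, 'a::{real_normed_algebra_1, banach}) universe \<Rightarrow>
    (complex \<Rightarrow> 'a \<Rightarrow> 'a) \<Rightarrow> ('a \<Rightarrow> 'a) \<Rightarrow> ('a \<Rightarrow> complex) \<Rightarrow> 'u model" where
  "assoc_model U sc star tr = \<lparr>mcar = car U, mapp = app U, mint = cst_int U sc star tr\<rparr>"

end

theory Submission
  imports Defs
begin

text \<open>Soundness is a routine induction once the value of every term of type \<open>0\<close>, \<open>1\<close> and \<open>X\<close> is known:
  \<open>=\<^sub>r\<close> and \<open>\<le>\<^sub>r\<close> become equality and order of the represented reals, and each axiom becomes a statement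
  about the algebra. The only deep one is the bound on \<open>q\<^sub>n\<^sub>,\<^sub>k(T)\<close> for a contraction \<open>T\<close>, which is von
  Neumann's inequality. It is proved without a Hilbert space representation. The faithful trace shows
  that a self-adjoint \<open>b\<close> with \<open>tr (y\<^sup>* b y) \<ge> 0\<close> for all \<open>y\<close> is a square, so an element that acts on
  \<open>\<parallel>_\<parallel>\<^sub>2\<close> as a contraction has norm at most \<open>1\<close>; and \<open>\<parallel>p(T) y\<parallel>\<^sub>2\<close> is bounded through the moments
  \<open>tr (y\<^sup>* T\<^sup>d y)\<close>, a positive definite function of \<open>d\<close>.\<close>

section \<open>Square roots in Banach algebras\<close>

text \<open>A contraction \<open>T\<close> need not be normal, so no commutative spectral theory
  applies to it, and no functional calculus is presupposed even for self-adjoint elements. The only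
  analytic tool is the binomial series of sqrt(1 - x), with coefficients \<open>sqrt_coeff\<close>.
  These are absolutely summable, so the series converges on the closed unit ball; it yields in turn
  absolute values, roots of elements that the trace sees as positive, and the comparison of the two
  norms. Extended to negative exponents by conjugation, the moments are those that a unitary
  dilation of \<open>T\<close> would have. Their positive definiteness comes from an induction on
  the degree that uses only \<open>norm T \<le> 1\<close>, so no dilation is built, and averages
  over roots of unity replace integration against the measure that Herglotz's theorem would provide.
  On the syntactic side the types are restricted to a set \<open>D\<close>, and a formula has to
  reveal that the types of its parts lie in \<open>D\<close> before these parts can be evaluated.
  Much of the treatment of terms serves to recover this information.\<close>

definition sqrt_coeff :: "nat \<Rightarrow> real" where
  "sqrt_coeff n = ((1/2) gchoose n) * (-1) ^ n"

lemma sqrt_coeff_0: "sqrt_coeff 0 = 1"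
  by (simp add: sqrt_coeff_def)

text \<open>These are the Taylor coefficients of 1/sqrt(1 - x); consecutive ones have the positive
  ratio (1/2 + n)/(n + 1).\<close>

lemma gbinomial_minus_half_nonneg: "((-1/2::real) gchoose n) * (-1) ^ n \<ge> 0"
proof (induction n)
  case (Suc n)
  have "((-1/2::real) gchoose Suc n) * (-1) ^ Suc n
      = (((-1/2) gchoose n) * (-1) ^ n) * ((1/2 + real n) / real (Suc n))"
    by (simp add: gbinomial_prod_rev field_simps)
  with Suc show ?case by (simp del: power_Suc)
qed simp

text \<open>The derivative of sqrt(1 - x) is -1/2 times 1/sqrt(1 - x); comparing coefficients
  reduces the sign to the previous lemma.\<close>

lemma sqrt_coeff_nonpos: "sqrt_coeff (Suc n) \<le> 0"
proof -
  have "sqrt_coeff (Suc n) = - ((1/2) / real (Suc n)) * (((-1/2) gchoose n) * (-1) ^ n)"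
    using gbinomial_absorption'[of "Suc n" "1/2::real"]
    by (simp add: sqrt_coeff_def field_simps)
  with gbinomial_minus_half_nonneg[of n] show ?thesis
    by (simp add: mult_nonneg_nonneg del: times_divide_eq_left)
qed

text \<open>Dividing a power series by 1 - x forms the partial sums of its coefficients, and sqrt(1
  - x)/(1 - x) is 1/sqrt(1 - x).\<close>

lemma sum_sqrt_coeff_nonneg: "(\<Sum>k\<le>n. sqrt_coeff k) \<ge> 0"
  using gbinomial_minus_half_nonneg[of n] gbinomial_sum_lower_neg[of "1/2::real" n]
  by (simp add: sqrt_coeff_def mult.commute)

text \<open>All coefficients after the constant term 1 have the same sign, so their absolute sum is
  1 minus a nonnegative partial sum. This makes the series usable at norm exactly 1.\<close>

lemma sum_abs_sqrt_coeff: "(\<Sum>k<n. \<bar>sqrt_coeff (Suc k)\<bar>) \<le> 1"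
proof -
  have "(\<Sum>k<n. \<bar>sqrt_coeff (Suc k)\<bar>) = (\<Sum>k<n. - sqrt_coeff (Suc k))"
    by (rule sum.cong) (use sqrt_coeff_nonpos in auto)
  moreover have "(\<Sum>k\<le>n. sqrt_coeff k) = 1 + (\<Sum>k<n. sqrt_coeff (Suc k))"
    by (subst lessThan_Suc_atMost[symmetric], subst sum.lessThan_Suc_shift) (simp add: sqrt_coeff_0)
  ultimately show ?thesis
    using sum_sqrt_coeff_nonneg[of n] by (simp add: sum_negf)
qed

lemma summable_abs_sqrt_coeff_Suc: "summable (\<lambda>k. \<bar>sqrt_coeff (Suc k)\<bar>)"
  and suminf_abs_sqrt_coeff_Suc: "(\<Sum>k. \<bar>sqrt_coeff (Suc k)\<bar>) \<le> 1"
proof -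
  show "summable (\<lambda>k. \<bar>sqrt_coeff (Suc k)\<bar>)"
    by (rule bounded_imp_summable[where B = 1])
       (use sum_abs_sqrt_coeff[of "Suc n" for n] in \<open>auto simp: lessThan_Suc_atMost\<close>)
  then show "(\<Sum>k. \<bar>sqrt_coeff (Suc k)\<bar>) \<le> 1"
    by (rule suminf_le_const) (rule sum_abs_sqrt_coeff)
qed

text \<open>Vandermonde's identity for 1/2 + 1/2 = 1: the square of the series is 1 - x.\<close>

lemma sqrt_coeff_convolution:
  "(\<Sum>i\<le>k. sqrt_coeff i * sqrt_coeff (k - i)) = (if k = 0 then 1 else if k = 1 then -1 else 0)"
proof -
  have "(\<Sum>i\<le>k. sqrt_coeff i * sqrt_coeff (k - i))
      = (-1) ^ k * (\<Sum>i\<le>k. ((1/2) gchoose i) * ((1/2) gchoose (k - i)))"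
    unfolding sqrt_coeff_def sum_distrib_left
    by (rule sum.cong) (auto simp: power_add[symmetric])
  also have "(\<Sum>i\<le>k. ((1/2::real) gchoose i) * ((1/2) gchoose (k - i))) = (1 gchoose k)"
    using gbinomial_Vandermonde[of "1/2::real" "1/2" k] by (simp add: atMost_atLeast0)
  also have "(1 gchoose k) = (if k \<le> 1 then 1 else 0 :: real)"
    using binomial_gbinomial[of 1 k, where 'a = real]
    by (cases "k \<le> 1") (auto simp: le_Suc_eq binomial_eq_0)
  finally show ?thesis by (auto simp: le_Suc_eq)
qed

definition sqrt_one_minus :: "'a::{real_normed_algebra_1, banach} \<Rightarrow> 'a" where
  "sqrt_one_minus x = (\<Sum>n. sqrt_coeff n *\<^sub>R x ^ n)"

context
  fixes x :: "'a::{real_normed_algebra_1, banach}"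
  assumes x: "norm x \<le> 1"
begin

lemma norm_sqrt_term_le: "norm (sqrt_coeff n *\<^sub>R x ^ n) \<le> \<bar>sqrt_coeff n\<bar>"
proof -
  have "norm (x ^ n) \<le> 1"
    using norm_power_ineq[of x n] power_le_one[OF norm_ge_zero x, of n] by linarith
  then show ?thesis by (simp add: mult_left_le)
qed

lemma summable_norm_sqrt: "summable (\<lambda>n. norm (sqrt_coeff n *\<^sub>R x ^ n))"
proof (rule summable_comparison_test'[where N = 0])
  show "summable (\<lambda>n. \<bar>sqrt_coeff n\<bar>)"
    using summable_abs_sqrt_coeff_Suc by (subst (asm) summable_Suc_iff)
qed (use norm_sqrt_term_le in auto)

lemmas summable_sqrt = summable_norm_cancel[OF summable_norm_sqrt]

lemma sqrt_one_minus_square: "sqrt_one_minus x * sqrt_one_minus x = 1 - x"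
proof -
  have "(\<lambda>k. \<Sum>i\<le>k. (sqrt_coeff i *\<^sub>R x ^ i) * (sqrt_coeff (k - i) *\<^sub>R x ^ (k - i)))
      sums (sqrt_one_minus x * sqrt_one_minus x)"
    unfolding sqrt_one_minus_def by (rule Cauchy_product_sums[OF summable_norm_sqrt summable_norm_sqrt])
  also have "(\<lambda>k. \<Sum>i\<le>k. (sqrt_coeff i *\<^sub>R x ^ i) * (sqrt_coeff (k - i) *\<^sub>R x ^ (k - i)))
      = (\<lambda>k. (\<Sum>i\<le>k. sqrt_coeff i * sqrt_coeff (k - i)) *\<^sub>R x ^ k)"
    by (auto simp: fun_eq_iff scaleR_sum_left power_add[symmetric] intro!: sum.cong)
  finally have s: "(\<lambda>k. (if k = 0 then 1 else if k = 1 then -1 else 0) *\<^sub>R x ^ k)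
      sums (sqrt_one_minus x * sqrt_one_minus x)"
    by (simp add: sqrt_coeff_convolution)
  have "(\<lambda>k. (if k = 0 then 1 else if k = 1 then -1 else 0) *\<^sub>R x ^ k) sums
     (\<Sum>k\<in>{0,1}. (if k = 0 then 1 else if k = 1 then -1 else 0) *\<^sub>R x ^ k)"
    by (rule sums_finite) auto
  then show ?thesis
    using sums_unique2[OF s] by simp
qed

text \<open>Without its constant term the series is bounded by the sum of the absolute coefficients.
  Hence the series can be applied a second time, to the complement of a root, which produces fourth
  roots.\<close>

lemma norm_one_minus_sqrt_le: "norm (1 - sqrt_one_minus x) \<le> 1"
proof -
  have sm: "summable (\<lambda>n. norm (sqrt_coeff (Suc n) *\<^sub>R x ^ Suc n))"
    using summable_norm_sqrt by (subst summable_Suc_iff)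
  have "sqrt_one_minus x = (\<Sum>n. sqrt_coeff (Suc n) *\<^sub>R x ^ Suc n) + 1"
    unfolding sqrt_one_minus_def using suminf_split_head[OF summable_sqrt] by (simp add: sqrt_coeff_0)
  then have "norm (1 - sqrt_one_minus x) = norm (\<Sum>n. sqrt_coeff (Suc n) *\<^sub>R x ^ Suc n)"
    by simp
  also have "\<dots> \<le> (\<Sum>n. norm (sqrt_coeff (Suc n) *\<^sub>R x ^ Suc n))"
    by (rule summable_norm[OF sm])
  also have "\<dots> \<le> (\<Sum>n. \<bar>sqrt_coeff (Suc n)\<bar>)"
    by (rule suminf_le[OF norm_sqrt_term_le sm summable_abs_sqrt_coeff_Suc])
  finally show ?thesis using suminf_abs_sqrt_coeff_Suc by linarith
qed

lemma sqrt_one_minus_commute: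
  assumes "z * x = x * z"
  shows "z * sqrt_one_minus x = sqrt_one_minus x * z"
proof -
  have "z * x ^ n = x ^ n * z" for n
    using power_commuting_commutes[OF assms[symmetric], of n] by simp
  then have "(\<Sum>n. z * (sqrt_coeff n *\<^sub>R x ^ n)) = (\<Sum>n. (sqrt_coeff n *\<^sub>R x ^ n) * z)"
    by simp
  then show ?thesis
    unfolding sqrt_one_minus_def
    by (simp only: suminf_mult[OF summable_sqrt] suminf_mult2[OF summable_sqrt, symmetric])
qed

text \<open>Meant for \<open>f = star\<close>: continuity carries self-adjointness from the powers
  to the limit.\<close>

lemma sqrt_one_minus_invariant:
  assumes "bounded_linear f" and "\<And>n. f (x ^ n) = x ^ n"
  shows "f (sqrt_one_minus x) = sqrt_one_minus x"
proof -
  interpret f: bounded_linear f by fact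
  show ?thesis
    unfolding sqrt_one_minus_def by (subst f.suminf[OF summable_sqrt]) (simp add: f.scaleR assms)
qed

end

section \<open>Algebras with a faithful trace\<close>

context complex_scaling begin

lemma sc_one [simp]: "sc 1 x = x"
  using sc_of_real[of 1] by simp

lemma sc_zero_left [simp]: "sc 0 x = 0"
  using sc_of_real[of 0] by simp

lemma sc_zero_right [simp]: "sc a 0 = 0"
  using sc_add_right[of a 0 0] by simp

lemma sc_minus_left: "sc (- a) x = - sc a x"
  using sc_add_left[of a "- a" x] by (simp add: add_eq_0_iff)

lemma sc_minus_right: "sc a (- x) = - sc a x"
  using sc_add_right[of a x "- x"] by (simp add: add_eq_0_iff)

lemma sc_diff_left: "sc (a - b) x = sc a x - sc b x"
  using sc_add_left[of a "- b"] by (simp add: sc_minus_left)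

lemma sc_diff_right: "sc a (x - y) = sc a x - sc a y"
  using sc_add_right[of a x "- y"] by (simp add: sc_minus_right)

lemma sc_sum_right: "sc a (sum f A) = (\<Sum>i\<in>A. sc a (f i))"
  by (induction A rule: infinite_finite_induct) (auto simp: sc_add_right)

lemma sc_scaleR: "sc a (r *\<^sub>R x) = r *\<^sub>R sc a x"
  by (simp add: sc_sc mult.commute flip: sc_of_real)

end

context cstar_algebra begin

lemma star_zero [simp]: "star 0 = 0"
  using star_add[of 0 0] by simp

lemma star_one [simp]: "star 1 = 1"
  using star_mult[of "star 1" 1] by (simp add: star_star)

lemma star_minus: "star (- x) = - star x"
  using star_add[of x "- x"] by (simp add: add_eq_0_iff)

lemma star_diff: "star (x - y) = star x - star y"
  using star_add[of x "- y"] by (simp add: star_minus)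

lemma star_scaleR: "star (r *\<^sub>R x) = r *\<^sub>R star x"
  by (simp add: star_sc flip: sc_of_real)

lemma norm_star: "norm (star x) = norm x"
proof -
  have "norm x \<le> norm (star x)" for x
  proof (cases "x = 0")
    case False
    have "norm x * norm x \<le> norm (star x) * norm x"
      using cstar[of x] norm_mult_ineq[of "star x" x] by (simp add: power2_eq_square)
    with False show ?thesis by simp
  qed simp
  from this[of x] this[of "star x"] show ?thesis by (simp add: star_star)
qed

lemma bounded_linear_star: "bounded_linear star"
  by (rule bounded_linear_intro[where K = 1]) (simp_all add: star_add star_scaleR norm_star)

lemma star_power: "star (x ^ n) = star x ^ n"
  by (induction n) (simp_all add: star_mult power_commutes)

lemma norm_square_selfadjoint: "star b = b \<Longrightarrow> norm (b * b) = (norm b)\<^sup>2"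
  using cstar[of b] by simp

lemma star_sqrt_one_minus: "norm x \<le> 1 \<Longrightarrow> star x = x \<Longrightarrow> star (sqrt_one_minus x) = sqrt_one_minus x"
  by (rule sqrt_one_minus_invariant[OF _ bounded_linear_star]) (simp_all add: star_power)

text \<open>The element \<open>w = a + \<i>b\<close> satisfies \<open>w\<^sup>* w = K\<^sup>2\<close>, and \<open>a\<close>, \<open>b\<close> are its real and imaginary part.\<close>

lemma norm_le_of_sum_squares:
  assumes "star a = a" "star b = b" "a * b = b * a" "a * a + b * b = (K\<^sup>2) *\<^sub>R 1" "K \<ge> 0"
  shows "norm a \<le> K" "norm b \<le> K"
proof -
  let ?w = "a + sc \<i> b"
  have st: "star ?w = a - sc \<i> b"
    using assms by (simp add: star_add star_sc sc_minus_left)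
  have "star ?w * ?w = a * a + b * b"
    unfolding st using \<open>a * b = b * a\<close>
    by (simp add: algebra_simps sc_mult_left sc_mult_right sc_sc sc_minus_left sc_diff_right)
  then have "(norm ?w)\<^sup>2 = K\<^sup>2"
    using cstar[of ?w] assms by simp
  then have w: "norm ?w = K"
    using \<open>K \<ge> 0\<close> by (simp add: power2_eq_iff_nonneg)
  then have st: "norm (a - sc \<i> b) = K"
    using norm_star[of ?w] by (simp add: st)
  have "2 *\<^sub>R a = ?w + (a - sc \<i> b)" "sc (2 * \<i>) b = ?w - (a - sc \<i> b)"
    by (simp_all add: scaleR_2 sc_add_left[symmetric])
  then have "norm (2 *\<^sub>R a) \<le> 2 * K" "norm (sc (2 * \<i>) b) \<le> 2 * K"
    using norm_triangle_ineq[of ?w "a - sc \<i> b"] norm_triangle_ineq4[of ?w "a - sc \<i> b"] w st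
    by simp_all
  then show "norm a \<le> K" "norm b \<le> K"
    by (simp_all add: norm_sc norm_mult)
qed

text \<open>The root s of 1 - b^2 commutes with b and b^2 + s^2 = 1, so
  \<open>norm_le_of_sum_squares\<close> bounds s, and with it s^2. The triangle inequality alone
  would give 2, outside the ball of convergence.\<close>

lemma norm_one_minus_square_le:
  assumes "star b = b" "norm b \<le> 1"
  shows "norm (1 - b * b) \<le> 1"
proof -
  let ?s = "sqrt_one_minus (b * b)"
  have bb: "norm (b * b) \<le> 1"
    using assms by (simp add: norm_square_selfadjoint power_le_one)
  have s: "star ?s = ?s"
    using assms by (intro star_sqrt_one_minus bb) (simp add: star_mult)
  have s2: "?s * ?s = 1 - b * b"
    by (rule sqrt_one_minus_square[OF bb])
  have "norm ?s \<le> 1"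
  proof (rule norm_le_of_sum_squares(2))
    show "b * ?s = ?s * b"
      by (rule sqrt_one_minus_commute[OF bb]) (simp add: mult.assoc)
  qed (use assms s s2 in auto)
  then show ?thesis
    using norm_square_selfadjoint[OF s] s2 by (simp add: power_le_one)
qed

end

section \<open>Positivity and norms seen through the trace\<close>

context tracial_von_neumann_algebra begin

abbreviation n2 :: "'a \<Rightarrow> real" where "n2 \<equiv> norm2 star tr"

lemma tr_zero [simp]: "tr 0 = 0"
  using tr_add[of 0 0] by simp

lemma tr_minus: "tr (- x) = - tr x"
  using tr_add[of x "- x"] by (simp add: add_eq_0_iff)

lemma tr_diff: "tr (x - y) = tr x - tr y"
  using tr_add[of x "- y"] by (simp add: tr_minus)

lemma tr_scaleR: "tr (r *\<^sub>R x) = r * tr x"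
  by (simp add: tr_sc flip: sc_of_real)

lemma tr_sum: "tr (sum f A) = (\<Sum>i\<in>A. tr (f i))"
  by (induction A rule: infinite_finite_induct) (auto simp: tr_add)

lemma tr_star_mult_self: "tr (star x * x) = complex_of_real ((n2 x)\<^sup>2)"
  using tr_pos[of x]
  by (auto simp: norm2_def complex_nonneg_Reals_iff complex_eq_iff simp del: of_real_power)

lemma n2_nonneg: "n2 x \<ge> 0"
  using tr_pos[of x] by (simp add: norm2_def complex_nonneg_Reals_iff)

lemma n2_eq_0_iff: "n2 x = 0 \<longleftrightarrow> x = 0"
  using tr_faithful[of x] by (simp add: tr_star_mult_self)

lemma n2_zero [simp]: "n2 0 = 0"
  by (simp add: n2_eq_0_iff)

lemma selfadjoint_eq_0: "star x = x \<Longrightarrow> x * x = 0 \<Longrightarrow> x = 0"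
  using cstar[of x] by simp

text \<open>With \<open>b\<^sup>- = (|b| - b)/2\<close>, positivity gives \<open>tr ((b\<^sup>-)\<^sup>3) \<le> 0\<close>, hence \<open>b\<^sup>- = 0\<close> and \<open>b = |b|\<close>.\<close>

lemma trace_positive_imp_square_aux:
  assumes b: "star b = b" and nb: "norm b \<le> 1"
    and pos: "\<And>y. Re (tr (star y * b * y)) \<ge> 0"
  shows "\<exists>c. star c = c \<and> c * c = b \<and> (\<forall>z. z * b = b * z \<longrightarrow> z * c = c * z)"
proof -
  define d where "d = 1 - b * b"
  \<comment> \<open>Here \<open>m\<close> is the absolute value of \<open>b\<close>, as the root of
    \<open>1 - d = b * b\<close>; \<open>e\<close> is the root of \<open>m\<close>, and
    \<open>g\<close> below is the negative part of \<open>b\<close>.\<close>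
  define m where "m = sqrt_one_minus d"
  define e where "e = sqrt_one_minus (1 - m)"
  have nd: "norm d \<le> 1"
    unfolding d_def by (rule norm_one_minus_square_le[OF b nb])
  have m2: "m * m = b * b"
    using sqrt_one_minus_square[OF nd] by (simp add: m_def d_def)
  have n1: "norm (1 - m) \<le> 1"
    unfolding m_def by (rule norm_one_minus_sqrt_le[OF nd])
  have e2: "e * e = m"
    using sqrt_one_minus_square[OF n1] by (simp add: e_def)
  have sd: "star d = d" by (simp add: d_def star_diff star_mult b)
  have sm: "star m = m" unfolding m_def by (rule star_sqrt_one_minus[OF nd sd])
  have se: "star e = e" unfolding e_def
    by (rule star_sqrt_one_minus[OF n1]) (simp add: star_diff sm)
  have cm: "z * m = m * z" if "z * b = b * z" for z
    unfolding m_def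
  proof (rule sqrt_one_minus_commute[OF nd])
    have "z * (b * b) = b * b * z"
      using that by (simp add: mult.assoc flip: mult.assoc[of z])
    then show "z * d = d * z" by (simp add: d_def algebra_simps)
  qed
  have ce: "z * e = e * z" if "z * b = b * z" for z
    unfolding e_def by (rule sqrt_one_minus_commute[OF n1]) (simp add: cm[OF that] algebra_simps)
  define g where "g = (1/2::real) *\<^sub>R (m - b)"
  have bm: "b * m = m * b" by (rule cm) simp
  have sg: "star g = g" by (simp add: g_def star_scaleR star_diff sm b)
  have gb: "g * b = b * g" by (simp add: g_def algebra_simps bm)
  have ge: "g * e = e * g" by (rule ce[OF gb])
  have mgb: "m * g = - (b * g)"
    by (simp add: g_def algebra_simps bm m2)
  \<comment> \<open>Since \<open>e * e = m\<close> and \<open>m * g = - (b * g)\<close>, the form of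
    \<open>b\<close> at \<open>g\<close> is minus a square, which positivity forces to
    vanish.\<close>
  have bg: "star g * b * g = - (star (e * g) * (e * g))"
  proof -
    have "star (e * g) * (e * g) = g * (e * e) * g"
      by (simp add: star_mult sg se mult.assoc)
    also have "\<dots> = - (g * b * g)"
      by (simp add: e2 mult.assoc mgb)
    finally show ?thesis by (simp add: sg)
  qed
  have "n2 (e * g) = 0"
    using pos[of g] by (simp add: bg tr_minus tr_star_mult_self)
  then have "e * g = 0" by (simp add: n2_eq_0_iff)
  then have "m * g = 0" by (simp add: e2[symmetric] mult.assoc)
  moreover from this mgb have "b * g = 0" by simp
  ultimately have "g * g = 0" by (subst (1) g_def) (simp add: algebra_simps)
  then have "g = 0" by (rule selfadjoint_eq_0[OF sg])
  then have "m = b" by (simp add: g_def)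
  with e2 se ce show ?thesis by blast
qed

text \<open>Rescaling reduces to norm at most 1. The commutation clause ensures that roots of two
  commuting elements commute again.\<close>

lemma trace_positive_imp_square:
  assumes b: "star b = b" and pos: "\<And>y. Re (tr (star y * b * y)) \<ge> 0"
  obtains c where "star c = c" "c * c = b" "\<And>z. z * b = b * z \<Longrightarrow> z * c = c * z"
proof (cases "b = 0")
  case True
  then show ?thesis using that[of 0] by simp
next
  case False
  let ?b = "(1 / norm b) *\<^sub>R b"
  have "\<exists>c. star c = c \<and> c * c = ?b \<and> (\<forall>z. z * ?b = ?b * z \<longrightarrow> z * c = c * z)"
  proof (rule trace_positive_imp_square_aux)
    show "Re (tr (star y * ?b * y)) \<ge> 0" for y
      using pos[of y] by (simp add: tr_scaleR)
  qed (use b False in \<open>auto simp: star_scaleR\<close>)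
  then obtain c where c: "star c = c" "c * c = ?b" "\<And>z. z * ?b = ?b * z \<Longrightarrow> z * c = c * z"
    by blast
  show ?thesis
  proof (rule that[of "sqrt (norm b) *\<^sub>R c"])
    show "z * (sqrt (norm b) *\<^sub>R c) = sqrt (norm b) *\<^sub>R c * z" if "z * b = b * z" for z
      using c(3)[of z] that by simp
  qed (use c(1,2) False in \<open>simp_all add: star_scaleR\<close>)
qed

lemma tr_cyclic: "tr (star y * (star x * x) * y) = tr (star (x * y) * (x * y))"
  by (simp add: star_mult mult.assoc)

text \<open>With h^2 = x* x and c^2 = K^2 - x* x, both available because the trace form is
  nonnegative, h and c commute and h^2 + c^2 = K^2. So h has norm at most K, and h and x have the
  same norm by the C*-identity. This does the work of a faithful representation on the completion
  for \<open>n2\<close>.\<close>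

lemma norm_le_of_n2_le:
  assumes K: "K \<ge> 0" and le: "\<And>y. n2 (x * y) \<le> K * n2 y"
  shows "norm x \<le> K"
proof -
  define a where "a = star x * x"
  have sa: "star a = a" by (simp add: a_def star_mult star_star)
  obtain h where h: "star h = h" "h * h = a" "\<And>z. z * a = a * z \<Longrightarrow> z * h = h * z"
  proof (rule trace_positive_imp_square[OF sa])
    show "Re (tr (star y * a * y)) \<ge> 0" for y
      by (simp add: a_def tr_cyclic tr_star_mult_self)
  qed blast
  define b where "b = (K\<^sup>2) *\<^sub>R 1 - a"
  have sb: "star b = b" by (simp add: b_def star_diff star_scaleR sa)
  have ab: "a * b = b * a" by (simp add: b_def algebra_simps)
  obtain c where c: "star c = c" "c * c = b" "\<And>z. z * b = b * z \<Longrightarrow> z * c = c * z"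
  proof (rule trace_positive_imp_square[OF sb])
    fix y
    have "tr (star y * b * y) = complex_of_real ((K * n2 y)\<^sup>2 - (n2 (x * y))\<^sup>2)"
      by (simp add: b_def a_def left_diff_distrib right_diff_distrib tr_diff tr_cyclic
          tr_star_mult_self tr_scaleR power_mult_distrib)
    then show "Re (tr (star y * b * y)) \<ge> 0"
      using power_mono[OF le[of y] n2_nonneg, of 2] by simp
  qed blast
  have "norm h \<le> K"
  proof (rule norm_le_of_sum_squares(1))
    have "c * a = a * c" using c(3)[OF ab] by simp
    then show "h * c = c * h" using h(3)[of c] by simp
    show "h * h + c * c = (K\<^sup>2) *\<^sub>R 1" by (simp add: h(2) c(2) b_def)
  qed (use K h(1) c(1) in auto)
  then have "(norm x)\<^sup>2 \<le> K\<^sup>2"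
    using cstar[of x] norm_square_selfadjoint[OF h(1)] h(2) by (simp add: a_def power_mono)
  then show ?thesis using K by (rule power2_le_imp_le)
qed

lemma n2_sc: "n2 (sc a x) = cmod a * n2 x"
proof -
  have "cnj a * a = complex_of_real ((cmod a)\<^sup>2)"
    by (simp only: complex_norm_square mult.commute)
  then have "sc (cnj a * a) y = (cmod a)\<^sup>2 *\<^sub>R y" for y
    by (simp only: sc_of_real)
  then have "star (sc a x) * sc a x = (cmod a)\<^sup>2 *\<^sub>R (star x * x)"
    by (simp add: star_sc sc_mult_left sc_mult_right sc_sc mult.commute)
  then show ?thesis
    by (simp add: norm2_def tr_scaleR real_sqrt_mult)
qed

lemma n2_scaleR: "n2 (r *\<^sub>R x) = \<bar>r\<bar> * n2 x"
  by (simp add: n2_sc flip: sc_of_real)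

text \<open>For \<open>norm x \<le> 1\<close> let s be the root of 1 - x* x. Then the squared
  \<open>n2\<close> of s y is the squared \<open>n2\<close> of y minus that of x y, and it is
  nonnegative. The general case is scaling.\<close>

lemma n2_mult_le: "n2 (x * y) \<le> norm x * n2 y"
proof -
  have *: "n2 (x * y) \<le> n2 y" if "norm x \<le> 1" for x
  proof -
    let ?a = "star x * x"
    let ?s = "sqrt_one_minus ?a"
    have na: "norm ?a \<le> 1"
      using that by (simp add: cstar power_le_one)
    have "star ?s = ?s"
      by (rule star_sqrt_one_minus[OF na]) (simp add: star_mult star_star)
    then have "star (?s * y) * (?s * y) = star y * (?s * ?s) * y"
      by (simp add: star_mult mult.assoc)
    also have "\<dots> = star y * y - star (x * y) * (x * y)"
      by (simp add: sqrt_one_minus_square[OF na] algebra_simps star_mult)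
    finally have "tr (star (?s * y) * (?s * y)) = tr (star y * y) - tr (star (x * y) * (x * y))"
      by (simp add: tr_diff)
    then have "complex_of_real ((n2 (?s * y))\<^sup>2) = complex_of_real ((n2 y)\<^sup>2 - (n2 (x * y))\<^sup>2)"
      unfolding tr_star_mult_self by simp
    then have "(n2 (?s * y))\<^sup>2 = (n2 y)\<^sup>2 - (n2 (x * y))\<^sup>2"
      using of_real_eq_iff by blast
    then have "(n2 (x * y))\<^sup>2 \<le> (n2 y)\<^sup>2"
      using zero_le_power2[of "n2 (?s * y)"] by linarith
    then show ?thesis using n2_nonneg by (rule power2_le_imp_le)
  qed
  show ?thesis
  proof (cases "x = 0")
    case False
    then have "n2 ((1 / norm x) *\<^sub>R x * y) \<le> n2 y" by (intro *) simp
    with False show ?thesis by (simp add: n2_scaleR field_simps)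
  qed simp
qed

lemma n2_one: "n2 1 = 1"
  by (simp add: norm2_def tr_one)

lemma n2_le_norm: "n2 x \<le> norm x"
  using n2_mult_le[of x 1] by (simp add: n2_one)

lemma tr_star_mult_swap: "tr (star x * y) = cnj (tr (star y * x))"
  by (simp add: star_mult star_star flip: tr_star)

lemma Cauchy_Schwarz_tr: "cmod (tr (star y * x)) \<le> n2 y * n2 x"
proof (cases "y = 0")
  case False
  define t where "t = tr (star y * x)"
  define r where "r = (n2 y)\<^sup>2"
  have r: "r > 0" using False n2_nonneg[of y] by (simp add: r_def n2_eq_0_iff)
  \<comment> \<open>Up to the factor \<open>r\<close> this is the component of \<open>x\<close>
    orthogonal to \<open>y\<close>; the factor avoids a division.\<close>
  let ?z = "r *\<^sub>R x - sc t y"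
  have "complex_of_real ((n2 ?z)\<^sup>2) = tr (star ?z * ?z)" by (simp add: tr_star_mult_self)
  also have "star ?z * ?z = (r * r) *\<^sub>R (star x * x) - r *\<^sub>R sc t (star x * y)
      - r *\<^sub>R sc (cnj t) (star y * x) + sc (t * cnj t) (star y * y)"
    by (simp add: star_diff star_scaleR star_sc sc_mult_left sc_mult_right sc_sc sc_diff_right sc_scaleR
        algebra_simps)
  also have "tr \<dots> = complex_of_real (r * (r * (n2 x)\<^sup>2 - (cmod t)\<^sup>2))"
    unfolding tr_add tr_diff tr_scaleR tr_sc tr_star_mult_self tr_star_mult_swap[of x y]
    by (simp add: t_def[symmetric] r_def[symmetric] algebra_simps complex_norm_square[symmetric]
        flip: of_real_power of_real_mult)
  finally have "(n2 ?z)\<^sup>2 = r * (r * (n2 x)\<^sup>2 - (cmod t)\<^sup>2)"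
    using of_real_eq_iff by blast
  then have "r * (r * (n2 x)\<^sup>2 - (cmod t)\<^sup>2) \<ge> 0"
    using zero_le_power2[of "n2 ?z"] by linarith
  then have "(cmod t)\<^sup>2 \<le> (n2 y * n2 x)\<^sup>2"
    using r by (simp add: zero_le_mult_iff r_def power_mult_distrib)
  then show ?thesis
    unfolding t_def by (rule power2_le_imp_le) (simp add: n2_nonneg)
qed simp

lemma cmod_tr_le: "cmod (tr x) \<le> n2 x"
  using Cauchy_Schwarz_tr[of 1 x] by (simp add: n2_one)

lemma n2_add_square: "(n2 (x + y))\<^sup>2 = (n2 x)\<^sup>2 + 2 * Re (tr (star y * x)) + (n2 y)\<^sup>2"
proof -
  have "complex_of_real ((n2 (x + y))\<^sup>2) = tr (star (x + y) * (x + y))"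
    by (simp only: tr_star_mult_self)
  also have "star (x + y) * (x + y) = star x * x + star y * x + star x * y + star y * y"
    by (simp add: star_add algebra_simps)
  also have "tr \<dots> = of_real ((n2 x)\<^sup>2) + tr (star y * x) + cnj (tr (star y * x)) + of_real ((n2 y)\<^sup>2)"
    by (simp only: tr_add tr_star_mult_self tr_star_mult_swap[of x y])
  also have "\<dots> = of_real ((n2 x)\<^sup>2 + 2 * Re (tr (star y * x)) + (n2 y)\<^sup>2)"
    using complex_add_cnj[of "tr (star y * x)"] by (simp add: algebra_simps)
  finally show ?thesis using of_real_eq_iff by blast
qed

lemma n2_triangle: "n2 (x + y) \<le> n2 x + n2 y"
proof (rule power2_le_imp_le)
  have "Re (tr (star y * x)) \<le> n2 y * n2 x"
    using Cauchy_Schwarz_tr[of y x] complex_Re_le_cmod order_trans by blast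
  then show "(n2 (x + y))\<^sup>2 \<le> (n2 x + n2 y)\<^sup>2"
    by (simp add: n2_add_square power2_sum mult.commute)
qed (simp add: n2_nonneg)

lemma n2_minus: "n2 (- x) = n2 x"
  by (simp add: norm2_def star_minus)

end

section \<open>Von Neumann's inequality\<close>

lemma sum_roots_unity:
  fixes M a b :: nat
  assumes "a < M" "b < M"
  defines "\<omega> \<equiv> \<lambda>j. cis (2 * pi * real j / real M)"
  shows "(\<Sum>j<M. \<omega> j ^ a * cnj (\<omega> j) ^ b) = (if a = b then of_nat M else 0)"
proof -
  \<comment> \<open>The summands turn out to be a geometric progression with ratio
    \<open>cis t\<close>.\<close>
  define t where "t = 2 * pi * (real a - real b) / real M"
  have eq: "\<omega> j ^ a * cnj (\<omega> j) ^ b = cis t ^ j" for j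
  proof -
    define \<theta> where "\<theta> = 2 * pi * real j / real M"
    have "\<omega> j ^ a * cnj (\<omega> j) ^ b = cis (real a * \<theta> + real b * (- \<theta>))"
      by (simp only: \<omega>_def \<theta>_def[symmetric] cis_cnj Complex.DeMoivre cis_mult)
    also have "real a * \<theta> + real b * (- \<theta>) = real j * t"
      unfolding t_def \<theta>_def by (simp add: field_simps diff_divide_distrib)
    finally show ?thesis by (simp only: Complex.DeMoivre)
  qed
  have pow: "cis t ^ M = 1"
  proof -
    have "real M * t = 2 * pi * of_int (int a - int b)"
      using assms unfolding t_def by simp
    then show ?thesis by (simp only: Complex.DeMoivre cis_multiple_2pi Ints_of_int)
  qed
  show ?thesis
  proof (cases "a = b")
    case True
    then have "t = 0" by (simp add: t_def)
    with True show ?thesis unfolding eq by simp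
  next
    case False
    \<comment> \<open>Ratio 1 would mean that \<open>M\<close> divides \<open>a - b\<close>, a
      nonzero number of absolute value below \<open>M\<close>.\<close>
    have "cis t \<noteq> 1"
    proof
      assume "cis t = 1"
      then have "cos t = 1" by (simp add: complex_eq_iff)
      then obtain n where n: "t = of_int n * 2 * pi" by (auto simp: cos_one_2pi_int)
      then have "2 * pi * (real a - real b) = 2 * pi * (of_int n * real M)"
        using assms by (simp add: t_def field_simps)
      then have "real a - real b = of_int n * real M" by simp
      then have "of_int (int a - int b) = (of_int (n * int M) :: real)" by simp
      then have i: "int a - int b = n * int M" by (simp only: of_int_eq_iff)
      have "n \<noteq> 0" using i False by auto
      then have "1 \<le> \<bar>n\<bar>" by linarith
      then have "int M \<le> \<bar>n\<bar> * int M" by (simp add: mult_le_cancel_right1)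
      moreover have "\<bar>int a - int b\<bar> < int M" using assms by linarith
      ultimately show False by (simp add: i abs_mult)
    qed
    with False pow show ?thesis unfolding eq by (simp add: sum_gp_strict)
  qed
qed

text \<open>The sum counts the points of an N by N grid on the diagonal l - k = r - i. Each k admits
  at most one l, and for k in \<open>{m..<N - m}\<close> the required l stays inside the
  grid.\<close>

lemma card_diagonal_bounds:
  fixes i r m N :: nat
  assumes "i < m" "r < m"
  defines "C \<equiv> (\<Sum>k<N. \<Sum>l<N. of_bool (i + l = r + k)) :: real"
  shows "C \<le> real N" "real N - 2 * real m \<le> C"
proof -
  have le1: "(\<Sum>l<N. of_bool (i + l = r + k)) \<le> (1::real)" for k
  proof -
    have "(\<Sum>l<N. of_bool (i + l = r + k)) = (\<Sum>l<N. if l = r + k - i then of_bool (i + l = r + k) else 0 :: real)"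
      by (rule sum.cong) auto
    also have "\<dots> \<le> 1" by simp
    finally show ?thesis .
  qed
  have "C \<le> (\<Sum>k<N. 1)" unfolding C_def by (rule sum_mono) (rule le1)
  then show "C \<le> real N" by simp
  have "real N - 2 * real m \<le> (\<Sum>k\<in>{m..<N - m}. 1::real)" by simp
  also have "\<dots> \<le> (\<Sum>k\<in>{m..<N - m}. \<Sum>l<N. of_bool (i + l = r + k))"
  proof (rule sum_mono)
    fix k assume k: "k \<in> {m..<N - m}"
    have "(1::real) = (\<Sum>l\<in>{r + k - i}. of_bool (i + l = r + k))"
      using k assms by simp
    also have "\<dots> \<le> (\<Sum>l<N. of_bool (i + l = r + k))"
      by (rule sum_mono2) (use k assms in auto)
    finally show "(1::real) \<le> (\<Sum>l<N. of_bool (i + l = r + k))" .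
  qed
  also have "\<dots> \<le> C"
    unfolding C_def by (rule sum_mono2) (auto intro!: sum_nonneg)
  finally show "real N - 2 * real m \<le> C" .
qed

lemma tendsto_diagonal_density:
  fixes i r :: nat
  shows "(\<lambda>N. (\<Sum>k<N. \<Sum>l<N. of_bool (i + l = r + k)) / real N) \<longlonglongrightarrow> (1::real)"
proof (rule tendsto_sandwich)
  let ?m = "Suc (max i r)"
  have b: "i < ?m" "r < ?m" by auto
  show "\<forall>\<^sub>F N in sequentially. 1 - 2 * real ?m / real N \<le> (\<Sum>k<N. \<Sum>l<N. of_bool (i + l = r + k)) / real N"
    using eventually_gt_at_top[of 0]
  proof eventually_elim
    case (elim N)
    have "1 - 2 * real ?m / real N = (real N - 2 * real ?m) / real N"
      using elim by (simp add: diff_divide_distrib)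
    with card_diagonal_bounds(2)[OF b, of N] show ?case
      by (simp only: divide_right_mono of_nat_0_le_iff)
  qed
  show "\<forall>\<^sub>F N in sequentially. (\<Sum>k<N. \<Sum>l<N. of_bool (i + l = r + k)) / real N \<le> (1::real)"
    using eventually_gt_at_top[of 0]
  proof eventually_elim
    case (elim N)
    with card_diagonal_bounds(1)[OF b, of N] show ?case
      by (simp only: divide_le_eq_1_pos of_nat_0_less_iff)
  qed
  have "(\<lambda>N. 1 - 2 * real ?m / real N) \<longlonglongrightarrow> 1 - 0"
    by (intro tendsto_intros tendsto_divide_0[OF tendsto_const] filterlim_real_sequentially
        filterlim_at_top_imp_at_infinity)
  then show "(\<lambda>N. 1 - 2 * real ?m / real N) \<longlonglongrightarrow> 1" by simp
qed auto

text \<open>Fejer averaging: the nonnegative sums \<open>F N z\<close> are averaged against \<open>|p|\<^sup>2\<close> over the roots of unity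
  of order \<open>N + m\<close>, where no aliasing occurs; after division by \<open>N\<close> the weights tend to \<open>1\<close>.\<close>

lemma positive_definite_le:
  fixes \<tau> :: "int \<Rightarrow> complex" and c :: "nat \<Rightarrow> complex"
  assumes pd: "\<And>a n. Re (\<Sum>i<n. \<Sum>l<n. a i * cnj (a l) * \<tau> (int i - int l)) \<ge> 0"
    and p: "\<And>z. cmod z = 1 \<Longrightarrow> cmod (\<Sum>i<m. c i * z ^ i) \<le> 1"
  shows "Re (\<Sum>i<m. \<Sum>r<m. c i * cnj (c r) * \<tau> (int i - int r)) \<le> Re (\<tau> 0)"
proof -
  define P where "P z = (\<Sum>i<m. c i * z ^ i)" for z
  define F where "F N z = (\<Sum>k<N. \<Sum>l<N. cnj z ^ k * z ^ l * \<tau> (int k - int l))" for N :: nat and z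
  define C where "C N i r = (\<Sum>k<N. \<Sum>l<N. of_bool (i + l = r + k) :: real)" for N i r :: nat
  have F_nonneg: "Re (F N z) \<ge> 0" for N z
    using pd[of "\<lambda>k. cnj z ^ k" N] by (simp add: F_def)
  have PP: "P z * cnj (P z) = (\<Sum>i<m. \<Sum>r<m. (c i * z ^ i) * (cnj (c r) * cnj z ^ r))" for z
    by (simp add: P_def sum_product)
  have key: "Re (\<Sum>i<m. \<Sum>r<m. c i * cnj (c r) * \<tau> (int i - int r) * of_real (C N i r / real N)) \<le> Re (\<tau> 0)"
    if N: "N > 0" for N
  proof -
    \<comment> \<open>The exponents \<open>i + l\<close> and \<open>r + k\<close> are below
      \<open>N + m\<close>, so roots of unity of this order tell them apart.\<close>
    define M where "M = N + m"
    define \<omega> where "\<omega> j = cis (2 * pi * real j / real M)" for j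
    have avg: "(\<Sum>j<M. \<omega> j ^ a * cnj (\<omega> j) ^ b) = (if a = b then of_nat M else 0)" if "a < M" "b < M" for a b
      unfolding \<omega>_def by (rule sum_roots_unity[OF that])
    have M: "M > 0" using N by (simp add: M_def)
    have "(\<Sum>j<M. F N (\<omega> j)) = (\<Sum>k<N. \<Sum>l<N. \<tau> (int k - int l) * (\<Sum>j<M. \<omega> j ^ l * cnj (\<omega> j) ^ k))"
      unfolding F_def sum_distrib_left
      by (subst sum.swap, rule sum.cong[OF refl], subst sum.swap) (simp add: mult_ac)
    also have "\<dots> = (\<Sum>k<N. \<Sum>l<N. if l = k then \<tau> 0 * of_nat M else 0)"
      by (intro sum.cong refl, subst avg) (auto simp: M_def)
    finally have F: "(\<Sum>j<M. F N (\<omega> j)) = of_nat M * (of_nat N * \<tau> 0)" by simp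
    have "(\<Sum>j<M. P (\<omega> j) * cnj (P (\<omega> j)) * F N (\<omega> j))
       = (\<Sum>j<M. \<Sum>i<m. \<Sum>r<m. \<Sum>k<N. \<Sum>l<N. c i * cnj (c r) * \<tau> (int k - int l) * (\<omega> j ^ (i + l) * cnj (\<omega> j) ^ (r + k)))"
      unfolding PP sum_distrib_right unfolding F_def sum_distrib_left
      by (intro sum.cong refl) (simp add: power_add mult_ac)
    also have "\<dots> = (\<Sum>i<m. \<Sum>r<m. \<Sum>k<N. \<Sum>l<N. c i * cnj (c r) * \<tau> (int k - int l) * (\<Sum>j<M. \<omega> j ^ (i + l) * cnj (\<omega> j) ^ (r + k)))"
      unfolding sum_distrib_left
      by (subst sum.swap, rule sum.cong[OF refl], subst sum.swap, rule sum.cong[OF refl],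
          subst sum.swap, rule sum.cong[OF refl], subst sum.swap, rule refl)
    \<comment> \<open>In the surviving terms \<open>k - l = i - r\<close>, so the value of \<tau>
      leaves the inner sums and only the count \<open>C\<close> remains there.\<close>
    also have "\<dots> = (\<Sum>i<m. \<Sum>r<m. \<Sum>k<N. \<Sum>l<N. c i * cnj (c r) * \<tau> (int i - int r) * (of_nat M * of_bool (i + l = r + k)))"
    proof (intro sum.cong refl)
      fix i r k l assume *: "i \<in> {..<m}" "r \<in> {..<m}" "k \<in> {..<N}" "l \<in> {..<N}"
      show "c i * cnj (c r) * \<tau> (int k - int l) * (\<Sum>j<M. \<omega> j ^ (i + l) * cnj (\<omega> j) ^ (r + k))
         = c i * cnj (c r) * \<tau> (int i - int r) * (of_nat M * of_bool (i + l = r + k))"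
      proof (cases "i + l = r + k")
        case True
        then have "int k - int l = int i - int r" by linarith
        with True * show ?thesis by (subst avg) (auto simp: M_def)
      qed (use * in \<open>subst avg, auto simp: M_def\<close>)
    qed
    also have "\<dots> = of_nat M * (\<Sum>i<m. \<Sum>r<m. c i * cnj (c r) * \<tau> (int i - int r) * of_real (C N i r))"
      unfolding C_def of_real_sum sum_distrib_left by (intro sum.cong refl) (simp add: mult_ac)
    finally have PF: "(\<Sum>j<M. P (\<omega> j) * cnj (P (\<omega> j)) * F N (\<omega> j))
       = of_nat M * (\<Sum>i<m. \<Sum>r<m. c i * cnj (c r) * \<tau> (int i - int r) * of_real (C N i r))" .
    \<comment> \<open>A pointwise comparison: \<open>P\<close> has modulus at most 1 on the circle,
      and the weight \<open>F N\<close> is nonnegative there.\<close>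
    have "Re (\<Sum>j<M. P (\<omega> j) * cnj (P (\<omega> j)) * F N (\<omega> j)) \<le> Re (\<Sum>j<M. F N (\<omega> j))"
      unfolding Re_sum
    proof (rule sum_mono)
      fix j
      have "Re (P (\<omega> j) * cnj (P (\<omega> j)) * F N (\<omega> j)) = (cmod (P (\<omega> j)))\<^sup>2 * Re (F N (\<omega> j))"
        by (simp flip: complex_norm_square of_real_power)
      also have "\<dots> \<le> 1 * Re (F N (\<omega> j))"
        by (rule mult_right_mono[OF _ F_nonneg])
           (use p[of "\<omega> j"] in \<open>simp add: P_def \<omega>_def power_le_one\<close>)
      finally show "Re (P (\<omega> j) * cnj (P (\<omega> j)) * F N (\<omega> j)) \<le> Re (F N (\<omega> j))" by simp
    qed
    then have "real M * Re (\<Sum>i<m. \<Sum>r<m. c i * cnj (c r) * \<tau> (int i - int r) * of_real (C N i r))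
      \<le> real M * (real N * Re (\<tau> 0))"
      unfolding PF F by simp
    then have "Re (\<Sum>i<m. \<Sum>r<m. c i * cnj (c r) * \<tau> (int i - int r) * of_real (C N i r)) \<le> real N * Re (\<tau> 0)"
      using M by simp
    moreover have "(\<Sum>i<m. \<Sum>r<m. c i * cnj (c r) * \<tau> (int i - int r) * of_real (C N i r / real N))
       = (\<Sum>i<m. \<Sum>r<m. c i * cnj (c r) * \<tau> (int i - int r) * of_real (C N i r)) / of_real (real N)"
      by (simp add: sum_divide_distrib)
    ultimately show ?thesis
      using N by (simp only: Re_divide_of_real) (simp add: field_simps)
  qed
  have "(\<lambda>N. Re (\<Sum>i<m. \<Sum>r<m. c i * cnj (c r) * \<tau> (int i - int r) * of_real (C N i r / real N)))
     \<longlonglongrightarrow> Re (\<Sum>i<m. \<Sum>r<m. c i * cnj (c r) * \<tau> (int i - int r) * of_real 1)"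
    unfolding C_def by (intro tendsto_intros tendsto_diagonal_density)
  then have "Re (\<Sum>i<m. \<Sum>r<m. c i * cnj (c r) * \<tau> (int i - int r) * of_real 1) \<le> Re (\<tau> 0)"
    by (rule LIMSEQ_le_const2) (use key in \<open>auto intro: exI[of _ 1]\<close>)
  then show ?thesis by simp
qed

section \<open>Moments of a contraction\<close>

context tracial_von_neumann_algebra begin

text \<open>The number tr(y* U^d y) that a unitary dilation U of \<open>T\<close> would give. For
  negative d the power of U compresses to a power of \<open>star T\<close>, whence the
  conjugate.\<close>

definition moment :: "'a \<Rightarrow> 'a \<Rightarrow> int \<Rightarrow> complex" where
  "moment T y d = (if d \<ge> 0 then tr (star y * (T ^ nat d * y)) else cnj (tr (star y * (T ^ nat (- d) * y))))"

lemma cnj_moment: "cnj (moment T y d) = moment T y (- d)"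
  using tr_star_mult_self[of y] by (auto simp: moment_def)

text \<open>Write p(T) y as T u + a_0 y and expand the square. The cross terms are moments, T u is
  no longer than u, and the induction hypothesis applies to u because the form depends only on i - l
  and survives the index shift. The inequality is used twice: as a bound for p(T) y and, since a
  square is nonnegative, as positive definiteness of the moments.\<close>

lemma n2_poly_le_moments:
  assumes T: "norm T \<le> 1"
  shows "(n2 (\<Sum>i<m. sc (a i) (T ^ i * y)))\<^sup>2 \<le> Re (\<Sum>i<m. \<Sum>l<m. a i * cnj (a l) * moment T y (int i - int l))"
proof (induction m arbitrary: a)
  case 0
  then show ?case by simp
next
  case (Suc m)
  define u where "u = (\<Sum>i<m. sc (a (Suc i)) (T ^ i * y))"
  define H where "H = (\<Sum>i<m. \<Sum>l<m. a (Suc i) * cnj (a (Suc l)) * moment T y (int i - int l))"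
  define R where "R = (\<Sum>i<m. a (Suc i) * cnj (a 0) * moment T y (int (Suc i)))"
  have u0: "(\<Sum>i<Suc m. sc (a i) (T ^ i * y)) = T * u + sc (a 0) y"
    unfolding u_def sum.lessThan_Suc_shift
    by (simp add: sum_distrib_left sc_mult_right mult.assoc add.commute)
  have trR: "tr (star (sc (a 0) y) * (T * u)) = R"
    unfolding u_def R_def
    by (simp add: star_sc sc_mult_left sc_mult_right sum_distrib_left tr_sum tr_sc sc_sum_right
        moment_def nat_add_distrib mult_ac flip: mult.assoc)
  have "(n2 (T * u))\<^sup>2 \<le> (n2 u)\<^sup>2"
    using n2_mult_le[of T u] mult_right_mono[OF T n2_nonneg[of u]]
    by (intro power_mono n2_nonneg) simp
  then have Tu: "(n2 (T * u))\<^sup>2 \<le> Re H"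
    using Suc.IH[of "\<lambda>i. a (Suc i)"] unfolding u_def H_def by linarith
  \<comment> \<open>The column \<open>l = 0\<close> without its corner is \<open>R\<close>, the row
    \<open>i = 0\<close> without its corner is the conjugate of \<open>R\<close>, and the remaining
    block is \<open>H\<close>.\<close>
  have "(\<Sum>i<Suc m. \<Sum>l<Suc m. a i * cnj (a l) * moment T y (int i - int l))
     = (a 0 * cnj (a 0) * moment T y 0 + (\<Sum>l<m. a 0 * cnj (a (Suc l)) * moment T y (- int (Suc l)))) + (R + H)"
    unfolding sum.lessThan_Suc_shift H_def R_def by (simp add: sum.distrib)
  also have "(\<Sum>l<m. a 0 * cnj (a (Suc l)) * moment T y (- int (Suc l))) = cnj R"
    unfolding R_def by (simp add: cnj_moment mult_ac)
  also have "a 0 * cnj (a 0) * moment T y 0 = of_real ((n2 (sc (a 0) y))\<^sup>2)"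
    unfolding n2_sc power_mult_distrib of_real_mult complex_norm_square
    by (simp add: moment_def tr_star_mult_self)
  finally have "Re (\<Sum>i<Suc m. \<Sum>l<Suc m. a i * cnj (a l) * moment T y (int i - int l))
     = (n2 (sc (a 0) y))\<^sup>2 + 2 * Re R + Re H"
    by simp
  then show ?case
    unfolding u0 n2_add_square trR using Tu by linarith
qed

text \<open>By \<open>norm_le_of_n2_le\<close> it is enough to bound p(T) with respect to
  \<open>n2\<close>. The quadratic form of the moments lies between the squared \<open>n2\<close> of
  p(T) y and the moment at 0, which is the squared \<open>n2\<close> of y.\<close>

theorem von_Neumann_inequality:
  assumes T: "norm T \<le> 1" and p: "\<And>z. cmod z = 1 \<Longrightarrow> cmod (\<Sum>i<m. c i * z ^ i) \<le> 1"
  shows "norm (\<Sum>i<m. sc (c i) (T ^ i)) \<le> 1"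
proof (rule norm_le_of_n2_le)
  fix y
  have "(n2 (\<Sum>i<m. sc (c i) (T ^ i * y)))\<^sup>2 \<le> Re (\<Sum>i<m. \<Sum>l<m. c i * cnj (c l) * moment T y (int i - int l))"
    by (rule n2_poly_le_moments[OF T])
  also have "\<dots> \<le> Re (moment T y 0)"
  proof (rule positive_definite_le[OF _ p])
    show "0 \<le> Re (\<Sum>i<n. \<Sum>l<n. a i * cnj (a l) * moment T y (int i - int l))" for a n
      using n2_poly_le_moments[OF T, of a y n] zero_le_power2 order_trans by blast
  qed
  also have "\<dots> = (n2 y)\<^sup>2"
    using tr_star_mult_self[of y] by (simp add: moment_def flip: of_real_power)
  finally have "n2 (\<Sum>i<m. sc (c i) (T ^ i * y)) \<le> n2 y"
    using n2_nonneg by (rule power2_le_imp_le)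
  then show "n2 ((\<Sum>i<m. sc (c i) (T ^ i)) * y) \<le> 1 * n2 y"
    by (simp add: sum_distrib_right sc_mult_left)
qed simp

end

section \<open>Codes of rational and real numbers\<close>

lemma tendsto_divide_pow2: "(\<lambda>n. c / 2 ^ (n + k)) \<longlonglongrightarrow> (0::real)"
proof -
  have "(\<lambda>n. c * (1/2) ^ n) \<longlonglongrightarrow> (0::real)"
    by (intro tendsto_mult_right_zero LIMSEQ_realpow_zero) auto
  then show ?thesis
    by (intro LIMSEQ_ignore_initial_segment) (simp add: power_divide)
qed

lemma limit_of_fast_sequence:
  fixes g :: "nat \<Rightarrow> real"
  assumes g: "\<And>n. \<bar>g n - g (Suc n)\<bar> < 1 / 2 ^ Suc n"
  shows "g \<longlonglongrightarrow> lim g" "\<bar>g n - lim g\<bar> < 1 / 2 ^ n"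
proof -
  have dist: "\<bar>g n - g (n + k)\<bar> \<le> 1 / 2 ^ n - 1 / 2 ^ (n + k)" for n k
  proof (induction k)
    case (Suc k)
    have "\<bar>g n - g (n + Suc k)\<bar> \<le> \<bar>g n - g (n + k)\<bar> + \<bar>g (n + k) - g (Suc (n + k))\<bar>"
      by simp
    also have "\<dots> \<le> (1 / 2 ^ n - 1 / 2 ^ (n + k)) + 1 / 2 ^ Suc (n + k)"
      by (rule add_mono[OF Suc less_imp_le[OF g]])
    also have "\<dots> = 1 / 2 ^ n - 1 / 2 ^ (n + Suc k)" by simp
    finally show ?case .
  qed simp
  have "Cauchy g"
  proof (rule CauchyI')
    fix e :: real assume "e > 0"
    then obtain N where N: "(1/2) ^ N < e"
      using real_arch_pow_inv[of e "1/2"] by auto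
    have "dist (g m) (g n) < e" if "m \<ge> N" "n > m" for m n
    proof -
      have "\<bar>g m - g n\<bar> \<le> 1 / 2 ^ m - 1 / 2 ^ n"
        using dist[of m "n - m"] that by simp
      also have "\<dots> < 1 / 2 ^ m" by simp
      also have "\<dots> \<le> 1 / 2 ^ N" using that by (simp add: field_simps)
      finally show ?thesis using N by (simp add: dist_real_def power_divide)
    qed
    then show "\<exists>M. \<forall>m\<ge>M. \<forall>n>m. dist (g m) (g n) < e" by blast
  qed
  then show lim: "g \<longlonglongrightarrow> lim g"
    by (simp add: Cauchy_convergent_iff convergent_LIMSEQ_iff)
  have le: "\<bar>g n - lim g\<bar> \<le> 1 / 2 ^ n" for n
  proof (rule LIMSEQ_le_const2)
    show "(\<lambda>k. \<bar>g n - g (k + n)\<bar>) \<longlonglongrightarrow> \<bar>g n - lim g\<bar>"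
      by (intro tendsto_intros LIMSEQ_ignore_initial_segment lim)
    show "\<exists>N. \<forall>k\<ge>N. \<bar>g n - g (k + n)\<bar> \<le> 1 / 2 ^ n"
    proof (intro exI allI impI)
      fix k :: nat
      have "(0::real) \<le> 1 / 2 ^ (n + k)" by simp
      then show "\<bar>g n - g (k + n)\<bar> \<le> 1 / 2 ^ n"
        using dist[of n k] unfolding add.commute[of k n] by linarith
    qed
  qed
  \<comment> \<open>The passage to the limit gives only a weak inequality; splitting off one step,
    whose bound is strict, makes it strict.\<close>
  have "\<bar>g n - lim g\<bar> \<le> \<bar>g n - g (Suc n)\<bar> + \<bar>g (Suc n) - lim g\<bar>" by simp
  also have "\<dots> < 1 / 2 ^ Suc n + 1 / 2 ^ Suc n"
    by (rule add_less_le_mono[OF g le])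
  finally show "\<bar>g n - lim g\<bar> < 1 / 2 ^ n" by simp
qed

section \<open>Arithmetic on codes of rationals\<close>

definition code_pos :: "nat \<Rightarrow> nat" where
  "code_pos c = (let n = fst (prod_decode c) in if even n then n div 2 else 0)"

definition code_neg :: "nat \<Rightarrow> nat" where
  "code_neg c = (let n = fst (prod_decode c) in if even n then 0 else Suc n div 2)"

definition code_den :: "nat \<Rightarrow> nat" where
  "code_den c = Suc (snd (prod_decode c))"

definition mk_code :: "nat \<Rightarrow> nat \<Rightarrow> nat \<Rightarrow> nat" where
  "mk_code a b d = (if b - a = 0 then prod_encode ((a - b) + (a - b), d - 1)
     else prod_encode ((b - a) + (b - a) - 1, d - 1))"

lemma code_den_pos [simp]: "code_den c > 0" "code_den c \<noteq> 0"
  by (simp_all add: code_den_def)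

lemma code_pos_or_neg: "code_pos c = 0 \<or> code_neg c = 0"
  by (simp add: code_pos_def code_neg_def Let_def)

lemma rat_of_code_eq: "rat_of_code c = (real (code_pos c) - real (code_neg c)) / real (code_den c)"
proof -
  obtain n m where "prod_decode c = (n, m)" by fastforce
  note * = this
  show ?thesis
  proof (cases "even n")
    case True
    then obtain k where "n = 2 * k" by (rule evenE)
    with * show ?thesis by (simp add: rat_of_code_def code_pos_def code_neg_def code_den_def field_simps)
  next
    case False
    then obtain k where "n = 2 * k + 1" by (rule oddE)
    with * show ?thesis by (simp add: rat_of_code_def code_pos_def code_neg_def code_den_def field_simps)
  qed
qed

lemma rat_of_mk_code:
  assumes "d > 0"
  shows "rat_of_code (mk_code a b d) = (real a - real b) / real d"
proof -
  obtain d' where d: "d = Suc d'" using assms by (cases d) auto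
  show ?thesis
  proof (cases "b \<le> a")
    case True
    then obtain k where "a = b + k" using le_Suc_ex by blast
    then have "mk_code a b d = prod_encode (2 * k, d')" by (simp add: mk_code_def d mult_2)
    then show ?thesis using \<open>a = b + k\<close> by (simp add: rat_of_code_def d field_simps)
  next
    case False
    then obtain k where "b = a + Suc k" using less_imp_Suc_add[of a b] by auto
    then have "mk_code a b d = prod_encode (2 * k + 1, d')" by (simp add: mk_code_def d mult_2)
    then show ?thesis using \<open>b = a + Suc k\<close> by (simp add: rat_of_code_def d field_simps)
  qed
qed

text \<open>A Cantor code dominates its first component n, and n/2, or (n + 1)/2 for odd n, is at
  most n. This is the source of all natural number bounds on represented reals: the shift in
  \<open>mult_real\<close> and the majorant of scaling.\<close>

lemma abs_rat_of_code_le: "\<bar>rat_of_code c\<bar> \<le> real c"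
proof -
  obtain n m where nm: "prod_decode c = (n, m)" by fastforce
  then have c: "c = prod_encode (n, m)" using prod_decode_inverse[of c] by simp
  have "\<bar>rat_of_code c\<bar> \<le> (if even n then real n / 2 else (real n + 1) / 2)"
    unfolding rat_of_code_def nm by (auto simp: field_simps)
  also have "\<dots> \<le> real n" by (cases n) auto
  also have "\<dots> \<le> real c" unfolding c using le_prod_encode_1 of_nat_le_iff by blast
  finally show ?thesis .
qed

text \<open>This and the following functions are the denotations of the closed terms
  \<open>c_addq\<close>, \<open>c_minusq\<close> and so on. They mirror the computation of these
  terms because the values of terms are compared as codes.\<close>

definition add_code :: "nat \<Rightarrow> nat \<Rightarrow> nat" where
  "add_code x y = mk_code (code_pos x * code_den y + code_pos y * code_den x)
     (code_neg x * code_den y + code_neg y * code_den x) (code_den x * code_den y)"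

definition minus_code :: "nat \<Rightarrow> nat" where
  "minus_code x = mk_code (code_neg x) (code_pos x) (code_den x)"

definition mult_code :: "nat \<Rightarrow> nat \<Rightarrow> nat" where
  "mult_code x y = mk_code (code_pos x * code_pos y + code_neg x * code_neg y)
     (code_pos x * code_neg y + code_neg x * code_pos y) (code_den x * code_den y)"

definition abs_code :: "nat \<Rightarrow> nat" where
  "abs_code x = mk_code (code_pos x + code_neg x) 0 (code_den x)"

definition less_code :: "nat \<Rightarrow> nat \<Rightarrow> nat" where
  "less_code x y = Suc (code_pos x * code_den y + code_neg y * code_den x)
     - (code_pos y * code_den x + code_neg x * code_den y)"

definition max_code :: "nat \<Rightarrow> nat \<Rightarrow> nat" where
  "max_code x y = (if less_code x y = 0 then y else x)"

definition recip_code :: "nat \<Rightarrow> nat" where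
  "recip_code x = mk_code (code_den x) 0 (code_pos x)"

definition eps_code :: "nat \<Rightarrow> nat" where
  "eps_code n = mk_code (Suc 0) 0 (2 ^ n)"

lemma rat_of_add_code: "rat_of_code (add_code x y) = rat_of_code x + rat_of_code y"
  unfolding add_code_def rat_of_code_eq[of x] rat_of_code_eq[of y]
  by (subst rat_of_mk_code) (simp_all add: field_simps)

lemma rat_of_minus_code: "rat_of_code (minus_code x) = - rat_of_code x"
  unfolding minus_code_def rat_of_code_eq[of x]
  by (subst rat_of_mk_code) (simp_all add: field_simps)

lemma rat_of_mult_code: "rat_of_code (mult_code x y) = rat_of_code x * rat_of_code y"
  unfolding mult_code_def rat_of_code_eq[of x] rat_of_code_eq[of y]
  by (subst rat_of_mk_code) (simp_all add: field_simps)

lemma rat_of_abs_code: "rat_of_code (abs_code x) = \<bar>rat_of_code x\<bar>"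
  unfolding abs_code_def rat_of_code_eq[of x] using code_pos_or_neg[of x]
  by (subst rat_of_mk_code) (auto simp: field_simps)

lemma less_code_eq_0_iff: "less_code x y = 0 \<longleftrightarrow> rat_of_code x < rat_of_code y"
proof -
  have "less_code x y = 0 \<longleftrightarrow> real (code_pos x * code_den y + code_neg y * code_den x)
      < real (code_pos y * code_den x + code_neg x * code_den y)"
    by (simp only: less_code_def diff_is_0_eq Suc_le_eq of_nat_less_iff)
  also have "\<dots> \<longleftrightarrow> rat_of_code x < rat_of_code y"
    by (simp add: rat_of_code_eq field_simps)
  finally show ?thesis .
qed

lemma rat_of_max_code: "rat_of_code (max_code x y) = max (rat_of_code x) (rat_of_code y)"
  by (simp add: max_code_def less_code_eq_0_iff max_def)

lemma rat_of_recip_code: "rat_of_code x > 0 \<Longrightarrow> rat_of_code (recip_code x) = 1 / rat_of_code x"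
  unfolding recip_code_def rat_of_code_eq[of x] using code_pos_or_neg[of x]
  by (subst rat_of_mk_code) (auto simp: zero_less_divide_iff)

lemma rat_of_eps_code: "rat_of_code (eps_code n) = 1 / 2 ^ n"
  by (simp add: eps_code_def rat_of_mk_code)

text \<open>The first failure \<open>LEAST k. B k\<close> does not depend on \<open>n\<close>, which
  exhibits \<open>hat_fun f\<close> as eventually frozen there.\<close>

lemma hat_fun_alt:
  fixes f :: "nat \<Rightarrow> nat"
  defines "B \<equiv> \<lambda>k. \<bar>rat_of_code (f k) - rat_of_code (f (k + 1))\<bar> \<ge> 1 / 2 ^ (k + 1)"
  shows "hat_fun f n = (if \<exists>k<n. B k then f (LEAST k. B k) else f n)"
proof (cases "\<exists>k<n. B k")
  case True
  let ?m = "LEAST k. B k"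
  from True obtain k where k: "k < n" "B k" by blast
  then have m: "B ?m" "?m < n" by (auto intro: LeastI Least_le[THEN le_less_trans])
  have "(LEAST k. k = n \<or> k < n \<and> B k) = ?m"
    by (rule Least_equality) (use m in \<open>auto intro: Least_le\<close>)
  with True show ?thesis by (auto simp: hat_fun_def B_def)
next
  case False
  have "(LEAST k. k = n \<or> k < n \<and> B k) = n"
    by (rule Least_equality) (use False in auto)
  with False show ?thesis by (auto simp: hat_fun_def B_def)
qed

lemma hat_fun_fast: "\<bar>rat_of_code (hat_fun f n) - rat_of_code (hat_fun f (Suc n))\<bar> < 1 / 2 ^ Suc n"
proof -
  define B where "B k \<longleftrightarrow> \<bar>rat_of_code (f k) - rat_of_code (f (k + 1))\<bar> \<ge> 1 / 2 ^ (k + 1)" for k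
  note alt = hat_fun_alt[of f, folded B_def]
  consider "\<exists>k<n. B k" | "\<not> (\<exists>k<n. B k)" "B n" | "\<not> (\<exists>k<n. B k)" "\<not> B n" by blast
  then show ?thesis
  proof cases
    case 1
    then have "\<exists>k<Suc n. B k" by (auto intro: less_SucI)
    with 1 show ?thesis by (simp add: alt)
  next
    \<comment> \<open>The first failure is at \<open>n\<close> itself, so the value at
      \<open>Suc n\<close> is already frozen to \<open>f n\<close>.\<close>
    case 2
    then have "(LEAST k. B k) = n"
      by (intro Least_equality) (auto simp: not_less[symmetric])
    with 2 show ?thesis by (auto simp: alt)
  next
    case 3
    then have "\<not> (\<exists>k<Suc n. B k)" by (auto simp: less_Suc_eq)
    with 3 have "hat_fun f n = f n" "hat_fun f (Suc n) = f (Suc n)"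
      unfolding alt by auto
    with 3 show ?thesis by (simp add: B_def)
  qed
qed

lemma hat_fun_0: "hat_fun f 0 = f 0"
  by (simp add: hat_fun_alt)

lemma hat_fun_id:
  assumes "\<And>n. \<bar>rat_of_code (f n) - rat_of_code (f (Suc n))\<bar> < 1 / 2 ^ Suc n"
  shows "hat_fun f n = f n"
  using assms by (subst hat_fun_alt) (auto simp: not_le[symmetric])

lemma hat_fun_tendsto: "(\<lambda>n. rat_of_code (hat_fun f n)) \<longlonglongrightarrow> real_of_code f"
  and hat_fun_approx: "\<bar>rat_of_code (hat_fun f n) - real_of_code f\<bar> < 1 / 2 ^ n"
  using limit_of_fast_sequence[of "\<lambda>n. rat_of_code (hat_fun f n)", OF hat_fun_fast]
  by (simp_all add: real_of_code_def)

text \<open>A fast sequence is not changed by \<open>hat_fun\<close>, so it represents its own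
  limit. All real operations below are verified through this rule.\<close>

lemma real_of_code_eqI:
  assumes "\<And>n. \<bar>rat_of_code (f n) - rat_of_code (f (Suc n))\<bar> < 1 / 2 ^ Suc n"
    and "(\<lambda>n. rat_of_code (f n)) \<longlonglongrightarrow> x"
  shows "real_of_code f = x"
  using LIMSEQ_unique[OF hat_fun_tendsto[of f]] assms by (simp add: hat_fun_id)

lemma abs_real_of_code_le: "\<bar>real_of_code f\<bar> \<le> real (f 0) + 1"
  using hat_fun_approx[of f 0] abs_rat_of_code_le[of "f 0"] by (simp add: hat_fun_0)

text \<open>At index \<open>Suc n\<close> the two approximation errors are each below half of
  \<open>1 / 2 ^ n\<close>, which gives one direction; the other is the limit of the
  inequalities.\<close>

lemma real_of_code_le_iff:
  "real_of_code f \<le> real_of_code g \<longleftrightarrow>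
   (\<forall>n. rat_of_code (hat_fun f (Suc n)) - rat_of_code (hat_fun g (Suc n)) < 1 / 2 ^ n)"
proof
  assume le: "real_of_code f \<le> real_of_code g"
  show "\<forall>n. rat_of_code (hat_fun f (Suc n)) - rat_of_code (hat_fun g (Suc n)) < 1 / 2 ^ n"
  proof
    fix n
    have "rat_of_code (hat_fun f (Suc n)) - rat_of_code (hat_fun g (Suc n)) < 1 / 2 ^ Suc n + 1 / 2 ^ Suc n"
      using hat_fun_approx[of f "Suc n"] hat_fun_approx[of g "Suc n"] le by linarith
    then show "rat_of_code (hat_fun f (Suc n)) - rat_of_code (hat_fun g (Suc n)) < 1 / 2 ^ n" by simp
  qed
next
  assume *: "\<forall>n. rat_of_code (hat_fun f (Suc n)) - rat_of_code (hat_fun g (Suc n)) < 1 / 2 ^ n"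
  have "(\<lambda>n. rat_of_code (hat_fun f (Suc n)) - rat_of_code (hat_fun g (Suc n)))
      \<longlonglongrightarrow> real_of_code f - real_of_code g"
    by (intro tendsto_intros LIMSEQ_Suc hat_fun_tendsto)
  moreover have "(\<lambda>n. 1 / 2 ^ n) \<longlonglongrightarrow> (0::real)"
    using tendsto_divide_pow2[of 1 0] by simp
  ultimately have "real_of_code f - real_of_code g \<le> 0"
    by (rule LIMSEQ_le) (use * in \<open>auto intro: less_imp_le\<close>)
  then show "real_of_code f \<le> real_of_code g" by simp
qed

lemma real_of_code_eq_iff:
  "real_of_code f = real_of_code g \<longleftrightarrow>
   (\<forall>n. \<bar>rat_of_code (hat_fun f (Suc n)) - rat_of_code (hat_fun g (Suc n))\<bar> < 1 / 2 ^ n)"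
  unfolding order_eq_iff real_of_code_le_iff abs_less_iff by (auto simp: algebra_simps)

section \<open>Arithmetic on representations of reals\<close>

definition add_real :: "(nat \<Rightarrow> nat) \<Rightarrow> (nat \<Rightarrow> nat) \<Rightarrow> nat \<Rightarrow> nat" where
  "add_real f g n = add_code (hat_fun f (Suc n)) (hat_fun g (Suc n))"

definition minus_real :: "(nat \<Rightarrow> nat) \<Rightarrow> nat \<Rightarrow> nat" where
  "minus_real f n = minus_code (hat_fun f n)"

definition abs_real :: "(nat \<Rightarrow> nat) \<Rightarrow> nat \<Rightarrow> nat" where
  "abs_real f n = abs_code (hat_fun f n)"

definition max_real :: "(nat \<Rightarrow> nat) \<Rightarrow> (nat \<Rightarrow> nat) \<Rightarrow> nat \<Rightarrow> nat" where
  "max_real f g n = max_code (hat_fun f n) (hat_fun g n)"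

definition mult_real :: "(nat \<Rightarrow> nat) \<Rightarrow> (nat \<Rightarrow> nat) \<Rightarrow> nat \<Rightarrow> nat" where
  "mult_real f g n = mult_code (hat_fun f (n + Suc (Suc (f 0 + g 0)))) (hat_fun g (n + Suc (Suc (f 0 + g 0))))"

definition recip_real :: "(nat \<Rightarrow> nat) \<Rightarrow> nat \<Rightarrow> nat" where
  "recip_real f n = recip_code (max_code (hat_fun f n) (eps_code 0))"

definition int_sqrt :: "nat \<Rightarrow> nat" where
  "int_sqrt n = nat \<lfloor>sqrt (real n)\<rfloor>"

definition sqrt_real :: "(nat \<Rightarrow> nat) \<Rightarrow> nat \<Rightarrow> nat" where
  "sqrt_real f n = (let p = Suc (Suc (Suc n)) in
     mk_code (int_sqrt (code_pos (hat_fun f (p + p)) * 2 ^ (p + p) div code_den (hat_fun f (p + p)))) 0 (2 ^ p))"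

lemma real_of_add_real: "real_of_code (add_real f g) = real_of_code f + real_of_code g"
proof (rule real_of_code_eqI)
  fix n
  show "\<bar>rat_of_code (add_real f g n) - rat_of_code (add_real f g (Suc n))\<bar> < 1 / 2 ^ Suc n"
    using hat_fun_fast[of f "Suc n"] hat_fun_fast[of g "Suc n"]
    by (simp add: add_real_def rat_of_add_code)
qed (auto simp: add_real_def rat_of_add_code intro!: tendsto_intros LIMSEQ_Suc hat_fun_tendsto)

lemma real_of_minus_real: "real_of_code (minus_real f) = - real_of_code f"
proof (rule real_of_code_eqI)
  fix n
  show "\<bar>rat_of_code (minus_real f n) - rat_of_code (minus_real f (Suc n))\<bar> < 1 / 2 ^ Suc n"
    using hat_fun_fast[of f n] by (simp add: minus_real_def rat_of_minus_code)
qed (auto simp: minus_real_def rat_of_minus_code intro!: tendsto_intros hat_fun_tendsto)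

lemma real_of_abs_real: "real_of_code (abs_real f) = \<bar>real_of_code f\<bar>"
proof (rule real_of_code_eqI)
  fix n
  show "\<bar>rat_of_code (abs_real f n) - rat_of_code (abs_real f (Suc n))\<bar> < 1 / 2 ^ Suc n"
    using hat_fun_fast[of f n] by (simp add: abs_real_def rat_of_abs_code)
qed (auto simp: abs_real_def rat_of_abs_code intro!: tendsto_intros hat_fun_tendsto)

lemma real_of_max_real: "real_of_code (max_real f g) = max (real_of_code f) (real_of_code g)"
proof (rule real_of_code_eqI)
  fix n
  show "\<bar>rat_of_code (max_real f g n) - rat_of_code (max_real f g (Suc n))\<bar> < 1 / 2 ^ Suc n"
    using hat_fun_fast[of f n] hat_fun_fast[of g n]
    unfolding max_real_def rat_of_max_code by linarith
qed (auto simp: max_real_def rat_of_max_code intro!: tendsto_max hat_fun_tendsto)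

lemma real_of_mult_real: "real_of_code (mult_real f g) = real_of_code f * real_of_code g"
proof (rule real_of_code_eqI)
  fix n
  define k where "k = Suc (Suc (f 0 + g 0))"
  define F where "F m = rat_of_code (hat_fun f m)" for m
  define G where "G m = rat_of_code (hat_fun g m)" for m
  define d where "d = (1::real) / 2 ^ Suc (n + k)"
  \<comment> \<open>Every approximation is within 1 of the limit, and the limit is within 1 of the
    approximation at 0.\<close>
  have bound: "\<bar>rat_of_code (hat_fun h m)\<bar> \<le> real (h 0) + 2" for h m
  proof -
    have "(1::real) / 2 ^ m \<le> 1" by simp
    then show ?thesis
      using hat_fun_approx[of h m] hat_fun_approx[of h 0, unfolded hat_fun_0 power_0 div_by_1]
        abs_rat_of_code_le[of "h 0"]
      by linarith
  qed
  have fast: "\<bar>F (n + k) - F (Suc (n + k))\<bar> < d" "\<bar>G (n + k) - G (Suc (n + k))\<bar> < d"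
    unfolding F_def G_def d_def by (rule hat_fun_fast)+
  have "\<bar>F (n + k) * G (n + k) - F (Suc (n + k)) * G (Suc (n + k))\<bar>
      \<le> \<bar>F (n + k)\<bar> * \<bar>G (n + k) - G (Suc (n + k))\<bar> + \<bar>G (Suc (n + k))\<bar> * \<bar>F (n + k) - F (Suc (n + k))\<bar>"
    using abs_triangle_ineq[of "F (n + k) * (G (n + k) - G (Suc (n + k)))"
        "G (Suc (n + k)) * (F (n + k) - F (Suc (n + k)))"]
    by (simp add: abs_mult[symmetric] algebra_simps)
  also have "\<dots> \<le> (real (f 0) + 2) * \<bar>G (n + k) - G (Suc (n + k))\<bar> + (real (g 0) + 2) * \<bar>F (n + k) - F (Suc (n + k))\<bar>"
    unfolding F_def G_def by (intro add_mono mult_right_mono bound) auto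
  also have "\<dots> < (real (f 0) + 2) * d + (real (g 0) + 2) * d"
    by (intro add_strict_mono mult_strict_left_mono fast) auto
  also have "\<dots> = real (k + 2) * d"
    by (simp add: k_def algebra_simps)
  \<comment> \<open>The purpose of the shift by \<open>k = f 0 + g 0 + 2\<close>: the bounds for the
    two factors add up to \<open>k + 2\<close>, and the shift gains the factor
    \<open>2 ^ k\<close>.\<close>
  also have "\<dots> \<le> 2 ^ k * d"
  proof (rule mult_right_mono)
    have "m + 4 \<le> 2 ^ Suc (Suc m)" for m :: nat by (induction m) auto
    from this[of "f 0 + g 0"] have "k + 2 \<le> 2 ^ k" by (simp add: k_def)
    then have "real (k + 2) \<le> real (2 ^ k)" by (simp only: of_nat_le_iff)
    then show "real (k + 2) \<le> 2 ^ k" by simp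
  qed (simp add: d_def)
  also have "\<dots> = 1 / 2 ^ Suc n" by (simp add: d_def power_add)
  finally show "\<bar>rat_of_code (mult_real f g n) - rat_of_code (mult_real f g (Suc n))\<bar> < 1 / 2 ^ Suc n"
    by (simp add: mult_real_def rat_of_mult_code F_def G_def k_def)
next
  show "(\<lambda>n. rat_of_code (mult_real f g n)) \<longlonglongrightarrow> real_of_code f * real_of_code g"
    unfolding mult_real_def rat_of_mult_code
    by (intro tendsto_mult LIMSEQ_ignore_initial_segment hat_fun_tendsto)
qed

lemma rat_of_recip_real: "rat_of_code (recip_real f n) = 1 / max (rat_of_code (hat_fun f n)) 1"
  unfolding recip_real_def by (subst rat_of_recip_code) (simp_all add: rat_of_max_code rat_of_eps_code)

lemma real_of_recip_real: "real_of_code (recip_real f) = 1 / max (real_of_code f) 1"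
proof (rule real_of_code_eqI)
  fix n
  define a where "a = max (rat_of_code (hat_fun f n)) 1"
  define b where "b = max (rat_of_code (hat_fun f (Suc n))) 1"
  have ab: "a \<ge> 1" "b \<ge> 1" by (auto simp: a_def b_def)
  then have "1 / a - 1 / b = (b - a) / (a * b)" by (simp add: field_simps)
  then have "\<bar>1 / a - 1 / b\<bar> = \<bar>a - b\<bar> / (a * b)"
    using ab by (simp add: abs_mult abs_minus_commute)
  \<comment> \<open>The truncation at 1 makes the denominator \<open>a * b\<close> at least
    1.\<close>
  also have "\<dots> \<le> \<bar>a - b\<bar>"
    using ab mult_mono[of 1 a 1 b] by (simp add: divide_le_eq mult_left_mono[of 1 "a * b" "\<bar>a - b\<bar>", simplified])
  also have "\<dots> < 1 / 2 ^ Suc n"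
    using hat_fun_fast[of f n] unfolding a_def b_def by linarith
  finally show "\<bar>rat_of_code (recip_real f n) - rat_of_code (recip_real f (Suc n))\<bar> < 1 / 2 ^ Suc n"
    by (simp only: rat_of_recip_real a_def b_def)
next
  show "(\<lambda>n. rat_of_code (recip_real f n)) \<longlonglongrightarrow> 1 / max (real_of_code f) 1"
    unfolding rat_of_recip_real
    by (intro tendsto_divide tendsto_const tendsto_max hat_fun_tendsto) auto
qed

lemma int_sqrt_bounds: "int_sqrt n * int_sqrt n \<le> n" "n < Suc (int_sqrt n) * Suc (int_sqrt n)"
proof -
  have w: "real (int_sqrt n) = of_int \<lfloor>sqrt (real n)\<rfloor>" by (simp add: int_sqrt_def)
  then have "real (int_sqrt n) \<le> sqrt (real n)" by simp
  then have "real (int_sqrt n) * real (int_sqrt n) \<le> sqrt (real n) * sqrt (real n)"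
    by (intro mult_mono) auto
  then have "real (int_sqrt n * int_sqrt n) \<le> real n" by simp
  then show "int_sqrt n * int_sqrt n \<le> n" by (simp only: of_nat_le_iff)
  have "sqrt (real n) < real (Suc (int_sqrt n))" using w by linarith
  then have "sqrt (real n) * sqrt (real n) < real (Suc (int_sqrt n)) * real (Suc (int_sqrt n))"
    by (intro mult_strict_mono) auto
  then have "real n < real (Suc (int_sqrt n) * Suc (int_sqrt n))"
    by (simp only: of_nat_mult real_sqrt_mult_self abs_of_nat)
  then show "n < Suc (int_sqrt n) * Suc (int_sqrt n)" by (simp only: of_nat_less_iff)
qed

text \<open>Rounding down the quotient loses nothing: an integer square is at most the quotient iff
  it is at most its integer part. So the scaled root lies between \<open>w\<close> and
  \<open>w + 1\<close>.\<close>

lemma int_sqrt_div_approx: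
  fixes a d N :: nat
  assumes d: "d > 0"
  shows "\<bar>real (int_sqrt (a * 2 ^ (p + p) div d)) / 2 ^ p - sqrt (real a / real d)\<bar> \<le> 1 / 2 ^ p"
proof -
  define w where "w = int_sqrt (a * 2 ^ (p + p) div d)"
  have "w * w * d \<le> a * 2 ^ (p + p)"
    using int_sqrt_bounds(1)[of "a * 2 ^ (p + p) div d"] d by (simp add: w_def less_eq_div_iff_mult_less_eq)
  then have "real (w * w * d) \<le> real (a * 2 ^ (p + p))" by (simp only: of_nat_le_iff)
  then have lo: "(real w / 2 ^ p)\<^sup>2 \<le> real a / real d"
    using d by (simp add: field_simps power2_eq_square power_add)
  define v where "v = Suc w"
  have "a * 2 ^ (p + p) < v * v * d"
    using int_sqrt_bounds(2)[of "a * 2 ^ (p + p) div d"] d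
    by (simp only: w_def v_def div_less_iff_less_mult)
  then have "real (a * 2 ^ (p + p)) < real (v * v * d)" by (simp only: of_nat_less_iff)
  then have up: "real a / real d \<le> (real v / 2 ^ p)\<^sup>2"
    using d by (simp add: field_simps power2_eq_square power_add)
  have "real w / 2 ^ p \<le> sqrt (real a / real d)"
    by (rule real_le_rsqrt[OF lo])
  moreover have "sqrt (real a / real d) \<le> real v / 2 ^ p"
    by (rule real_le_lsqrt[OF _ up]) simp_all
  moreover have "real v / 2 ^ p = real w / 2 ^ p + 1 / 2 ^ p"
    by (simp add: v_def add_divide_distrib)
  ultimately show ?thesis
    unfolding w_def[symmetric] by linarith
qed

text \<open>The modulus of continuity of the square root is itself a square root; hence
  \<open>sqrt_real\<close> reads its argument at index \<open>p + p\<close> to obtain precision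
  \<open>p\<close>.\<close>

lemma abs_sqrt_diff_le:
  fixes a b :: real
  assumes "a \<ge> 0" "b \<ge> 0"
  shows "\<bar>sqrt a - sqrt b\<bar> \<le> sqrt \<bar>a - b\<bar>"
proof -
  have *: "sqrt a \<le> sqrt b + sqrt \<bar>a - b\<bar>" if "b \<ge> 0" for a b :: real
  proof -
    have "sqrt a \<le> sqrt (b + \<bar>a - b\<bar>)" by simp
    also have "\<dots> \<le> sqrt b + sqrt \<bar>a - b\<bar>" using that by (intro sqrt_add_le_add_sqrt) auto
    finally show ?thesis .
  qed
  from *[of b a] *[of a b] assms show ?thesis by (simp add: abs_minus_commute abs_le_iff)
qed

lemma code_pos_div_den: "real (code_pos c) / real (code_den c) = max (rat_of_code c) 0"
  using code_pos_or_neg[of c] by (auto simp: rat_of_code_eq max_def divide_le_0_iff)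

text \<open>One error \<open>1 / 2 ^ p\<close> comes from the integer square root, another from
  replacing \<open>f\<close> by its approximation.\<close>

lemma sqrt_real_approx:
  "\<bar>rat_of_code (sqrt_real f n) - sqrt (max (real_of_code f) 0)\<bar> \<le> 2 / 2 ^ (n + 3)"
proof -
  define p where "p = n + 3"
  define c where "c = hat_fun f (p + p)"
  have p: "Suc (Suc (Suc n)) = p" by (simp add: p_def)
  have "rat_of_code (sqrt_real f n) = real (int_sqrt (code_pos c * 2 ^ (p + p) div code_den c)) / 2 ^ p"
    unfolding sqrt_real_def Let_def p c_def[symmetric] by (subst rat_of_mk_code) simp_all
  then have 1: "\<bar>rat_of_code (sqrt_real f n) - sqrt (max (rat_of_code c) 0)\<bar> \<le> 1 / 2 ^ p"
    using int_sqrt_div_approx[OF code_den_pos(1), of "code_pos c" p c] by (simp only: code_pos_div_den)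
  have "\<bar>sqrt (max (rat_of_code c) 0) - sqrt (max (real_of_code f) 0)\<bar>
      \<le> sqrt \<bar>max (rat_of_code c) 0 - max (real_of_code f) 0\<bar>"
    by (rule abs_sqrt_diff_le) auto
  also have "\<dots> \<le> sqrt (1 / 2 ^ (p + p))"
    by (rule real_sqrt_le_mono) (use hat_fun_approx[of f "p + p"] in \<open>unfold c_def, linarith\<close>)
  also have "\<dots> = 1 / 2 ^ p"
    by (simp add: power_add real_sqrt_divide)
  finally show ?thesis
    using 1 by (simp add: p_def)
qed

lemma real_of_sqrt_real: "real_of_code (sqrt_real f) = sqrt (max (real_of_code f) 0)"
proof (rule real_of_code_eqI)
  fix n
  have "\<bar>rat_of_code (sqrt_real f n) - rat_of_code (sqrt_real f (Suc n))\<bar> \<le> 2 / 2 ^ (n + 3) + 2 / 2 ^ (Suc n + 3)"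
    using sqrt_real_approx[of f n] sqrt_real_approx[of f "Suc n"] by linarith
  \<comment> \<open>In units of \<open>1 / 2 ^ n\<close> this is 3/8 against 1/2, which explains the
    choice \<open>p = n + 3\<close>.\<close>
  also have "\<dots> < 1 / 2 ^ Suc n" by (simp add: power_add field_simps)
  finally show "\<bar>rat_of_code (sqrt_real f n) - rat_of_code (sqrt_real f (Suc n))\<bar> < 1 / 2 ^ Suc n" .
next
  have "(\<lambda>n. rat_of_code (sqrt_real f n) - sqrt (max (real_of_code f) 0)) \<longlonglongrightarrow> 0"
  proof (rule Lim_null_comparison[OF always_eventually tendsto_divide_pow2])
    show "\<forall>n. norm (rat_of_code (sqrt_real f n) - sqrt (max (real_of_code f) 0)) \<le> 2 / 2 ^ (n + 3)"
      using sqrt_real_approx by (simp only: real_norm_def) blast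
  qed
  then show "(\<lambda>n. rat_of_code (sqrt_real f n)) \<longlonglongrightarrow> sqrt (max (real_of_code f) 0)"
    by (rule LIM_zero_cancel)
qed

section \<open>The dyadic representations \<open>circ\<close> and \<open>circ_plus\<close>\<close>

lemma Max_dyadic:
  assumes "x \<ge> 0"
  shows "Max {k::nat. real k / 2 ^ (n + 1) \<le> x} = nat \<lfloor>x * 2 ^ (n + 1)\<rfloor>"
proof -
  have "{k::nat. real k / 2 ^ (n + 1) \<le> x} = {..nat \<lfloor>x * 2 ^ (n + 1)\<rfloor>}"
    using assms by (auto simp: divide_le_eq le_nat_iff le_floor_iff)
  moreover have "Max {..m} = m" for m :: nat by (rule Max_eqI) auto
  ultimately show ?thesis by (simp only:)
qed

lemma dyadic_floor:
  assumes "x \<ge> 0"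
  defines "K \<equiv> \<lambda>n. real (nat \<lfloor>x * 2 ^ (n + 1)\<rfloor>) / 2 ^ (n + 1)"
  shows "\<bar>K n - K (Suc n)\<bar> < 1 / 2 ^ Suc n" "K \<longlonglongrightarrow> x"
proof -
  have bounds: "K n \<le> x" "x < K n + 1 / 2 ^ (n + 1)" for n
  proof -
    have "real (nat \<lfloor>x * 2 ^ (n + 1)\<rfloor>) = of_int \<lfloor>x * 2 ^ (n + 1)\<rfloor>"
      using assms by simp
    then have "real (nat \<lfloor>x * 2 ^ (n + 1)\<rfloor>) \<le> x * 2 ^ (n + 1)"
      "x * 2 ^ (n + 1) < real (nat \<lfloor>x * 2 ^ (n + 1)\<rfloor>) + 1"
      by linarith+
    then show "K n \<le> x" "x < K n + 1 / 2 ^ (n + 1)"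
      unfolding K_def by (simp_all add: field_simps)
  qed
  \<comment> \<open>Both truncations lie above \<open>x - 1 / 2 ^ (n + 1)\<close> and not above
    \<open>x\<close>, so their distance is strictly below the length of this interval.\<close>
  have "(1::real) / 2 ^ (Suc n + 1) \<le> 1 / 2 ^ (n + 1)" by (simp add: field_simps)
  then show "\<bar>K n - K (Suc n)\<bar> < 1 / 2 ^ Suc n"
    using bounds[of n] bounds[of "Suc n"] by simp
  have "(\<lambda>n. K n - x) \<longlonglongrightarrow> 0"
  proof (rule Lim_null_comparison[OF always_eventually tendsto_divide_pow2])
    have "norm (K n - x) \<le> 1 / 2 ^ (n + 1)" for n
      using bounds[of n] unfolding real_norm_def by linarith
    then show "\<forall>n. norm (K n - x) \<le> 1 / 2 ^ (n + 1)" by blast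
  qed
  then show "K \<longlonglongrightarrow> x" by (rule LIM_zero_cancel)
qed

lemma rat_of_circ:
  assumes "x \<ge> 0"
  shows "rat_of_code (circ x n) = real (nat \<lfloor>x * 2 ^ (n + 1)\<rfloor>) / 2 ^ (n + 1)"
  unfolding circ_def Max_dyadic[OF assms] by (simp add: rat_of_code_def of_nat_diff)

lemma real_of_circ: "x \<ge> 0 \<Longrightarrow> real_of_code (circ x) = x"
  by (rule real_of_code_eqI) (simp_all only: rat_of_circ dyadic_floor)

lemma rat_of_circ_plus_neg:
  assumes "x < 0"
  shows "rat_of_code (circ_plus x n) = - (real (nat \<lfloor>- x * 2 ^ (n + 1)\<rfloor>) / 2 ^ (n + 1))"
proof -
  define K where "K = nat \<lfloor>- x * 2 ^ (n + 1)\<rfloor>"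
  have "circ_plus x n = prod_encode (2 * K - 1, 2 ^ (n + 1) - 1)"
    unfolding circ_plus_def K_def using assms by (subst Max_dyadic) auto
  \<comment> \<open>For \<open>K > 0\<close> the odd numerator \<open>2 * K - 1\<close> codes the
    negative fraction with numerator \<open>2 * K\<close>; for \<open>K = 0\<close> truncated
    subtraction yields 0, an even numerator with value 0.\<close>
  moreover have "odd (2 * K - 1)" if "K > 0" using that by presburger
  ultimately show ?thesis
    unfolding K_def[symmetric] by (cases "K > 0") (simp_all add: rat_of_code_def of_nat_diff)
qed

lemma real_of_circ_plus: "real_of_code (circ_plus x) = x"
proof (cases "x \<ge> 0")
  case True
  then have "circ_plus x = circ x" by (simp add: circ_plus_def fun_eq_iff)
  with True show ?thesis by (simp add: real_of_circ)
next
  case False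
  then have x: "- x \<ge> 0" "x < 0" by auto
  show ?thesis
  proof (rule real_of_code_eqI)
    show "\<bar>rat_of_code (circ_plus x n) - rat_of_code (circ_plus x (Suc n))\<bar> < 1 / 2 ^ Suc n" for n
      using dyadic_floor(1)[OF x(1), of n] unfolding rat_of_circ_plus_neg[OF x(2)] by linarith
    show "(\<lambda>n. rat_of_code (circ_plus x n)) \<longlonglongrightarrow> x"
      using tendsto_minus[OF dyadic_floor(2)[OF x(1)]] unfolding rat_of_circ_plus_neg[OF x(2)] by simp
  qed
qed

lemma prod_encode_mono: "a \<le> a' \<Longrightarrow> b \<le> b' \<Longrightarrow> prod_encode (a, b) \<le> prod_encode (a', b')"
proof -
  assume *: "a \<le> a'" "b \<le> b'"
  have "mono triangle" by (rule incseq_SucI) simp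
  then have "triangle (a + b) \<le> triangle (a' + b')" using * by (simp add: monoD)
  then show ?thesis using * by (simp add: prod_encode_def)
qed

lemma dyadic_floor_mono:
  fixes x y :: real
  assumes "0 \<le> x" "x \<le> y" "n \<le> m"
  shows "nat \<lfloor>x * 2 ^ (n + 1)\<rfloor> \<le> nat \<lfloor>y * 2 ^ (m + 1)\<rfloor>"
  using assms by (intro nat_mono floor_mono mult_mono power_increasing) auto

text \<open>Majorization at type 1 compares the codes as natural numbers, not the rationals they
  stand for. The Cantor code grows with both components, and these do not decrease when the real or
  the index grows.\<close>

lemma circ_mono:
  assumes "0 \<le> x" "x \<le> y" "n \<le> m"
  shows "circ x n \<le> circ y m"
proof -
  have "prod_encode (2 * nat \<lfloor>x * 2 ^ (n + 1)\<rfloor>, 2 ^ (n + 1) - 1)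
      \<le> prod_encode (2 * nat \<lfloor>y * 2 ^ (m + 1)\<rfloor>, 2 ^ (m + 1) - 1)"
    using assms by (intro prod_encode_mono mult_le_mono2 dyadic_floor_mono diff_le_mono power_increasing) auto
  with assms show ?thesis unfolding circ_def by (subst (1 2) Max_dyadic) auto
qed

text \<open>For negative \<open>x\<close> the numerator is one less than for its absolute value, or
  both are 0.\<close>

lemma circ_plus_le_circ: "\<bar>x\<bar> \<le> y \<Longrightarrow> n \<le> m \<Longrightarrow> circ_plus x n \<le> circ y m"
proof (cases "x \<ge> 0")
  case False
  assume *: "\<bar>x\<bar> \<le> y" "n \<le> m"
  have "nat \<lfloor>- x * 2 ^ (n + 1)\<rfloor> \<le> nat \<lfloor>y * 2 ^ (m + 1)\<rfloor>"
    using * False by (intro dyadic_floor_mono) auto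
  then have "prod_encode (2 * nat \<lfloor>- x * 2 ^ (n + 1)\<rfloor> - 1, 2 ^ (n + 1) - 1)
      \<le> prod_encode (2 * nat \<lfloor>y * 2 ^ (m + 1)\<rfloor>, 2 ^ (m + 1) - 1)"
    using * by (intro prod_encode_mono diff_le_mono power_increasing) auto
  moreover have "circ_plus x n = prod_encode (2 * nat \<lfloor>- x * 2 ^ (n + 1)\<rfloor> - 1, 2 ^ (n + 1) - 1)"
    unfolding circ_plus_def using False by (subst Max_dyadic) auto
  moreover have "circ y m = prod_encode (2 * nat \<lfloor>y * 2 ^ (m + 1)\<rfloor>, 2 ^ (m + 1) - 1)"
    unfolding circ_def using * by (subst Max_dyadic) auto
  ultimately show ?thesis by simp
qed (simp add: circ_plus_def circ_mono)

section \<open>Terms in a full universe\<close>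

lemma lam_typing:
  assumes "wt UNIV t"
  shows wt_lam_UNIV: "wt UNIV (lam v t)" and ty_of_lam: "ty_of (lam v t) = Fn (snd v) (ty_of t)"
proof -
  have "wt UNIV (lam v t) \<and> ty_of (lam v t) = Fn (snd v) (ty_of t)"
    using assms by (induction t) (auto simp: Let_def)
  then show "wt UNIV (lam v t)" "ty_of (lam v t) = Fn (snd v) (ty_of t)" by auto
qed

lemma fvt_lam [simp]: "fvt (lam v t) = fvt t - {v}"
  by (induction t) (auto simp: Let_def)

declare wt_lam_UNIV [simp] ty_of_lam [simp]

lemma finite_fvt: "finite (fvt t)"
  by (induction t) auto

lemma fresh_notin_fvt: "t \<in> set ts \<Longrightarrow> fresh ts \<le> n \<Longrightarrow> (n, \<rho>) \<notin> fvt t"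
proof
  assume t: "t \<in> set ts" and n: "fresh ts \<le> n" and v: "(n, \<rho>) \<in> fvt t"
  have "n \<in> insert 0 (fst ` (\<Union>t\<in>set ts. fvt t))"
    using t v by force
  then have "n \<le> Max (insert 0 (fst ` (\<Union>t\<in>set ts. fvt t)))"
    by (intro Max_ge) (auto simp: finite_fvt)
  with n show False by (simp add: fresh_def)
qed

lemma foldl_App_tval: "tval M e (apps t ts) = foldl (mapp M) (tval M e t) (map (tval M e) ts)"
  by (induction ts arbitrary: t) auto

lemma tval_cong: "(\<And>v. v \<in> fvt t \<Longrightarrow> e v = e' v) \<Longrightarrow> tval M e t = tval M e' t"
  by (induction t) auto

lemma tval_upd_notin [simp]: "v \<notin> fvt t \<Longrightarrow> tval M (e(v := a)) t = tval M e t"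
  by (rule tval_cong) auto

lemma assoc_model_simps [simp]:
  "mcar (assoc_model U sc star tr) = car U"
  "mapp (assoc_model U sc star tr) = app U"
  "mint (assoc_model U sc star tr) = cst_int U sc star tr"
  by (simp_all add: assoc_model_def)

section \<open>Elements and functions of a full universe\<close>

locale full_universe_model =
  fixes U :: "('u, 'a::{real_normed_algebra_1, banach}) universe"
    and sc :: "complex \<Rightarrow> 'a \<Rightarrow> 'a" and star :: "'a \<Rightarrow> 'a" and tr :: "'a \<Rightarrow> complex"
  assumes full: "full_universe U"
begin

abbreviation "D \<equiv> tys U"
abbreviation "M \<equiv> assoc_model U sc star tr"
abbreviation "val \<equiv> tval M"

lemma base_types [simp]: "Nt \<in> D" "Xt \<in> D"
  using full by (auto simp: full_universe_def)

lemma Fn_typesD: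
  assumes "Fn \<rho> \<tau> \<in> D"
  shows Fn_type_dom: "\<rho> \<in> D" and Fn_type_cod: "\<tau> \<in> D"
  using full assms unfolding full_universe_def by blast+

lemma bij_num: "bij_betw (num U) UNIV (car U Nt)" and bij_elt: "bij_betw (elt U) UNIV (car U Xt)"
  using full unfolding full_universe_def by blast+

lemma bij_app:
  "Fn \<rho> \<tau> \<in> D \<Longrightarrow>
    bij_betw (\<lambda>f. restrict (app U f) (car U \<rho>)) (car U (Fn \<rho> \<tau>)) (car U \<rho> \<rightarrow>\<^sub>E car U \<tau>)"
  using full unfolding full_universe_def by blast

lemma num_in [simp]: "num U n \<in> car U Nt"
  using bij_num by (auto simp: bij_betw_def)

lemma elt_in [simp]: "elt U x \<in> car U Xt"
  using bij_elt by (auto simp: bij_betw_def)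

lemma num_eq_iff [simp]: "num U m = num U n \<longleftrightarrow> m = n"
  using bij_num by (auto simp: bij_betw_def inj_eq)

lemma elt_eq_iff [simp]: "elt U x = elt U y \<longleftrightarrow> x = y"
  using bij_elt by (auto simp: bij_betw_def inj_eq)

lemma the_num_num [simp]: "the_num U (num U n) = n"
  unfolding the_num_def by (rule inv_f_f) (use bij_num in \<open>auto simp: bij_betw_def\<close>)

lemma the_elt_elt [simp]: "the_elt U (elt U x) = x"
  unfolding the_elt_def by (rule inv_f_f) (use bij_elt in \<open>auto simp: bij_betw_def\<close>)

lemma num_the_num [simp]: "x \<in> car U Nt \<Longrightarrow> num U (the_num U x) = x"
  unfolding the_num_def by (rule f_inv_into_f) (use bij_num in \<open>auto simp: bij_betw_def\<close>)

lemma elt_the_elt [simp]: "x \<in> car U Xt \<Longrightarrow> elt U (the_elt U x) = x"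
  unfolding the_elt_def by (rule f_inv_into_f) (use bij_elt in \<open>auto simp: bij_betw_def\<close>)

lemma the_elt_eq_iff: "x \<in> car U Xt \<Longrightarrow> y \<in> car U Xt \<Longrightarrow> the_elt U x = the_elt U y \<longleftrightarrow> x = y"
  by (metis elt_the_elt)

lemma app_in: "Fn \<rho> \<tau> \<in> D \<Longrightarrow> f \<in> car U (Fn \<rho> \<tau>) \<Longrightarrow> x \<in> car U \<rho> \<Longrightarrow> app U f x \<in> car U \<tau>"
  using bij_betwE[OF bij_app, of \<rho> \<tau>] by (force simp: PiE_iff)

lemma fun_ext:
  assumes "Fn \<rho> \<tau> \<in> D" "f \<in> car U (Fn \<rho> \<tau>)" "g \<in> car U (Fn \<rho> \<tau>)"
    and "\<And>x. x \<in> car U \<rho> \<Longrightarrow> app U f x = app U g x"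
  shows "f = g"
proof -
  have "inj_on (\<lambda>f. restrict (app U f) (car U \<rho>)) (car U (Fn \<rho> \<tau>))"
    using bij_app[OF assms(1)] by (simp add: bij_betw_def)
  moreover have "restrict (app U f) (car U \<rho>) = restrict (app U g) (car U \<rho>)"
    using assms(4) by (auto simp: fun_eq_iff)
  ultimately show ?thesis using assms(2,3) by (auto dest: inj_onD)
qed

text \<open>Surjectivity of \<open>app\<close> gives existence and injectivity gives uniqueness, so
  the definite description in \<open>fun_code\<close> denotes.\<close>

lemma fun_code:
  assumes D: "Fn \<rho> \<tau> \<in> D" and f: "\<And>x. x \<in> car U \<rho> \<Longrightarrow> f x \<in> car U \<tau>"
  shows fun_code_in: "fun_code U \<rho> \<tau> f \<in> car U (Fn \<rho> \<tau>)"
    and app_fun_code: "x \<in> car U \<rho> \<Longrightarrow> app U (fun_code U \<rho> \<tau> f) x = f x"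
proof -
  have "restrict f (car U \<rho>) \<in> (\<lambda>f. restrict (app U f) (car U \<rho>)) ` car U (Fn \<rho> \<tau>)"
    using bij_app[OF D] f by (auto simp: bij_betw_def)
  then obtain g where g: "g \<in> car U (Fn \<rho> \<tau>)" "restrict f (car U \<rho>) = restrict (app U g) (car U \<rho>)"
    by blast
  have gx: "app U g x = f x" if "x \<in> car U \<rho>" for x
    using fun_cong[OF g(2), of x] that by simp
  have "\<exists>!g. g \<in> car U (Fn \<rho> \<tau>) \<and> (\<forall>x\<in>car U \<rho>. app U g x = f x)"
  proof (rule ex1I)
    show "g \<in> car U (Fn \<rho> \<tau>) \<and> (\<forall>x\<in>car U \<rho>. app U g x = f x)"
      by (simp add: g(1) gx)
    show "g' = g" if "g' \<in> car U (Fn \<rho> \<tau>) \<and> (\<forall>x\<in>car U \<rho>. app U g' x = f x)" for g'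
      by (rule fun_ext[OF D]) (use that g(1) gx in auto)
  qed
  from theI'[OF this] show "fun_code U \<rho> \<tau> f \<in> car U (Fn \<rho> \<tau>)"
    and "x \<in> car U \<rho> \<Longrightarrow> app U (fun_code U \<rho> \<tau> f) x = f x"
    unfolding fun_code_def by auto
qed

text \<open>Needed for the quantifier axioms when the quantified variable does not occur and the
  instantiating term cannot be evaluated.\<close>

lemma car_nonempty: "\<rho> \<in> D \<Longrightarrow> car U \<rho> \<noteq> {}"
proof (induction \<rho>)
  case (Fn \<rho> \<tau>)
  then obtain b where "b \<in> car U \<tau>" using Fn_typesD by blast
  then have "fun_code U \<rho> \<tau> (\<lambda>_. b) \<in> car U (Fn \<rho> \<tau>)"
    using Fn.prems by (intro fun_code_in) auto
  then show ?case by blast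
qed (use num_in elt_in in blast)+

lemma funs_code:
  assumes "fns \<rho>s \<tau> \<in> D"
    and "\<And>xs. list_all2 (\<lambda>x \<rho>. x \<in> car U \<rho>) xs \<rho>s \<Longrightarrow> f xs \<in> car U \<tau>"
  shows funs_code_in: "funs_code U \<rho>s \<tau> f \<in> car U (fns \<rho>s \<tau>)"
    and foldl_funs_code: "list_all2 (\<lambda>x \<rho>. x \<in> car U \<rho>) xs \<rho>s \<Longrightarrow> foldl (app U) (funs_code U \<rho>s \<tau> f) xs = f xs"
proof -
  have "funs_code U \<rho>s \<tau> f \<in> car U (fns \<rho>s \<tau>) \<and>
    (\<forall>xs. list_all2 (\<lambda>x \<rho>. x \<in> car U \<rho>) xs \<rho>s \<longrightarrow> foldl (app U) (funs_code U \<rho>s \<tau> f) xs = f xs)"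
    using assms
  proof (induction \<rho>s arbitrary: f)
    case (Cons \<rho> \<rho>s)
    then have D: "Fn \<rho> (fns \<rho>s \<tau>) \<in> D" by simp
    then have D': "fns \<rho>s \<tau> \<in> D" by (rule Fn_typesD)
    have IH: "funs_code U \<rho>s \<tau> (\<lambda>xs. f (x # xs)) \<in> car U (fns \<rho>s \<tau>) \<and>
       (\<forall>xs. list_all2 (\<lambda>x \<rho>. x \<in> car U \<rho>) xs \<rho>s \<longrightarrow>
          foldl (app U) (funs_code U \<rho>s \<tau> (\<lambda>xs. f (x # xs))) xs = f (x # xs))"
      if "x \<in> car U \<rho>" for x
      using that Cons.prems(2) by (intro Cons.IH[OF D']) auto
    let ?g = "\<lambda>x. funs_code U \<rho>s \<tau> (\<lambda>xs. f (x # xs))"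
    have g: "?g x \<in> car U (fns \<rho>s \<tau>)" if "x \<in> car U \<rho>" for x using IH[OF that] by blast
    have "foldl (app U) (fun_code U \<rho> (fns \<rho>s \<tau>) ?g) xs = f xs"
      if xs: "list_all2 (\<lambda>x \<rho>. x \<in> car U \<rho>) xs (\<rho> # \<rho>s)" for xs
    proof -
      obtain y ys where y: "xs = y # ys" "y \<in> car U \<rho>" "list_all2 (\<lambda>x \<rho>. x \<in> car U \<rho>) ys \<rho>s"
        using xs by (auto simp: list_all2_Cons2)
      have "app U (fun_code U \<rho> (fns \<rho>s \<tau>) ?g) y = ?g y" by (rule app_fun_code[OF D g y(2)])
      then show ?thesis using IH[OF y(2)] y by simp
    qed
    moreover have "fun_code U \<rho> (fns \<rho>s \<tau>) ?g \<in> car U (Fn \<rho> (fns \<rho>s \<tau>))"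
      by (rule fun_code_in[OF D g])
    ultimately show ?case by simp
  qed simp
  then show "funs_code U \<rho>s \<tau> f \<in> car U (fns \<rho>s \<tau>)"
    and "list_all2 (\<lambda>x \<rho>. x \<in> car U \<rho>) xs \<rho>s \<Longrightarrow> foldl (app U) (funs_code U \<rho>s \<tau> f) xs = f xs"
    by auto
qed

lemma foldl_app_in:
  "fns \<rho>s \<tau> \<in> D \<Longrightarrow> f \<in> car U (fns \<rho>s \<tau>) \<Longrightarrow> list_all2 (\<lambda>x \<rho>. x \<in> car U \<rho>) xs \<rho>s \<Longrightarrow>
    foldl (app U) f xs \<in> car U \<tau>"
proof (induction \<rho>s arbitrary: f xs)
  case (Cons \<rho> \<rho>s)
  then obtain y ys where xs: "xs = y # ys" "y \<in> car U \<rho>" "list_all2 (\<lambda>x \<rho>. x \<in> car U \<rho>) ys \<rho>s"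
    by (auto simp: list_all2_Cons2)
  have D: "Fn \<rho> (fns \<rho>s \<tau>) \<in> D" using Cons.prems by simp
  have "app U f y \<in> car U (fns \<rho>s \<tau>)" using Cons.prems xs by (intro app_in[OF D]) auto
  from Cons.IH[OF Fn_type_cod[OF D] this xs(3)] show ?case by (simp add: xs)
qed simp

lemma fns_typesD: "fns \<rho>s \<tau> \<in> D \<Longrightarrow> \<tau> \<in> D" "fns \<rho>s \<tau> \<in> D \<Longrightarrow> \<rho> \<in> set \<rho>s \<Longrightarrow> \<rho> \<in> D"
  by (induction \<rho>s) (auto dest: Fn_typesD)

lemma rec_val_in:
  assumes D: "\<And>\<rho>. \<rho> \<in> set \<rho>s \<Longrightarrow> stepty \<rho>s \<rho> \<in> D"
    and ys: "list_all2 (\<lambda>x \<rho>. x \<in> car U \<rho>) ys \<rho>s"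
    and zs: "list_all2 (\<lambda>x \<rho>. x \<in> car U \<rho>) zs (map (stepty \<rho>s) \<rho>s)"
  shows "list_all2 (\<lambda>x \<rho>. x \<in> car U \<rho>) (rec_val U ys zs n) \<rho>s"
proof (induction n)
  case (Suc n)
  show ?case
  proof (rule list_all2_all_nthI)
    have len: "length zs = length \<rho>s" using zs by (auto dest: list_all2_lengthD)
    then show "length (rec_val U ys zs (Suc n)) = length \<rho>s" by simp
    fix i assume "i < length (rec_val U ys zs (Suc n))"
    then have i: "i < length \<rho>s" using len by simp
    have "zs ! i \<in> car U (stepty \<rho>s (\<rho>s ! i))"
      using list_all2_nthD[OF zs, of i] i len by simp
    moreover have "list_all2 (\<lambda>x \<rho>. x \<in> car U \<rho>) (rec_val U ys zs n @ [num U n]) (\<rho>s @ [Nt])"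
      using Suc by (intro list_all2_appendI) auto
    ultimately have "foldl (app U) (zs ! i) (rec_val U ys zs n @ [num U n]) \<in> car U (\<rho>s ! i)"
      using D i by (intro foldl_app_in[where \<rho>s = "\<rho>s @ [Nt]"]) auto
    then show "rec_val U ys zs (Suc n) ! i \<in> car U (\<rho>s ! i)" using i len by simp
  qed
qed (simp add: ys)

lemma recursor:
  assumes i: "i < length \<rho>s" and D: "cty (Rec \<rho>s i) \<in> D"
  shows Rec_in: "cst_int U sc star tr (Rec \<rho>s i) \<in> car U (cty (Rec \<rho>s i))"
    and foldl_Rec: "list_all2 (\<lambda>x \<rho>. x \<in> car U \<rho>) ys \<rho>s \<Longrightarrow>
      list_all2 (\<lambda>x \<rho>. x \<in> car U \<rho>) zs (map (stepty \<rho>s) \<rho>s) \<Longrightarrow>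
      foldl (app U) (cst_int U sc star tr (Rec \<rho>s i)) (num U n # ys @ zs) = rec_val U ys zs n ! i"
proof -
  let ?f = "\<lambda>as. rec_val U (take (length \<rho>s) (tl as)) (drop (length \<rho>s) (tl as)) (the_num U (hd as)) ! i"
  have D': "fns (Nt # \<rho>s @ map (stepty \<rho>s) \<rho>s) (\<rho>s ! i) \<in> D" using D by (simp only: cty.simps)
  have step: "stepty \<rho>s \<rho> \<in> D" if "\<rho> \<in> set \<rho>s" for \<rho>
    using fns_typesD(2)[OF D', of "stepty \<rho>s \<rho>"] that by simp
  have in_car: "?f as \<in> car U (\<rho>s ! i)"
    if as: "list_all2 (\<lambda>x \<rho>. x \<in> car U \<rho>) as (Nt # \<rho>s @ map (stepty \<rho>s) \<rho>s)" for as
  proof -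
    obtain a ys zs where as': "as = a # ys @ zs" "list_all2 (\<lambda>x \<rho>. x \<in> car U \<rho>) ys \<rho>s"
      "list_all2 (\<lambda>x \<rho>. x \<in> car U \<rho>) zs (map (stepty \<rho>s) \<rho>s)"
      using as by (auto simp: list_all2_Cons2 list_all2_append2)
    then have "length ys = length \<rho>s" by (auto dest: list_all2_lengthD)
    with as' i list_all2_nthD2[OF rec_val_in[OF step as'(2,3)] i] show ?thesis by simp
  qed
  show "cst_int U sc star tr (Rec \<rho>s i) \<in> car U (cty (Rec \<rho>s i))"
    using funs_code_in[OF D' in_car] by (simp only: cst_int.simps cty.simps)
  assume ys: "list_all2 (\<lambda>x \<rho>. x \<in> car U \<rho>) ys \<rho>s"
    and zs: "list_all2 (\<lambda>x \<rho>. x \<in> car U \<rho>) zs (map (stepty \<rho>s) \<rho>s)"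
  have "list_all2 (\<lambda>x \<rho>. x \<in> car U \<rho>) (num U n # ys @ zs) (Nt # \<rho>s @ map (stepty \<rho>s) \<rho>s)"
    using ys zs by (auto intro: list_all2_appendI)
  note foldl_funs_code[OF D' in_car this]
  moreover have "length ys = length \<rho>s" using ys by (auto dest: list_all2_lengthD)
  ultimately show "foldl (app U) (cst_int U sc star tr (Rec \<rho>s i)) (num U n # ys @ zs) = rec_val U ys zs n ! i"
    by (simp only: cst_int.simps) simp
qed

lemma code1_in: "T1 \<in> D \<Longrightarrow> code1 U f \<in> car U T1"
  unfolding code1_def by (intro fun_code_in) auto

lemma decode1_code1: "T1 \<in> D \<Longrightarrow> decode1 U (code1 U f) = f"
  by (rule ext) (simp add: decode1_def code1_def app_fun_code)

lemma app_decode1: "T1 \<in> D \<Longrightarrow> f \<in> car U T1 \<Longrightarrow> app U f (num U n) = num U (decode1 U f n)"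
  unfolding decode1_def by (subst num_the_num) (auto intro: app_in)

lemma VN_in: "vnty c \<in> D \<Longrightarrow> vn_int U sc star tr c \<in> car U (vnty c)"
  by (cases c) (auto intro!: fun_code_in code1_in dest: Fn_typesD)

lemma Maj_in: "hatty (vnty c) \<in> D \<Longrightarrow> maj_int U c \<in> car U (hatty (vnty c))"
  by (cases c) (auto intro!: fun_code_in code1_in dest: Fn_typesD)

lemma cst_in:
  assumes "cst_ok c" "cty c \<in> D"
  shows "cst_int U sc star tr c \<in> car U (cty c)"
proof (cases c)
  case (Rec \<rho>s i)
  with assms Rec_in[of i \<rho>s] show ?thesis by simp
next
  case (Sig \<delta> \<rho> \<tau>)
  then have D: "Fn (Fn \<delta> (Fn \<rho> \<tau>)) (Fn (Fn \<delta> \<rho>) (Fn \<delta> \<tau>)) \<in> D" using assms by simp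
  then have "Fn (Fn \<delta> \<rho>) (Fn \<delta> \<tau>) \<in> D" "Fn \<delta> (Fn \<rho> \<tau>) \<in> D" "Fn \<delta> \<tau> \<in> D" "Fn \<delta> \<rho> \<in> D" "Fn \<rho> \<tau> \<in> D"
    using Fn_typesD by blast+
  with D show ?thesis
    unfolding Sig cst_int.simps cty.simps by (intro fun_code_in) (auto intro: app_in)
next
  case (Pi \<rho> \<tau>)
  with assms show ?thesis by (auto intro!: fun_code_in dest: Fn_typesD)
qed (use assms VN_in Maj_in in \<open>auto intro!: fun_code_in\<close>)

lemma app_Pi:
  assumes "cty (Pi \<rho> \<tau>) \<in> D" "x \<in> car U \<rho>" "y \<in> car U \<tau>"
  shows "app U (app U (cst_int U sc star tr (Pi \<rho> \<tau>)) x) y = x"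
proof -
  have D: "Fn \<rho> (Fn \<tau> \<rho>) \<in> D" "Fn \<tau> \<rho> \<in> D" using assms(1) by (auto dest: Fn_typesD)
  with assms(2,3) show ?thesis by (simp add: app_fun_code fun_code_in)
qed

lemma app_Sig:
  assumes "cty (Sig \<delta> \<rho> \<tau>) \<in> D" "x \<in> car U (Fn \<delta> (Fn \<rho> \<tau>))" "y \<in> car U (Fn \<delta> \<rho>)" "z \<in> car U \<delta>"
  shows "app U (app U (app U (cst_int U sc star tr (Sig \<delta> \<rho> \<tau>)) x) y) z = app U (app U x z) (app U y z)"
proof -
  have D: "Fn (Fn \<delta> (Fn \<rho> \<tau>)) (Fn (Fn \<delta> \<rho>) (Fn \<delta> \<tau>)) \<in> D" using assms by simp
  then have D': "Fn (Fn \<delta> \<rho>) (Fn \<delta> \<tau>) \<in> D" "Fn \<delta> (Fn \<rho> \<tau>) \<in> D" "Fn \<delta> \<tau> \<in> D" "Fn \<delta> \<rho> \<in> D" "Fn \<rho> \<tau> \<in> D"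
    using Fn_typesD by blast+
  have 3: "app U (app U x z) (app U y z) \<in> car U \<tau>"
    if "x \<in> car U (Fn \<delta> (Fn \<rho> \<tau>))" "y \<in> car U (Fn \<delta> \<rho>)" "z \<in> car U \<delta>" for x y z
    using that D' by (auto intro: app_in)
  have 2: "fun_code U \<delta> \<tau> (\<lambda>z. app U (app U x z) (app U y z)) \<in> car U (Fn \<delta> \<tau>)"
    if "x \<in> car U (Fn \<delta> (Fn \<rho> \<tau>))" "y \<in> car U (Fn \<delta> \<rho>)" for x y
    using that by (intro fun_code_in D' 3)
  have 1: "fun_code U (Fn \<delta> \<rho>) (Fn \<delta> \<tau>) (\<lambda>y. fun_code U \<delta> \<tau> (\<lambda>z. app U (app U x z) (app U y z)))
      \<in> car U (Fn (Fn \<delta> \<rho>) (Fn \<delta> \<tau>))"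
    if "x \<in> car U (Fn \<delta> (Fn \<rho> \<tau>))" for x
    using that by (intro fun_code_in D' 2)
  show ?thesis
    using assms(2-4) by (simp add: app_fun_code[OF D 1] app_fun_code[OF D'(1) 2] app_fun_code[OF D'(3) 3])
qed

definition good :: "(var \<Rightarrow> 'u) \<Rightarrow> bool" where
  "good e \<longleftrightarrow> (\<forall>v. snd v \<in> D \<longrightarrow> e v \<in> car U (snd v))"

lemma good_in: "good e \<Longrightarrow> \<rho> \<in> D \<Longrightarrow> e (n, \<rho>) \<in> car U \<rho>"
  unfolding good_def by (metis snd_conv)

lemma good_upd [simp]: "good e \<Longrightarrow> a \<in> car U (snd v) \<Longrightarrow> good (e(v := a))"
  by (auto simp: good_def)

lemma ty_of_in: "wt D t \<Longrightarrow> ty_of t \<in> D"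
  by (induction t) (auto dest: Fn_typesD)

lemma val_in: "wt D t \<Longrightarrow> good e \<Longrightarrow> val e t \<in> car U (ty_of t)"
proof (induction t)
  case (App s t)
  then obtain \<tau> where \<tau>: "ty_of s = Fn (ty_of t) \<tau>" by auto
  with App ty_of_in[of s] show ?case by (auto intro: app_in)
qed (auto simp: good_def cst_in)

text \<open>The combinators inserted by \<open>lam\<close> carry the types of the variable and of
  the subterms, and \<open>D\<close> is closed under subtypes. So a closed arithmetical term passes
  its typing on to all terms nested in it.\<close>

lemma wt_lamD:
  assumes "wt UNIV t" "wt D (lam v t)"
  shows "snd v \<in> D \<and> wt D t"
  using assms
proof (induction t)
  case (Var w)
  then show ?case by (auto simp: Let_def split: if_splits dest: Fn_typesD)
next
  case (Cst c)
  then show ?case by (auto dest: Fn_typesD)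
next
  case (App s t)
  then obtain \<tau> where \<tau>: "ty_of s = Fn (ty_of t) \<tau>" by auto
  with App show ?case by (auto split: if_splits dest: Fn_typesD)
qed

text \<open>Beta reduction for bracket abstraction. Typing over \<open>UNIV\<close> fixes the shape
  of the combinators, typing over \<open>D\<close> provides the function spaces in which they are
  applied.\<close>

lemma app_lam:
  assumes "wt UNIV t" "wt D (lam v t)" and e: "good e" and a: "a \<in> car U (snd v)"
  shows "app U (val e (lam v t)) a = val (e(v := a)) t"
  using assms(1,2)
proof (induction t)
  case (Var w)
  show ?case
  proof (cases "v = w")
    case True
    define \<rho> where "\<rho> = snd v"
    have w: "snd w = \<rho>" using True by (simp add: \<rho>_def)
    have D: "cty (Sig \<rho> (Fn \<rho> \<rho>) \<rho>) \<in> D" "cty (Pi \<rho> (Fn \<rho> \<rho>)) \<in> D" "cty (Pi \<rho> \<rho>) \<in> D"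
      using Var True by (auto simp: Let_def \<rho>_def)
    have in_car: "cst_int U sc star tr (Pi \<rho> (Fn \<rho> \<rho>)) \<in> car U (cty (Pi \<rho> (Fn \<rho> \<rho>)))"
      "cst_int U sc star tr (Pi \<rho> \<rho>) \<in> car U (cty (Pi \<rho> \<rho>))"
      by (rule cst_in; use D in simp)+
    then have "app U (cst_int U sc star tr (Pi \<rho> \<rho>)) a \<in> car U (Fn \<rho> \<rho>)"
      using D a by (auto intro: app_in simp: \<rho>_def simp del: cst_int.simps)
    with D in_car a True show ?thesis
      by (simp add: Let_def app_Sig app_Pi w \<rho>_def[symmetric] del: cst_int.simps)
  next
    case False
    with Var have "e w \<in> car U (snd w)" using e by (cases w) (auto simp: good_def)
    with Var False a show ?thesis by (simp add: app_Pi del: cst_int.simps)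
  qed
next
  case (Cst c)
  then have "cst_int U sc star tr c \<in> car U (cty c)" by (intro cst_in) auto
  with Cst a show ?case by (simp add: app_Pi del: cst_int.simps)
next
  case (App s t)
  obtain \<tau> where \<tau>: "ty_of s = Fn (ty_of t) \<tau>" using App.prems by auto
  show ?case
  proof (cases "v \<in> fvt s \<union> fvt t")
    case True
    then have w: "wt D (lam v s)" "wt D (lam v t)" "cty (Sig (snd v) (ty_of t) \<tau>) \<in> D"
      using App.prems \<tau> by auto
    have u: "wt UNIV s" "wt UNIV t" using App.prems by auto
    have "val e (lam v s) \<in> car U (Fn (snd v) (Fn (ty_of t) \<tau>))" "val e (lam v t) \<in> car U (Fn (snd v) (ty_of t))"
      using val_in[OF w(1) e] val_in[OF w(2) e] u \<tau> by simp_all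
    with True \<tau> w u a App.IH show ?thesis
      by (simp add: app_Sig del: cst_int.simps)
  next
    case False
    then have w: "wt D (s \<cdot> t)" "cty (Pi \<tau> (snd v)) \<in> D"
      using App.prems \<tau> by auto
    have "val e (s \<cdot> t) \<in> car U \<tau>" using val_in[OF w(1) e] \<tau> by simp
    then have "app U (app U (cst_int U sc star tr (Pi \<tau> (snd v))) (val e (s \<cdot> t))) a = val e (s \<cdot> t)"
      using w a by (intro app_Pi)
    moreover have "val (e(v := a)) (s \<cdot> t) = val e (s \<cdot> t)"
      by (rule tval_upd_notin) (use False in simp)
    moreover have "val e (lam v (s \<cdot> t)) = app U (cst_int U sc star tr (Pi \<tau> (snd v))) (val e (s \<cdot> t))"
      using False \<tau> by simp
    ultimately show ?thesis by (simp only:)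
  qed
qed

end

section \<open>Values of the arithmetical terms\<close>

text \<open>Primitive recursive search for the greatest \<open>w\<close> satisfying a downward
  closed property: the counter climbs while the next value qualifies and then stays put, so any
  number of steps from \<open>w\<close> on suffices.\<close>

lemma rec_nat_search:
  assumes "\<And>u. P (Suc u) \<Longrightarrow> P u" "P w \<or> w = 0" "\<not> P (Suc w)" "w \<le> n"
  shows "rec_nat 0 (\<lambda>j i. if P (Suc i) then Suc i else i) n = (w::nat)"
proof -
  have below: "P v" if "0 < v" "v \<le> w" for v
    using that(2,1)
  proof (induction rule: inc_induct)
    case base
    with assms(2) show ?case by auto
  next
    case (step v)
    then show ?case using assms(1) by simp
  qed
  \<comment> \<open>The invariant of the loop.\<close>
  have "rec_nat 0 (\<lambda>j i. if P (Suc i) then Suc i else i) n = min n w"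
  proof (induction n)
    case (Suc n)
    show ?case
    proof (cases "n < w")
      case True
      then have "P (Suc n)" by (intro below) auto
      with Suc True show ?thesis by simp
    next
      case False
      with Suc assms(3) show ?thesis by simp
    qed
  qed simp
  with assms(4) show ?thesis by simp
qed

lemma le_triangle: "n \<le> triangle n"
  by (induction n) auto

text \<open>The sum of the two components is the greatest \<open>i\<close> with
  \<open>triangle i \<le> c\<close>.\<close>

lemma rec_nat_diag:
  "rec_nat 0 (\<lambda>j i. if triangle (Suc i) - c = 0 then Suc i else i) c
    = fst (prod_decode c) + snd (prod_decode c)"
proof -
  obtain m n where mn: "prod_decode c = (m, n)" by fastforce
  then have c: "c = triangle (m + n) + m"
    using prod_decode_inverse[of c] by (simp add: prod_encode_def)
  have "rec_nat 0 (\<lambda>j i. if triangle (Suc i) - c = 0 then Suc i else i) c = m + n"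
  proof (rule rec_nat_search)
    show "triangle (m + n) - c = 0 \<or> m + n = 0" by (simp add: c)
    show "triangle (Suc (m + n)) - c \<noteq> 0" by (simp add: c)
    show "m + n \<le> c" using le_triangle[of "m + n"] by (simp add: c)
  qed simp
  with mn show ?thesis by simp
qed

lemma prod_decode_triangle: "triangle (fst (prod_decode c) + snd (prod_decode c)) + fst (prod_decode c) = c"
  using prod_decode_inverse[of c] by (simp add: prod_encode_def split: prod.splits)

lemma rec_nat_div:
  assumes "d > 0"
  shows "rec_nat 0 (\<lambda>j i. if Suc i * d - n = 0 then Suc i else i) n = n div d"
proof (rule rec_nat_search)
  show "n div d * d - n = 0 \<or> n div d = 0" by simp
  show "Suc (n div d) * d - n \<noteq> 0"
    using dividend_less_div_times[OF assms, of n] by simp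
qed auto

lemma rec_nat_int_sqrt:
  "rec_nat 0 (\<lambda>j i. if Suc i * Suc i - n = 0 then Suc i else i) n = int_sqrt n"
proof (rule rec_nat_search)
  show "int_sqrt n * int_sqrt n - n = 0 \<or> int_sqrt n = 0"
    using int_sqrt_bounds(1)[of n] by simp
  show "Suc (int_sqrt n) * Suc (int_sqrt n) - n \<noteq> 0"
    using int_sqrt_bounds(2)[of n] by (simp only: diff_is_0_eq not_le)
  show "int_sqrt n \<le> n"
    using int_sqrt_bounds(1)[of n] by (cases "int_sqrt n") auto
qed auto

text \<open>The accumulator keeps pace with the counter until the first failure. Afterwards it lags
  behind, so the test \<open>i = j\<close> never succeeds again and the failing place is
  kept.\<close>

lemma rec_nat_hat:
  fixes f :: "nat \<Rightarrow> nat"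
  defines "B \<equiv> \<lambda>k. \<bar>rat_of_code (f k) - rat_of_code (f (k + 1))\<bar> \<ge> 1 / 2 ^ (k + 1)"
  shows "f (rec_nat 0 (\<lambda>j i. if i = j \<and> \<not> B j then Suc j else i) n) = hat_fun f n"
proof -
  have "rec_nat 0 (\<lambda>j i. if i = j \<and> \<not> B j then Suc j else i) n = (if \<exists>k<n. B k then LEAST k. B k else n)"
  proof (induction n)
    case (Suc n)
    consider "\<exists>k<n. B k" | "\<not> (\<exists>k<n. B k)" "B n" | "\<not> (\<exists>k<n. B k)" "\<not> B n" by blast
    then show ?case
    proof cases
      case 1
      then obtain k where k: "k < n" "B k" by blast
      then have "(LEAST k. B k) < n" using Least_le[of B k] by linarith
      moreover have "\<exists>k<Suc n. B k" using k less_SucI by blast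
      ultimately show ?thesis using Suc 1 by simp
    next
      case 2
      then have "(LEAST k. B k) = n"
        by (intro Least_equality) (auto simp: not_less[symmetric])
      with 2 Suc show ?thesis by auto
    next
      case 3
      then have "\<not> (\<exists>k<Suc n. B k)" by (auto simp: less_Suc_eq)
      then have "(if \<exists>k<Suc n. B k then LEAST k. B k else Suc n) = Suc n" by (rule if_not_P)
      moreover have "(if \<exists>k<n. B k then LEAST k. B k else n) = n" using 3(1) by (rule if_not_P)
      ultimately show ?thesis using 3(2) Suc.IH by (simp only: nat.rec) simp
    qed
  qed simp
  moreover have "hat_fun f n = (if \<exists>k<n. B k then f (LEAST k. B k) else f n)"
    unfolding B_def by (rule hat_fun_alt)
  ultimately show ?thesis by (simp only: if_distrib[of f])
qed

declare cst_int.simps [simp del] vn_int.simps [simp del] maj_int.simps [simp del] lam.simps [simp del]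

context full_universe_model begin

text \<open>\<open>lam_ok\<close> and \<open>rec_ok\<close> repeat well-typedness in an opaque form, so that \<open>wt_lam_iff\<close> and
  \<open>wt_recN_iff\<close> are terminating rewrite rules.\<close>

definition lam_ok :: "var \<Rightarrow> trm \<Rightarrow> bool" where
  "lam_ok v t \<longleftrightarrow> wt D (lam v t)"

lemma wt_lam_iff [simp]:
  "wt UNIV t \<Longrightarrow> wt D (lam v t) \<longleftrightarrow> lam_ok v t \<and> snd v \<in> D \<and> wt D t"
  using wt_lamD[of t v] by (auto simp: lam_ok_def)

lemma app_lam_ok [simp]:
  "wt UNIV t \<Longrightarrow> lam_ok v t \<Longrightarrow> good e \<Longrightarrow> a \<in> car U (snd v) \<Longrightarrow>
    app U (val e (lam v t)) a = val (e(v := a)) t"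
  unfolding lam_ok_def by (rule app_lam)

lemma app_Succ [simp]: "Fn Nt Nt \<in> D \<Longrightarrow> app U (cst_int U sc star tr Succ) (num U n) = num U (Suc n)"
  by (simp add: cst_int.simps app_fun_code)

lemma val_zero [simp]: "cst_int U sc star tr Zero = num U 0"
  by (simp add: cst_int.simps)

text \<open>The recursor hands the accumulator to its step before the counter,
  \<open>rec_nat\<close> the other way round; hence the swapped arguments of
  \<open>F\<close>.\<close>

lemma app_Rec_Nt:
  assumes D: "cty (Rec [Nt] 0) \<in> D" and z: "z \<in> car U (Fn Nt (Fn Nt Nt))"
    and F: "\<And>i j. app U (app U z (num U i)) (num U j) = num U (F i j)"
  shows "app U (app U (app U (cst_int U sc star tr (Rec [Nt] 0)) (num U n)) (num U a)) z
    = num U (rec_nat a (\<lambda>j i. F i j) n)"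
proof -
  have "rec_val U [num U a] [z] n = [num U (rec_nat a (\<lambda>j i. F i j) n)]"
    by (induction n) (simp_all add: F)
  with foldl_Rec[of 0 "[Nt]" "[num U a]" "[z]" n] D z show ?thesis by simp
qed

lemma recN_typing [simp]:
  assumes "wt UNIV b" "ty_of b = Nt"
  shows "wt UNIV (recN n a u k b) \<longleftrightarrow> wt UNIV n \<and> ty_of n = Nt \<and> wt UNIV a \<and> ty_of a = Nt"
    and "ty_of (recN n a u k b) = Nt"
  using assms by (auto simp: recN_def)

lemma fvt_recN [simp]: "fvt (recN n a u k b) = fvt n \<union> fvt a \<union> (fvt b - {(k, Nt)} - {(u, Nt)})"
  by (auto simp: recN_def)

definition rec_ok :: "nat \<Rightarrow> nat \<Rightarrow> trm \<Rightarrow> bool" where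
  "rec_ok u k b \<longleftrightarrow> cty (Rec [Nt] 0) \<in> D \<and> wt D (lamN u (lamN k b))"

lemma wt_recN_iff [simp]:
  assumes "wt UNIV b" "ty_of b = Nt"
  shows "wt D (recN n a u k b) \<longleftrightarrow>
    rec_ok u k b \<and> wt D n \<and> ty_of n = Nt \<and> wt D a \<and> ty_of a = Nt \<and> wt D b"
  using assms by (auto simp: recN_def rec_ok_def)

lemma val_recN:
  assumes "wt UNIV b" "ty_of b = Nt" "rec_ok u k b" "good e" "u \<noteq> k"
    and n: "val e n = num U N" and a: "val e a = num U A"
    and b: "\<And>i j. val (e((u, Nt) := num U i, (k, Nt) := num U j)) b = num U (F i j)"
    and r: "rec_nat A (\<lambda>j i. F i j) N = r"
  shows "val e (recN n a u k b) = num U r"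
proof -
  have ok: "wt D (lamN u (lamN k b))" and D: "cty (Rec [Nt] 0) \<in> D"
    using assms(3) by (auto simp: rec_ok_def)
  have z: "val e (lamN u (lamN k b)) \<in> car U (Fn Nt (Fn Nt Nt))"
    using val_in[OF ok \<open>good e\<close>] assms(1,2) by simp
  have "app U (app U (val e (lamN u (lamN k b))) (num U i)) (num U j) = num U (F i j)" for i j
    using ok assms(1,2,4) b[of i j] by simp
  from app_Rec_Nt[OF D z this] show ?thesis
    by (simp only: recN_def tval.simps assoc_model_simps n a r)
qed

section \<open>Closed terms for arithmetic on natural numbers\<close>

lemma c_pred_typing [simp]: "wt UNIV c_pred" "ty_of c_pred = T1" "fvt c_pred = {}"
  by (auto simp: c_pred_def)

lemma val_pred [simp]:
  assumes "wt D c_pred" "good e"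
  shows "app U (val e c_pred) (num U n) = num U (n - 1)"
  \<comment> \<open>The step ignores the accumulator and returns the counter, whose last value is
    \<open>n - 1\<close>.\<close>
  using assms unfolding c_pred_def
  by simp (rule val_recN[where N = n and A = 0 and F = "\<lambda>i j. j"]; cases n; simp)

lemma c_monus_typing [simp]: "wt UNIV c_monus" "ty_of c_monus = Fn Nt T1" "fvt c_monus = {}"
  by (auto simp: c_monus_def)

lemma val_monus [simp]:
  assumes "wt D c_monus" "good e"
  shows "app U (app U (val e c_monus) (num U m)) (num U n) = num U (m - n)"
proof -
  have r: "rec_nat m (\<lambda>j i. i - 1) n = m - n" by (induction n) auto
  show ?thesis
    using assms unfolding c_monus_def by simp (rule val_recN[OF _ _ _ _ _ _ _ _ r]; simp)
qed

lemma c_add_typing [simp]: "wt UNIV c_add" "ty_of c_add = Fn Nt T1" "fvt c_add = {}"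
  by (auto simp: c_add_def)

lemma val_add [simp]:
  assumes "wt D c_add" "good e"
  shows "app U (app U (val e c_add) (num U m)) (num U n) = num U (m + n)"
proof -
  have r: "rec_nat m (\<lambda>j i. Suc i) n = m + n" by (induction n) auto
  show ?thesis
    using assms unfolding c_add_def by simp (rule val_recN[OF _ _ _ _ _ _ _ _ r]; simp)
qed

lemma c_mul_typing [simp]: "wt UNIV c_mul" "ty_of c_mul = Fn Nt T1" "fvt c_mul = {}"
  by (auto simp: c_mul_def)

lemma val_mul [simp]:
  assumes "wt D c_mul" "good e"
  shows "app U (app U (val e c_mul) (num U m)) (num U n) = num U (m * n)"
proof -
  have r: "rec_nat 0 (\<lambda>j i. i + m) n = m * n" by (induction n) auto
  show ?thesis
    using assms unfolding c_mul_def by simp (rule val_recN[OF _ _ _ _ _ _ _ _ r]; simp)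
qed

lemma c_ifz_typing [simp]: "wt UNIV c_ifz" "ty_of c_ifz = Fn Nt (Fn Nt T1)" "fvt c_ifz = {}"
  by (auto simp: c_ifz_def)

lemma val_ifz [simp]:
  assumes "wt D c_ifz" "good e"
  shows "app U (app U (app U (val e c_ifz) (num U c)) (num U a)) (num U b) = num U (if c = 0 then a else b)"
proof -
  have r: "rec_nat a (\<lambda>j i. b) c = (if c = 0 then a else b)" by (cases c) auto
  show ?thesis
    using assms unfolding c_ifz_def by (simp split del: if_split) (rule val_recN[OF _ _ _ _ _ _ _ _ r]; simp)
qed

lemma c_parity_typing [simp]: "wt UNIV c_parity" "ty_of c_parity = T1" "fvt c_parity = {}"
  by (auto simp: c_parity_def)

lemma val_parity [simp]:
  assumes "wt D c_parity" "good e"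
  shows "app U (val e c_parity) (num U n) = num U (n mod 2)"
proof -
  have r: "rec_nat 0 (\<lambda>j i. Suc 0 - i) n = n mod 2" by (induction n) (auto simp: mod_Suc)
  show ?thesis
    using assms unfolding c_parity_def by simp (rule val_recN[OF _ _ _ _ _ _ _ _ r]; simp)
qed

lemma c_half_typing [simp]: "wt UNIV c_half" "ty_of c_half = T1" "fvt c_half = {}"
  by (auto simp: c_half_def)

lemma val_half [simp]:
  assumes "wt D c_half" "good e"
  shows "app U (val e c_half) (num U n) = num U (n div 2)"
proof -
  have r: "rec_nat 0 (\<lambda>j i. i + j mod 2) n = n div 2"
  proof (induction n)
    case (Suc n)
    then show ?case by simp presburger
  qed simp
  show ?thesis
    using assms unfolding c_half_def by simp (rule val_recN[OF _ _ _ _ _ _ _ _ r]; simp)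
qed

lemma c_pow2_typing [simp]: "wt UNIV c_pow2" "ty_of c_pow2 = T1" "fvt c_pow2 = {}"
  by (auto simp: c_pow2_def)

lemma val_pow2 [simp]:
  assumes "wt D c_pow2" "good e"
  shows "app U (val e c_pow2) (num U n) = num U (2 ^ n)"
proof -
  have r: "rec_nat (Suc 0) (\<lambda>j i. i + i) n = 2 ^ n" by (induction n) auto
  show ?thesis
    using assms unfolding c_pow2_def by simp (rule val_recN[OF _ _ _ _ _ _ _ _ r]; simp)
qed

lemma c_div_typing [simp]: "wt UNIV c_div" "ty_of c_div = Fn Nt T1" "fvt c_div = {}"
  by (auto simp: c_div_def)

lemma val_div [simp]:
  assumes "wt D c_div" "good e" "d > 0"
  shows "app U (app U (val e c_div) (num U n)) (num U d) = num U (n div d)"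
  using assms(1,2) unfolding c_div_def
  by simp (rule val_recN[OF _ _ _ _ _ _ _ _ rec_nat_div[OF assms(3)]]; simp)

lemma c_isqrt_typing [simp]: "wt UNIV c_isqrt" "ty_of c_isqrt = T1" "fvt c_isqrt = {}"
  by (auto simp: c_isqrt_def)

lemma val_isqrt [simp]:
  assumes "wt D c_isqrt" "good e"
  shows "app U (val e c_isqrt) (num U n) = num U (int_sqrt n)"
  using assms unfolding c_isqrt_def
  by simp (rule val_recN[OF _ _ _ _ _ _ _ _ rec_nat_int_sqrt]; simp)

section \<open>Closed terms for the Cantor pairing\<close>

lemma c_tri_typing [simp]: "wt UNIV c_tri" "ty_of c_tri = T1" "fvt c_tri = {}"
  by (auto simp: c_tri_def)

lemma val_tri [simp]:
  assumes "wt D c_tri" "good e"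
  shows "app U (val e c_tri) (num U n) = num U (triangle n)"
proof -
  have r: "rec_nat 0 (\<lambda>j i. i + Suc j) n = triangle n" by (induction n) auto
  show ?thesis
    using assms unfolding c_tri_def by simp (rule val_recN[OF _ _ _ _ _ _ _ _ r]; simp)
qed

lemma c_j_typing [simp]: "wt UNIV c_j" "ty_of c_j = Fn Nt T1" "fvt c_j = {}"
  by (auto simp: c_j_def)

lemma val_j [simp]:
  assumes "wt D c_j" "good e"
  shows "app U (app U (val e c_j) (num U m)) (num U n) = num U (prod_encode (m, n))"
  using assms unfolding c_j_def by (simp add: prod_encode_def)

lemma c_diag_typing [simp]: "wt UNIV c_diag" "ty_of c_diag = T1" "fvt c_diag = {}"
  by (auto simp: c_diag_def)

lemma val_diag [simp]:
  assumes "wt D c_diag" "good e"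
  shows "app U (val e c_diag) (num U c) = num U (fst (prod_decode c) + snd (prod_decode c))"
  using assms unfolding c_diag_def
  by simp (rule val_recN[OF _ _ _ _ _ _ _ _ rec_nat_diag]; simp)

lemma c_j1_typing [simp]: "wt UNIV c_j1" "ty_of c_j1 = T1" "fvt c_j1 = {}"
  by (auto simp: c_j1_def)

lemma val_j1 [simp]:
  assumes "wt D c_j1" "good e"
  shows "app U (val e c_j1) (num U c) = num U (fst (prod_decode c))"
proof -
  have "c - triangle (fst (prod_decode c) + snd (prod_decode c)) = fst (prod_decode c)"
    using prod_decode_triangle[of c] by linarith
  then show ?thesis using assms unfolding c_j1_def by simp
qed

lemma c_j2_typing [simp]: "wt UNIV c_j2" "ty_of c_j2 = T1" "fvt c_j2 = {}"
  by (auto simp: c_j2_def)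

lemma val_j2 [simp]:
  assumes "wt D c_j2" "good e"
  shows "app U (val e c_j2) (num U c) = num U (snd (prod_decode c))"
  using assms unfolding c_j2_def by simp

section \<open>Closed terms on codes of rationals\<close>

lemma c_qpos_typing [simp]: "wt UNIV c_qpos" "ty_of c_qpos = T1" "fvt c_qpos = {}"
  by (auto simp: c_qpos_def)

lemma val_qpos [simp]:
  assumes "wt D c_qpos" "good e"
  shows "app U (val e c_qpos) (num U c) = num U (code_pos c)"
  using assms unfolding c_qpos_def by (simp add: code_pos_def Let_def even_iff_mod_2_eq_zero)

lemma c_qneg_typing [simp]: "wt UNIV c_qneg" "ty_of c_qneg = T1" "fvt c_qneg = {}"
  by (auto simp: c_qneg_def)

lemma val_qneg [simp]:
  assumes "wt D c_qneg" "good e"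
  shows "app U (val e c_qneg) (num U c) = num U (code_neg c)"
  using assms unfolding c_qneg_def by (simp add: code_neg_def Let_def even_iff_mod_2_eq_zero)

lemma c_qden_typing [simp]: "wt UNIV c_qden" "ty_of c_qden = T1" "fvt c_qden = {}"
  by (auto simp: c_qden_def)

lemma val_qden [simp]:
  assumes "wt D c_qden" "good e"
  shows "app U (val e c_qden) (num U c) = num U (code_den c)"
  using assms unfolding c_qden_def by (simp add: code_den_def)

lemma c_mkq_typing [simp]: "wt UNIV c_mkq" "ty_of c_mkq = Fn Nt (Fn Nt T1)" "fvt c_mkq = {}"
  by (auto simp: c_mkq_def)

lemma val_mkq [simp]:
  assumes "wt D c_mkq" "good e"
  shows "app U (app U (app U (val e c_mkq) (num U a)) (num U b)) (num U d) = num U (mk_code a b d)"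
  using assms unfolding c_mkq_def by (simp add: mk_code_def)

lemma c_addq_typing [simp]: "wt UNIV c_addq" "ty_of c_addq = Fn Nt T1" "fvt c_addq = {}"
  by (auto simp: c_addq_def)

lemma val_addq [simp]:
  assumes "wt D c_addq" "good e"
  shows "app U (app U (val e c_addq) (num U x)) (num U y) = num U (add_code x y)"
  using assms unfolding c_addq_def by (simp add: add_code_def)

lemma c_minusq_typing [simp]: "wt UNIV c_minusq" "ty_of c_minusq = T1" "fvt c_minusq = {}"
  by (auto simp: c_minusq_def)

lemma val_minusq [simp]:
  assumes "wt D c_minusq" "good e"
  shows "app U (val e c_minusq) (num U x) = num U (minus_code x)"
  using assms unfolding c_minusq_def by (simp add: minus_code_def)

lemma c_mulq_typing [simp]: "wt UNIV c_mulq" "ty_of c_mulq = Fn Nt T1" "fvt c_mulq = {}"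
  by (auto simp: c_mulq_def)

lemma val_mulq [simp]:
  assumes "wt D c_mulq" "good e"
  shows "app U (app U (val e c_mulq) (num U x)) (num U y) = num U (mult_code x y)"
  using assms unfolding c_mulq_def by (simp add: mult_code_def)

lemma c_absq_typing [simp]: "wt UNIV c_absq" "ty_of c_absq = T1" "fvt c_absq = {}"
  by (auto simp: c_absq_def)

lemma val_absq [simp]:
  assumes "wt D c_absq" "good e"
  shows "app U (val e c_absq) (num U x) = num U (abs_code x)"
  using assms unfolding c_absq_def by (simp add: abs_code_def)

lemma c_lessq_typing [simp]: "wt UNIV c_lessq" "ty_of c_lessq = Fn Nt T1" "fvt c_lessq = {}"
  by (auto simp: c_lessq_def)

lemma val_lessq [simp]:
  assumes "wt D c_lessq" "good e"
  shows "app U (app U (val e c_lessq) (num U x)) (num U y) = num U (less_code x y)"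
  using assms unfolding c_lessq_def by (simp add: less_code_def)

lemma c_maxq_typing [simp]: "wt UNIV c_maxq" "ty_of c_maxq = Fn Nt T1" "fvt c_maxq = {}"
  by (auto simp: c_maxq_def)

lemma val_maxq [simp]:
  assumes "wt D c_maxq" "good e"
  shows "app U (app U (val e c_maxq) (num U x)) (num U y) = num U (max_code x y)"
  using assms unfolding c_maxq_def by (simp add: max_code_def)

lemma c_recipq_typing [simp]: "wt UNIV c_recipq" "ty_of c_recipq = T1" "fvt c_recipq = {}"
  by (auto simp: c_recipq_def)

lemma val_recipq [simp]:
  assumes "wt D c_recipq" "good e"
  shows "app U (val e c_recipq) (num U x) = num U (recip_code x)"
  using assms unfolding c_recipq_def by (simp add: recip_code_def)

lemma c_epsq_typing [simp]: "wt UNIV c_epsq" "ty_of c_epsq = T1" "fvt c_epsq = {}"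
  by (auto simp: c_epsq_def)

lemma val_epsq [simp]:
  assumes "wt D c_epsq" "good e"
  shows "app U (val e c_epsq) (num U x) = num U (eps_code x)"
  using assms unfolding c_epsq_def by (simp add: eps_code_def)

lemma num_trm_typing [simp]: "wt UNIV (num_trm n)" "ty_of (num_trm n) = Nt" "fvt (num_trm n) = {}"
  by (induction n) auto

lemma val_num_trm [simp]: "wt D (num_trm n) \<Longrightarrow> val e (num_trm n) = num U n"
  by (induction n) auto

declare app_decode1 [simp]

lemma c_hat_typing [simp]: "wt UNIV c_hat" "ty_of c_hat = Fn T1 T1" "fvt c_hat = {}"
  by (auto simp: c_hat_def)

lemma val_hat [simp]:
  assumes "wt D c_hat" "good e" "f \<in> car U T1"
  shows "app U (app U (val e c_hat) f) (num U n) = num U (hat_fun (decode1 U f) n)"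
proof -
  let ?f = "decode1 U f"
  \<comment> \<open>A sum is 0 iff all its terms are: the two truncated differences test
    \<open>i = j\<close>, and the comparison term is 0 iff the convergence condition holds at
    \<open>j\<close>.\<close>
  have cond: "(i - j) + (j - i) + less_code (abs_code (add_code (?f j) (minus_code (?f (Suc j))))) (eps_code (Suc j)) = 0
      \<longleftrightarrow> i = j \<and> \<not> \<bar>rat_of_code (?f j) - rat_of_code (?f (j + 1))\<bar> \<ge> 1 / 2 ^ (j + 1)" for i j
    by (auto simp: less_code_eq_0_iff rat_of_abs_code rat_of_add_code rat_of_minus_code rat_of_eps_code
        simp del: power_Suc)
  have T1: "T1 \<in> D" using ty_of_in[OF assms(1)] by (simp add: Fn_type_dom[of T1 T1])
  let ?r = "rec_nat 0 (\<lambda>j i. if (i - j) + (j - i) +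
      less_code (abs_code (add_code (?f j) (minus_code (?f (Suc j))))) (eps_code (Suc j)) = 0 then Suc j else i) n"
  have "app U (app U (val e c_hat) f) (num U n) = num U (?f ?r)"
    using assms unfolding c_hat_def
    by simp (subst val_recN[OF _ _ _ _ _ _ _ _ refl]; simp)
  also have "?f ?r = hat_fun ?f n"
    unfolding cond by (rule rec_nat_hat)
  finally show ?thesis .
qed

end

section \<open>Values of real and algebraic terms\<close>

context full_universe_model begin

lemma decode1_eqI: "(\<And>n. app U F (num U n) = num U (h n)) \<Longrightarrow> decode1 U F = h"
  by (rule ext) (simp add: decode1_def)

lemma c_natr_typing [simp]: "wt UNIV c_natr" "ty_of c_natr = Fn Nt T1" "fvt c_natr = {}"
  by (auto simp: c_natr_def)

lemma c_addr_typing [simp]: "wt UNIV c_addr" "ty_of c_addr = Fn T1 (Fn T1 T1)" "fvt c_addr = {}"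
  by (auto simp: c_addr_def)

lemma c_minusr_typing [simp]: "wt UNIV c_minusr" "ty_of c_minusr = Fn T1 T1" "fvt c_minusr = {}"
  by (auto simp: c_minusr_def)

lemma c_absr_typing [simp]: "wt UNIV c_absr" "ty_of c_absr = Fn T1 T1" "fvt c_absr = {}"
  by (auto simp: c_absr_def)

lemma c_maxr_typing [simp]: "wt UNIV c_maxr" "ty_of c_maxr = Fn T1 (Fn T1 T1)" "fvt c_maxr = {}"
  by (auto simp: c_maxr_def)

lemma c_mulr_typing [simp]: "wt UNIV c_mulr" "ty_of c_mulr = Fn T1 (Fn T1 T1)" "fvt c_mulr = {}"
  by (auto simp: c_mulr_def)

lemma c_recipr_typing [simp]: "wt UNIV c_recipr" "ty_of c_recipr = Fn T1 T1" "fvt c_recipr = {}"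
  by (auto simp: c_recipr_def)

lemma c_sqrtr_typing [simp]: "wt UNIV c_sqrtr" "ty_of c_sqrtr = Fn T1 T1" "fvt c_sqrtr = {}"
  by (auto simp: c_sqrtr_def)

lemma ratr_typing [simp]: "wt UNIV (ratr r)" "ty_of (ratr r) = T1" "fvt (ratr r) = {}"
  by (auto simp: ratr_def split: prod.splits)

lemma decode_natr:
  assumes "wt D c_natr" "good e"
  shows "decode1 U (app U (val e c_natr) (num U m)) = (\<lambda>_. prod_encode (m + m, 0))"
  by (rule decode1_eqI) (use assms in \<open>simp add: c_natr_def\<close>)

lemma decode_addr:
  assumes "wt D c_addr" "good e" "f \<in> car U T1" "g \<in> car U T1"
  shows "decode1 U (app U (app U (val e c_addr) f) g) = add_real (decode1 U f) (decode1 U g)"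
  by (rule decode1_eqI) (use assms in \<open>simp add: c_addr_def add_real_def\<close>)

lemma decode_minusr:
  assumes "wt D c_minusr" "good e" "f \<in> car U T1"
  shows "decode1 U (app U (val e c_minusr) f) = minus_real (decode1 U f)"
  by (rule decode1_eqI) (use assms in \<open>simp add: c_minusr_def minus_real_def\<close>)

lemma decode_absr:
  assumes "wt D c_absr" "good e" "f \<in> car U T1"
  shows "decode1 U (app U (val e c_absr) f) = abs_real (decode1 U f)"
  by (rule decode1_eqI) (use assms in \<open>simp add: c_absr_def abs_real_def\<close>)

lemma decode_maxr:
  assumes "wt D c_maxr" "good e" "f \<in> car U T1" "g \<in> car U T1"
  shows "decode1 U (app U (app U (val e c_maxr) f) g) = max_real (decode1 U f) (decode1 U g)"
  by (rule decode1_eqI) (use assms in \<open>simp add: c_maxr_def max_real_def\<close>)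

lemma decode_mulr:
  assumes "wt D c_mulr" "good e" "f \<in> car U T1" "g \<in> car U T1"
  shows "decode1 U (app U (app U (val e c_mulr) f) g) = mult_real (decode1 U f) (decode1 U g)"
  by (rule decode1_eqI) (use assms in \<open>simp add: c_mulr_def mult_real_def\<close>)

lemma decode_recipr:
  assumes "wt D c_recipr" "good e" "f \<in> car U T1"
  shows "decode1 U (app U (val e c_recipr) f) = recip_real (decode1 U f)"
  by (rule decode1_eqI) (use assms in \<open>simp add: c_recipr_def recip_real_def\<close>)

lemma decode_sqrtr:
  assumes "wt D c_sqrtr" "good e" "f \<in> car U T1"
  shows "decode1 U (app U (val e c_sqrtr) f) = sqrt_real (decode1 U f)"
  by (rule decode1_eqI) (use assms in \<open>simp add: c_sqrtr_def sqrt_real_def Let_def\<close>)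

text \<open>Values of terms of type 0, 1 and X are pulled back to naturals, reals and the algebra.
  On this level every term former is a homomorphism, so an axiom simplifies to a statement free of
  codes.\<close>

definition nat_val :: "(var \<Rightarrow> 'u) \<Rightarrow> trm \<Rightarrow> nat" where
  "nat_val e t = the_num U (val e t)"

definition real_val :: "(var \<Rightarrow> 'u) \<Rightarrow> trm \<Rightarrow> real" where
  "real_val e t = real_of_code (decode1 U (val e t))"

definition alg_val :: "(var \<Rightarrow> 'u) \<Rightarrow> trm \<Rightarrow> 'a" where
  "alg_val e t = the_elt U (val e t)"

lemma val_Nt: "wt D t \<Longrightarrow> ty_of t = Nt \<Longrightarrow> good e \<Longrightarrow> val e t = num U (nat_val e t)"
  using val_in[of t e] by (simp add: nat_val_def)

lemma val_T1: "wt D t \<Longrightarrow> ty_of t = T1 \<Longrightarrow> good e \<Longrightarrow> val e t \<in> car U T1"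
  using val_in[of t e] by simp

lemma wt_App1D:
  assumes "wt D (c \<cdot> s)" "ty_of c = Fn a r"
  shows "wt D c" "wt D s" "ty_of s = a"
  using assms by auto

lemma wt_App2D:
  assumes "wt D (c \<cdot> s \<cdot> t)" "ty_of c = Fn a (Fn b r)"
  shows "wt D c" "wt D s" "wt D t" "ty_of s = a" "ty_of t = b"
  using assms by auto

lemma nat_val_zero [simp]: "nat_val e zero = 0"
  by (simp add: nat_val_def)

lemma nat_val_suc [simp]:
  assumes "wt D (suc t)" "good e" shows "nat_val e (suc t) = Suc (nat_val e t)"
proof -
  have t: "wt D t" "ty_of t = Nt" "T1 \<in> D" using assms(1) by auto
  show ?thesis
    unfolding nat_val_def[of e "suc t"] using val_Nt[OF t(1,2) assms(2)] t(3) by simp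
qed

lemma real_val_natr [simp]:
  assumes "wt D (natr t)" "good e" shows "real_val e (natr t) = real (nat_val e t)"
proof -
  note t = wt_App1D[OF assms(1) c_natr_typing(2)]
  have "real_of_code (\<lambda>_. prod_encode (m + m, 0)) = real m" for m
    by (rule real_of_code_eqI) (simp_all add: rat_of_code_def)
  with decode_natr[OF t(1) assms(2)] val_Nt[OF t(2,3) assms(2)] show ?thesis
    by (simp add: real_val_def)
qed

lemma real_val_ratr [simp]:
  assumes "wt D (ratr r)" "good e" shows "real_val e (ratr r) = of_rat r"
proof -
  obtain a b where q: "quotient_of r = (a, b)" by fastforce
  then have b: "b > 0" by (rule quotient_of_denom_pos)
  have "decode1 U (val e (ratr r)) = (\<lambda>_. mk_code (nat a) (nat (- a)) (nat b))"
    by (rule decode1_eqI) (use assms q in \<open>simp add: ratr_def\<close>)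
  moreover have "real_of_code (\<lambda>_. mk_code (nat a) (nat (- a)) (nat b)) = of_rat r"
  proof (rule real_of_code_eqI)
    have "real (nat a) - real (nat (- a)) = of_int a" by (cases "a \<ge> 0") auto
    moreover have "of_rat r = (of_int a / of_int b :: real)"
      using quotient_of_div[OF q] by (simp add: of_rat_divide)
    ultimately show "(\<lambda>n. rat_of_code (mk_code (nat a) (nat (- a)) (nat b))) \<longlonglongrightarrow> of_rat r"
      using b by (simp add: rat_of_mk_code)
  qed simp
  ultimately show ?thesis by (simp add: real_val_def)
qed

lemma real_val_addr [simp]:
  assumes "wt D (s +\<^sub>r t)" "good e" shows "real_val e (s +\<^sub>r t) = real_val e s + real_val e t"
proof -
  note t = wt_App2D[OF assms(1) c_addr_typing(2)]
  from decode_addr[OF t(1) assms(2) val_T1 val_T1] t assms(2) show ?thesis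
    by (simp add: real_val_def real_of_add_real)
qed

lemma real_val_minusr [simp]:
  assumes "wt D (minusr s)" "good e" shows "real_val e (minusr s) = - real_val e s"
proof -
  note t = wt_App1D[OF assms(1) c_minusr_typing(2)]
  from decode_minusr[OF t(1) assms(2) val_T1] t assms(2) show ?thesis
    by (simp add: real_val_def real_of_minus_real)
qed

lemma real_val_absr [simp]:
  assumes "wt D (absr s)" "good e" shows "real_val e (absr s) = \<bar>real_val e s\<bar>"
proof -
  note t = wt_App1D[OF assms(1) c_absr_typing(2)]
  from decode_absr[OF t(1) assms(2) val_T1] t assms(2) show ?thesis
    by (simp add: real_val_def real_of_abs_real)
qed

lemma real_val_maxr [simp]:
  assumes "wt D (maxr s t)" "good e" shows "real_val e (maxr s t) = max (real_val e s) (real_val e t)"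
proof -
  note t = wt_App2D[OF assms(1) c_maxr_typing(2)]
  from decode_maxr[OF t(1) assms(2) val_T1 val_T1] t assms(2) show ?thesis
    by (simp add: real_val_def real_of_max_real)
qed

lemma real_val_mulr [simp]:
  assumes "wt D (s *\<^sub>r t)" "good e" shows "real_val e (s *\<^sub>r t) = real_val e s * real_val e t"
proof -
  note t = wt_App2D[OF assms(1) c_mulr_typing(2)]
  from decode_mulr[OF t(1) assms(2) val_T1 val_T1] t assms(2) show ?thesis
    by (simp add: real_val_def real_of_mult_real)
qed

lemma real_val_recipr [simp]:
  assumes "wt D (recipr s)" "good e" shows "real_val e (recipr s) = 1 / max (real_val e s) 1"
proof -
  note t = wt_App1D[OF assms(1) c_recipr_typing(2)]
  from decode_recipr[OF t(1) assms(2) val_T1] t assms(2) show ?thesis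
    by (simp add: real_val_def real_of_recip_real)
qed

lemma real_val_sqrtr:
  assumes "wt D (sqrtr s)" "good e" shows "real_val e (sqrtr s) = sqrt (max (real_val e s) 0)"
proof -
  note t = wt_App1D[OF assms(1) c_sqrtr_typing(2)]
  from decode_sqrtr[OF t(1) assms(2) val_T1] t assms(2) show ?thesis
    by (simp add: real_val_def real_of_sqrt_real)
qed

text \<open>Stated for the unfolded form of \<open>absc\<close>, in which it occurs after
  simplification. A sum of squares is not affected by the truncation at 0 in the square
  root.\<close>

lemma real_val_absc [simp]:
  assumes "wt D (sqrtr (a *\<^sub>r a +\<^sub>r b *\<^sub>r b))" "good e"
  shows "real_val e (sqrtr (a *\<^sub>r a +\<^sub>r b *\<^sub>r b)) = cmod (Complex (real_val e a) (real_val e b))"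
proof -
  note t = wt_App1D[OF assms(1) c_sqrtr_typing(2)]
  note t2 = wt_App2D[OF t(2) c_addr_typing(2)]
  show ?thesis
    unfolding real_val_sqrtr[OF assms] real_val_addr[OF t(2) assms(2)]
      real_val_mulr[OF t2(2) assms(2)] real_val_mulr[OF t2(3) assms(2)]
    by (simp add: complex_norm power2_eq_square)
qed

text \<open>An opaque bundle of the typing facts about the auxiliary terms in \<open>eqr\<close>, so
  that the simplifier does not decompose them; they are opened again in \<open>sat_eqr\<close>.
  \<open>ler_ok\<close> does the same for \<open>ler\<close>.\<close>

definition eqr_ok :: bool where
  "eqr_ok \<longleftrightarrow> T1 \<in> D \<and> wt D c_absq \<and> wt D c_hat \<and> wt D c_addq \<and> wt D c_minusq \<and> wt D c_lessq \<and> wt D c_epsq"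

definition ler_ok :: bool where
  "ler_ok \<longleftrightarrow> T1 \<in> D \<and> wt D c_hat \<and> wt D c_addq \<and> wt D c_minusq \<and> wt D c_lessq \<and> wt D c_epsq"

lemma wff_eqr_iff [simp]:
  "wff D (s =\<^sub>r t) \<longleftrightarrow> eqr_ok \<and> wt D s \<and> wt D t \<and> ty_of s = T1 \<and> ty_of t = T1"
  by (auto simp: eqr_def Let_def eqr_ok_def)

lemma wff_ler_iff [simp]:
  "wff D (s \<le>\<^sub>r t) \<longleftrightarrow> ler_ok \<and> wt D s \<and> wt D t \<and> ty_of s = T1 \<and> ty_of t = T1"
  by (auto simp: ler_def Let_def ler_ok_def)

lemma sat_eqr [simp]:
  assumes w: "wff D (s =\<^sub>r t)" and e: "good e"
  shows "sat M e (s =\<^sub>r t) \<longleftrightarrow> real_val e s = real_val e t"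
proof -
  define n where "n = fresh [s, t]"
  have fr: "(n, Nt) \<notin> fvt s" "(n, Nt) \<notin> fvt t"
    by (rule fresh_notin_fvt[where ts = "[s, t]"]; simp add: n_def)+
  have st: "val e s \<in> car U T1" "val e t \<in> car U T1"
    using w e by (auto intro: val_T1)
  have ok: eqr_ok using w by simp
  have "sat M (e((n, Nt) := num U k)) (absq (hat s (suc (vN n)) +\<^sub>q minusq (hat t (suc (vN n)))) <\<^sub>q epsq (vN n) \<doteq> zero)
    \<longleftrightarrow> \<bar>rat_of_code (hat_fun (decode1 U (val e s)) (Suc k)) - rat_of_code (hat_fun (decode1 U (val e t)) (Suc k))\<bar>
      < 1 / 2 ^ k" for k
    using ok fr st e
    by (simp add: eqr_ok_def less_code_eq_0_iff rat_of_abs_code rat_of_add_code rat_of_minus_code rat_of_eps_code)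
  moreover have "(\<forall>a\<in>car U Nt. P a) \<longleftrightarrow> (\<forall>k. P (num U k))" for P
    using num_the_num num_in by metis
  ultimately show ?thesis
    unfolding eqr_def Let_def n_def[symmetric] real_val_def real_of_code_eq_iff by simp
qed

lemma sat_ler [simp]:
  assumes w: "wff D (s \<le>\<^sub>r t)" and e: "good e"
  shows "sat M e (s \<le>\<^sub>r t) \<longleftrightarrow> real_val e s \<le> real_val e t"
proof -
  define n where "n = fresh [s, t]"
  have fr: "(n, Nt) \<notin> fvt s" "(n, Nt) \<notin> fvt t"
    by (rule fresh_notin_fvt[where ts = "[s, t]"]; simp add: n_def)+
  have st: "val e s \<in> car U T1" "val e t \<in> car U T1"
    using w e by (auto intro: val_T1)
  have ok: ler_ok using w by simp
  have "sat M (e((n, Nt) := num U k)) (hat s (suc (vN n)) +\<^sub>q minusq (hat t (suc (vN n))) <\<^sub>q epsq (vN n) \<doteq> zero)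
    \<longleftrightarrow> rat_of_code (hat_fun (decode1 U (val e s)) (Suc k)) - rat_of_code (hat_fun (decode1 U (val e t)) (Suc k))
      < 1 / 2 ^ k" for k
    using ok fr st e
    by (simp add: ler_ok_def less_code_eq_0_iff rat_of_add_code rat_of_minus_code rat_of_eps_code)
  moreover have "(\<forall>a\<in>car U Nt. P a) \<longleftrightarrow> (\<forall>k. P (num U k))" for P
    using num_the_num num_in by metis
  ultimately show ?thesis
    unfolding ler_def Let_def n_def[symmetric] real_val_def real_of_code_le_iff by simp
qed

lemma app_fun_code2:
  assumes "Fn \<rho> (Fn \<sigma> \<tau>) \<in> D" "\<And>x y. x \<in> car U \<rho> \<Longrightarrow> y \<in> car U \<sigma> \<Longrightarrow> f x y \<in> car U \<tau>"
    and "x \<in> car U \<rho>" "y \<in> car U \<sigma>"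
  shows "app U (app U (fun_code U \<rho> (Fn \<sigma> \<tau>) (\<lambda>x. fun_code U \<sigma> \<tau> (f x))) x) y = f x y"
proof -
  note D = Fn_type_cod[OF assms(1)]
  have "app U (fun_code U \<rho> (Fn \<sigma> \<tau>) (\<lambda>x. fun_code U \<sigma> \<tau> (f x))) x = fun_code U \<sigma> \<tau> (f x)"
    by (rule app_fun_code[OF assms(1) fun_code_in[OF D assms(2)] assms(3)])
  then show ?thesis using app_fun_code[OF D assms(2)[OF assms(3)] assms(4)] by simp
qed

lemma app_fun_code3:
  assumes "Fn \<rho> (Fn \<sigma> (Fn \<tau> \<upsilon>)) \<in> D"
    and "\<And>x y z. x \<in> car U \<rho> \<Longrightarrow> y \<in> car U \<sigma> \<Longrightarrow> z \<in> car U \<tau> \<Longrightarrow> f x y z \<in> car U \<upsilon>"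
    and "x \<in> car U \<rho>" "y \<in> car U \<sigma>" "z \<in> car U \<tau>"
  shows "app U (app U (app U (fun_code U \<rho> (Fn \<sigma> (Fn \<tau> \<upsilon>)) (\<lambda>x. fun_code U \<sigma> (Fn \<tau> \<upsilon>)
     (\<lambda>y. fun_code U \<tau> \<upsilon> (f x y)))) x) y) z = f x y z"
proof -
  note D = Fn_type_cod[OF Fn_type_cod[OF assms(1)]]
  have "app U (app U (fun_code U \<rho> (Fn \<sigma> (Fn \<tau> \<upsilon>)) (\<lambda>x. fun_code U \<sigma> (Fn \<tau> \<upsilon>)
     (\<lambda>y. fun_code U \<tau> \<upsilon> (f x y)))) x) y = fun_code U \<tau> \<upsilon> (f x y)"
    by (rule app_fun_code2[OF assms(1) fun_code_in[OF D assms(2)] assms(3,4)])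
  then show ?thesis using app_fun_code[OF D assms(2)[OF assms(3,4)] assms(5)] by simp
qed

lemma alg_val_zerox [simp]: "alg_val e 0\<^sub>X = 0"
  by (simp add: alg_val_def cst_int.simps vn_int.simps)

lemma alg_val_onex [simp]: "alg_val e 1\<^sub>X = 1"
  by (simp add: alg_val_def cst_int.simps vn_int.simps)

lemma alg_val_plusx [simp]:
  assumes "wt D (s +\<^sub>X t)" "good e" shows "alg_val e (s +\<^sub>X t) = alg_val e s + alg_val e t"
proof -
  have t: "Fn Xt (Fn Xt Xt) \<in> D" "wt D s" "wt D t" "ty_of s = Xt" "ty_of t = Xt"
    using assms(1) by auto
  show ?thesis
    using app_fun_code2[OF t(1), of "\<lambda>x y. elt U (the_elt U x + the_elt U y)" "val e s" "val e t"]
      val_in[OF t(2) assms(2)] val_in[OF t(3) assms(2)] t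
    by (simp add: alg_val_def cst_int.simps vn_int.simps)
qed

lemma alg_val_timesx [simp]:
  assumes "wt D (s *\<^sub>X t)" "good e" shows "alg_val e (s *\<^sub>X t) = alg_val e s * alg_val e t"
proof -
  have t: "Fn Xt (Fn Xt Xt) \<in> D" "wt D s" "wt D t" "ty_of s = Xt" "ty_of t = Xt"
    using assms(1) by auto
  show ?thesis
    using app_fun_code2[OF t(1), of "\<lambda>x y. elt U (the_elt U x * the_elt U y)" "val e s" "val e t"]
      val_in[OF t(2) assms(2)] val_in[OF t(3) assms(2)] t
    by (simp add: alg_val_def cst_int.simps vn_int.simps)
qed

lemma alg_val_minusx [simp]:
  assumes "wt D (minusx s)" "good e" shows "alg_val e (minusx s) = - alg_val e s"
proof -
  have t: "Fn Xt Xt \<in> D" "wt D s" "ty_of s = Xt"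
    using assms(1) by auto
  show ?thesis
    using app_fun_code[OF t(1), of "\<lambda>x. elt U (- the_elt U x)" "val e s"] val_in[OF t(2) assms(2)] t
    by (simp add: alg_val_def cst_int.simps vn_int.simps)
qed

lemma alg_val_starx [simp]:
  assumes "wt D (starx s)" "good e" shows "alg_val e (starx s) = star (alg_val e s)"
proof -
  have t: "Fn Xt Xt \<in> D" "wt D s" "ty_of s = Xt"
    using assms(1) by auto
  show ?thesis
    using app_fun_code[OF t(1), of "\<lambda>x. elt U (star (the_elt U x))" "val e s"] val_in[OF t(2) assms(2)] t
    by (simp add: alg_val_def cst_int.simps vn_int.simps)
qed

lemma alg_val_scalex [simp]:
  assumes "wt D (Cst (VN ScaleX) \<cdot> a \<cdot> b \<cdot> t)" "good e"
  shows "alg_val e (Cst (VN ScaleX) \<cdot> a \<cdot> b \<cdot> t) = sc (Complex (real_val e a) (real_val e b)) (alg_val e t)"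
proof -
  have t: "Fn T1 (Fn T1 (Fn Xt Xt)) \<in> D" "wt D a" "wt D b" "wt D t" "ty_of a = T1" "ty_of b = T1" "ty_of t = Xt"
    using assms(1) by auto
  show ?thesis
    using app_fun_code3[OF t(1), of "\<lambda>f g x. elt U (sc (Complex (real_of_code (decode1 U f))
        (real_of_code (decode1 U g))) (the_elt U x))" "val e a" "val e b" "val e t"]
      val_in[OF t(2) assms(2)] val_in[OF t(3) assms(2)] val_in[OF t(4) assms(2)] t
    by (simp add: alg_val_def real_val_def cst_int.simps vn_int.simps)
qed

text \<open>Common to the two norms and the two parts of the trace, which differ only in the
  representing function \<open>h\<close>.\<close>

lemma decode_app_VN:
  assumes "wt D (Cst (VN c) \<cdot> s)" "good e" "vnty c = Fn Xt T1"
    and "vn_int U sc star tr c = fun_code U Xt T1 (\<lambda>x. code1 U (h (the_elt U x)))"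
  shows "decode1 U (val e (Cst (VN c) \<cdot> s)) = h (alg_val e s)"
proof -
  have t: "Fn Xt T1 \<in> D" "wt D s" "ty_of s = Xt"
    using assms(1,3) by auto
  note T1 = Fn_type_cod[OF t(1)]
  show ?thesis
    using app_fun_code[OF t(1) code1_in[OF T1], of "val e s"] val_in[OF t(2) assms(2)] t T1
    by (simp add: alg_val_def cst_int.simps assms(4) decode1_code1)
qed

end

locale tracial_model = full_universe_model U sc star tr + tracial_von_neumann_algebra sc star scp J tr
  for U :: "('u, 'a::{real_normed_algebra_1, banach}) universe" and sc star tr
    and scp :: "complex \<Rightarrow> 'p::banach \<Rightarrow> 'p" and J
begin

lemma real_val_ninf [simp]:
  "wt D (\<parallel>s\<parallel>) \<Longrightarrow> good e \<Longrightarrow> real_val e (\<parallel>s\<parallel>) = norm (alg_val e s)"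
  unfolding real_val_def
  by (subst decode_app_VN[where h = "\<lambda>x. circ (norm x)"]) (simp_all add: vn_int.simps real_of_circ)

lemma real_val_n2 [simp]:
  "wt D (Cst (VN Norm2) \<cdot> s) \<Longrightarrow> good e \<Longrightarrow> real_val e (Cst (VN Norm2) \<cdot> s) = n2 (alg_val e s)"
  unfolding real_val_def
  by (subst decode_app_VN[where h = "\<lambda>x. circ (n2 x)"]) (simp_all add: vn_int.simps real_of_circ n2_nonneg)

lemma real_val_TrRe [simp]:
  "wt D (Cst (VN TrRe) \<cdot> s) \<Longrightarrow> good e \<Longrightarrow> real_val e (Cst (VN TrRe) \<cdot> s) = Re (tr (alg_val e s))"
  unfolding real_val_def
  by (subst decode_app_VN[where h = "\<lambda>x. circ_plus (Re (tr x))"]) (simp_all add: vn_int.simps real_of_circ_plus)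

lemma real_val_TrIm [simp]:
  "wt D (Cst (VN TrIm) \<cdot> s) \<Longrightarrow> good e \<Longrightarrow> real_val e (Cst (VN TrIm) \<cdot> s) = Im (tr (alg_val e s))"
  unfolding real_val_def
  by (subst decode_app_VN[where h = "\<lambda>x. circ_plus (Im (tr x))"]) (simp_all add: vn_int.simps real_of_circ_plus)

end

section \<open>Axioms of tracial algebras and majorization\<close>

context full_universe_model begin

lemma wff_eqfD: "wff D (eqf \<rho> s t) \<Longrightarrow> wt D s \<and> wt D t \<and> ty_of s = \<rho> \<and> ty_of t = \<rho>"
proof (induction \<rho> arbitrary: s t)
  case (Fn \<rho> \<tau>)
  then show ?case by (fastforce simp: Let_def)
qed auto

lemma val_upd_fresh:
  assumes "fresh [s, t] \<le> n"
  shows "val (e((n, \<rho>) := a)) s = val e s" "val (e((n, \<rho>) := a)) t = val e t"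
  using fresh_notin_fvt[of s "[s, t]" n \<rho>] fresh_notin_fvt[of t "[s, t]" n \<rho>] assms by simp_all

fun majorizes :: "ty \<Rightarrow> 'u \<Rightarrow> 'u \<Rightarrow> bool" where
  "majorizes Nt a b \<longleftrightarrow> the_num U a \<le> the_num U b"
| "majorizes Xt a b \<longleftrightarrow> norm (the_elt U a) \<le> real (the_num U b)"
| "majorizes (Fn \<rho> \<tau>) f g \<longleftrightarrow> (\<forall>x\<in>car U \<rho>. \<forall>y\<in>car U (hatty \<rho>).
     majorizes \<rho> x y \<longrightarrow> majorizes \<tau> (app U f x) (app U g y))"

lemma wff_majfD: "wff D (majf \<rho> s t) \<Longrightarrow> wt D s \<and> wt D t \<and> ty_of s = \<rho> \<and> ty_of t = hatty \<rho>"
proof (induction \<rho> arbitrary: s t)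
  case (Fn \<rho> \<tau>)
  then show ?case by (fastforce simp: Let_def)
qed auto

end

context tracial_model begin

text \<open>Defined equality is true identity in the model: at type X because the norm is definite,
  at higher types because elements of a full function space are determined by their values. This
  makes the extensionality rule and the combinator axioms sound.\<close>

lemma sat_eqf:
  assumes "wff D (eqf \<rho> s t)" "good e"
  shows "sat M e (eqf \<rho> s t) \<longleftrightarrow> val e s = val e t"
  using assms
proof (induction \<rho> arbitrary: s t e)
  case Nt
  then show ?case by simp
next
  case Xt
  have w: "wt D s" "wt D t" "ty_of s = Xt" "ty_of t = Xt" using wff_eqfD[OF Xt(1)] by auto
  have "val e s \<in> car U Xt" "val e t \<in> car U Xt"
    using val_in[OF w(1) Xt(2)] val_in[OF w(2) Xt(2)] w by auto
  then have "alg_val e s = alg_val e t \<longleftrightarrow> val e s = val e t"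
    unfolding alg_val_def by (rule the_elt_eq_iff)
  then show ?case using Xt by simp
next
  case (Fn \<rho> \<tau>)
  define n where "n = fresh [s, t]"
  have w: "wt D s" "wt D t" "ty_of s = Fn \<rho> \<tau>" "ty_of t = Fn \<rho> \<tau>"
    using wff_eqfD[OF Fn.prems(1)] by auto
  have D: "Fn \<rho> \<tau> \<in> D" using ty_of_in[OF w(1)] w(3) by simp
  have wff: "wff D (eqf \<tau> (s \<cdot> Var (n, \<rho>)) (t \<cdot> Var (n, \<rho>)))"
    using Fn.prems(1) by (simp add: Let_def n_def)
  have eq: "sat M (e((n, \<rho>) := a)) (eqf \<tau> (s \<cdot> Var (n, \<rho>)) (t \<cdot> Var (n, \<rho>)))
      \<longleftrightarrow> app U (val e s) a = app U (val e t) a" if "a \<in> car U \<rho>" for a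
    using that Fn.prems(2) val_upd_fresh[of s t n e \<rho> a]
    by (subst Fn.IH(2)[OF wff]) (simp_all add: n_def)
  have "sat M e (eqf (Fn \<rho> \<tau>) s t) \<longleftrightarrow>
      (\<forall>a\<in>car U \<rho>. sat M (e((n, \<rho>) := a)) (eqf \<tau> (s \<cdot> Var (n, \<rho>)) (t \<cdot> Var (n, \<rho>))))"
    by (simp add: Let_def n_def)
  also have "\<dots> \<longleftrightarrow> (\<forall>a\<in>car U \<rho>. app U (val e s) a = app U (val e t) a)"
    by (simp only: eq cong: ball_cong)
  also have "\<dots> \<longleftrightarrow> val e s = val e t"
    using fun_ext[OF D] val_in[OF w(1) Fn.prems(2)] val_in[OF w(2) Fn.prems(2)] w(3,4) by auto
  finally show ?case .
qed

lemma sat_majf: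
  assumes "wff D (majf \<rho> s t)" "good e"
  shows "sat M e (majf \<rho> s t) \<longleftrightarrow> majorizes \<rho> (val e s) (val e t)"
  using assms
proof (induction \<rho> arbitrary: s t e)
  case Nt
  then have w: "wt D s" "wt D t" "ty_of s = Nt" "ty_of t = Nt" "wt D c_monus" by auto
  show ?case
    using Nt(2) w(5) val_Nt[OF w(1,3) Nt(2)] val_Nt[OF w(2,4) Nt(2)] by simp
next
  case Xt
  then show ?case by (simp add: alg_val_def nat_val_def)
next
  case (Fn \<rho> \<tau>)
  define n where "n = fresh [s, t]"
  let ?e = "\<lambda>a b. e((n, \<rho>) := a, (Suc n, hatty \<rho>) := b)"
  have wff: "wff D (majf \<rho> (Var (n, \<rho>)) (Var (Suc n, hatty \<rho>)))"
    "wff D (majf \<tau> (s \<cdot> Var (n, \<rho>)) (t \<cdot> Var (Suc n, hatty \<rho>)))"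
    using Fn.prems(1) by (simp_all add: Let_def n_def)
  have e: "good (?e a b)" if "a \<in> car U \<rho>" "b \<in> car U (hatty \<rho>)" for a b
    using that Fn.prems(2) by simp
  have v: "val (?e a b) s = val e s" "val (?e a b) t = val e t" for a b
    using val_upd_fresh[of s t n] val_upd_fresh[of s t "Suc n"] by (simp_all add: n_def)
  have maj: "sat M (?e a b) (majf \<rho> (Var (n, \<rho>)) (Var (Suc n, hatty \<rho>)))
      \<longleftrightarrow> majorizes \<rho> (val (?e a b) (Var (n, \<rho>))) (val (?e a b) (Var (Suc n, hatty \<rho>)))"
    "sat M (?e a b) (majf \<tau> (s \<cdot> Var (n, \<rho>)) (t \<cdot> Var (Suc n, hatty \<rho>)))
      \<longleftrightarrow> majorizes \<tau> (val (?e a b) (s \<cdot> Var (n, \<rho>))) (val (?e a b) (t \<cdot> Var (Suc n, hatty \<rho>)))"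
    if "a \<in> car U \<rho>" "b \<in> car U (hatty \<rho>)" for a b
    by (rule Fn.IH(1)[OF wff(1) e[OF that]] Fn.IH(2)[OF wff(2) e[OF that]])+
  have "sat M e (majf (Fn \<rho> \<tau>) s t) \<longleftrightarrow> (\<forall>a\<in>car U \<rho>. \<forall>b\<in>car U (hatty \<rho>).
      sat M (?e a b) (majf \<rho> (Var (n, \<rho>)) (Var (Suc n, hatty \<rho>))) \<longrightarrow>
      sat M (?e a b) (majf \<tau> (s \<cdot> Var (n, \<rho>)) (t \<cdot> Var (Suc n, hatty \<rho>))))"
    by (simp add: Let_def n_def)
  also have "\<dots> \<longleftrightarrow> majorizes (Fn \<rho> \<tau>) (val e s) (val e t)"
    by (simp add: maj v cong: ball_cong)
  finally show ?case .
qed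

section \<open>Majorization of the constants\<close>

lemma app_code1: "T1 \<in> D \<Longrightarrow> x \<in> car U Nt \<Longrightarrow> app U (code1 U f) x = num U (f (the_num U x))"
  unfolding code1_def by (rule app_fun_code) auto

lemma majorizes_code1:
  assumes "T1 \<in> D" "\<And>m n. m \<le> n \<Longrightarrow> f m \<le> g n"
  shows "majorizes T1 (code1 U f) (code1 U g)"
  using assms by (simp add: app_code1)

text \<open>The majorant of scaling reads its arguments only at 0, and 0 is majorized by
  itself.\<close>

lemma majorizes_T1_0:
  assumes "T1 \<in> D" "f \<in> car U T1" "g \<in> car U T1" "majorizes T1 f g"
  shows "decode1 U f 0 \<le> decode1 U g 0"
proof -
  have "majorizes Nt (app U f (num U 0)) (app U g (num U 0))"
    using assms(4) by (simp del: majorizes.simps(1)) (simp del: app_decode1)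
  with assms(1-3) show ?thesis by simp
qed

text \<open>Each part is bounded by its first code plus 1; the two summands 1 are the constant 2 in
  the majorant of scaling.\<close>

lemma cmod_Complex_code_le:
  "cmod (Complex (real_of_code f) (real_of_code g)) \<le> real (f 0 + g 0 + 2)"
  using cmod_le[of "Complex (real_of_code f) (real_of_code g)"] abs_real_of_code_le[of f] abs_real_of_code_le[of g]
  by simp

lemma majorizes_real:
  assumes D: "Fn Xt T1 \<in> D" "Fn Nt T1 \<in> D"
    and h: "\<And>x n i j. norm x \<le> real n \<Longrightarrow> i \<le> j \<Longrightarrow> h x i \<le> circ (real n) j"
  shows "majorizes (Fn Xt T1) (fun_code U Xt T1 (\<lambda>x. code1 U (h (the_elt U x))))
    (fun_code U Nt T1 (\<lambda>n. code1 U (circ (real (the_num U n)))))"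
  unfolding majorizes.simps(3)[of Xt] hatty.simps
proof (intro ballI impI)
  note T1 = Fn_type_cod[OF D(1)]
  fix x n assume x: "x \<in> car U Xt" "n \<in> car U Nt" "majorizes Xt x n"
  have "majorizes T1 (code1 U (h (the_elt U x))) (code1 U (circ (real (the_num U n))))"
    by (rule majorizes_code1[OF T1 h]) (use x in auto)
  then show "majorizes T1 (app U (fun_code U Xt T1 (\<lambda>x. code1 U (h (the_elt U x)))) x)
      (app U (fun_code U Nt T1 (\<lambda>n. code1 U (circ (real (the_num U n))))) n)"
    by (simp only: app_fun_code[OF D(1) code1_in[OF T1] x(1)] app_fun_code[OF D(2) code1_in[OF T1] x(2)])
qed

lemma majorizes_VN:
  assumes D: "vnty c \<in> D" "hatty (vnty c) \<in> D"
  shows "majorizes (vnty c) (vn_int U sc star tr c) (maj_int U c)"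
proof (cases c)
  case PlusX
  have add: "norm (x + y) \<le> a + b" if "norm x \<le> a" "norm y \<le> b" for x y :: 'a and a b
    using that norm_triangle_ineq[of x y] by linarith
  show ?thesis
    using D by (simp add: PlusX vn_int.simps maj_int.simps app_fun_code2 add)
next
  case TimesX
  have mult: "norm (x * y) \<le> real m * real n" if "norm x \<le> real m" "norm y \<le> real n" for x y :: 'a and m n
    using that norm_mult_ineq[of x y] mult_mono[of "norm x" "real m" "norm y" "real n"] by simp
  show ?thesis
    using D by (simp add: TimesX vn_int.simps maj_int.simps app_fun_code2 mult)
next
  case ScaleX
  have T1: "T1 \<in> D" using D Fn_type_dom[of T1] by (simp add: ScaleX)
  show ?thesis
    unfolding ScaleX vnty.simps majorizes.simps(3) hatty.simps
  proof (intro ballI impI)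
    fix f F g G x n
    assume in_car: "f \<in> car U T1" "F \<in> car U T1" "g \<in> car U T1" "G \<in> car U T1" "x \<in> car U Xt" "n \<in> car U Nt"
      and f: "\<forall>x\<in>car U Nt. \<forall>y\<in>car U Nt. majorizes Nt x y \<longrightarrow> majorizes Nt (app U f x) (app U F y)"
      and g: "\<forall>x\<in>car U Nt. \<forall>y\<in>car U Nt. majorizes Nt x y \<longrightarrow> majorizes Nt (app U g x) (app U G y)"
      and x: "majorizes Xt x n"
    have "decode1 U f 0 \<le> decode1 U F 0" "decode1 U g 0 \<le> decode1 U G 0"
      using majorizes_T1_0[OF T1 in_car(1,2)] majorizes_T1_0[OF T1 in_car(3,4)] f g by simp_all
    then have "cmod (Complex (real_of_code (decode1 U f)) (real_of_code (decode1 U g)))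
        \<le> real (decode1 U F 0 + decode1 U G 0 + 2)"
      using cmod_Complex_code_le[of "decode1 U f" "decode1 U g"] by simp
    then have "norm (sc (Complex (real_of_code (decode1 U f)) (real_of_code (decode1 U g))) (the_elt U x))
        \<le> real ((decode1 U F 0 + decode1 U G 0 + 2) * the_num U n)"
      unfolding norm_sc of_nat_mult using x by (intro mult_mono) auto
    then show "majorizes Xt (app U (app U (app U (vn_int U sc star tr ScaleX) f) g) x)
        (app U (app U (app U (maj_int U ScaleX) F) G) n)"
      using D in_car by (simp add: ScaleX vn_int.simps maj_int.simps app_fun_code3)
  qed
next
  case NormInf
  with D show ?thesis
    unfolding NormInf vn_int.simps maj_int.simps vnty.simps hatty.simps
    by (intro majorizes_real[where h = "\<lambda>x. circ (norm x)"]) (simp_all add: circ_mono norm_ge_zero)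
next
  case Norm2
  have "n2 x \<le> real n" if "norm x \<le> real n" for x n
    using n2_le_norm[of x] that by simp
  with Norm2 D show ?thesis
    unfolding Norm2 vn_int.simps maj_int.simps vnty.simps hatty.simps
    by (intro majorizes_real[where h = "\<lambda>x. circ (n2 x)"]) (simp_all add: circ_mono n2_nonneg)
next
  case TrRe
  have "\<bar>Re (tr x)\<bar> \<le> real n" if "norm x \<le> real n" for x n
    using abs_Re_le_cmod[of "tr x"] cmod_tr_le[of x] n2_le_norm[of x] that by linarith
  with TrRe D show ?thesis
    unfolding TrRe vn_int.simps maj_int.simps vnty.simps hatty.simps
    by (intro majorizes_real[where h = "\<lambda>x. circ_plus (Re (tr x))"]) (simp_all add: circ_plus_le_circ)
next
  case TrIm
  have "\<bar>Im (tr x)\<bar> \<le> real n" if "norm x \<le> real n" for x n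
    using abs_Im_le_cmod[of "tr x"] cmod_tr_le[of x] n2_le_norm[of x] that by linarith
  with TrIm D show ?thesis
    unfolding TrIm vn_int.simps maj_int.simps vnty.simps hatty.simps
    by (intro majorizes_real[where h = "\<lambda>x. circ_plus (Im (tr x))"]) (simp_all add: circ_plus_le_circ)
qed (use D in \<open>simp_all add: vn_int.simps maj_int.simps app_fun_code norm_star\<close>)

section \<open>Axioms on the algebra, the norms and the trace\<close>

lemma Complex_1_0: "Complex 1 0 = 1"
  by (simp add: complex_eq_iff)

lemma sat_algebra_axiom: "algebra_axiom A \<Longrightarrow> wff D A \<Longrightarrow> good e \<Longrightarrow> sat M e A"
  by (induction rule: algebra_axiom.induct)
     (simp_all add: sc_add_right sc_mult_left sc_mult_right sc_sc Complex_1_0 algebra_simps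
       flip: sc_add_left complex_add complex_mult)

lemma sat_normed_axiom_ninf: "normed_axiom ninf A \<Longrightarrow> wff D A \<Longrightarrow> good e \<Longrightarrow> sat M e A"
proof (induction rule: normed_axiom.induct)
  case 2
  then show ?case by (simp add: norm_triangle_ineq)
next
  case 4
  then show ?case by (simp add: norm_minus_commute)
next
  case 5
  then show ?case using norm_triangle_ineq[of "alg_val e (vX 0) - alg_val e (vX 1)" "alg_val e (vX 1) - alg_val e (vX 2)"] by simp
next
  case 8
  then show ?case using norm_diff_triangle_ineq[of "alg_val e (vX 0)" "alg_val e (vX 1)"
        "alg_val e (vX 2)" "alg_val e (vX 3)"] by (simp add: algebra_simps)
next
  case 9
  then show ?case by (simp add: norm_minus_commute)
next
  case 10
  then show ?case by (simp add: norm_triangle_ineq3)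
qed (simp_all add: norm_sc flip: sc_diff_left sc_diff_right complex_diff)

lemma n2_minus_commute: "n2 (x - y) = n2 (y - x)"
  using n2_minus[of "x - y"] by simp

lemma n2_triangle3: "\<bar>n2 x - n2 y\<bar> \<le> n2 (x - y)"
  using n2_triangle[of "x - y" y] n2_triangle[of "y - x" x] n2_minus_commute[of x y] by simp

lemma sat_normed_axiom_n2:
  "normed_axiom (\<lambda>s. Cst (VN Norm2) \<cdot> s) A \<Longrightarrow> wff D A \<Longrightarrow> good e \<Longrightarrow> sat M e A"
proof (induction rule: normed_axiom.induct)
  case 2
  then show ?case by (simp add: n2_triangle)
next
  case 4
  then show ?case by (simp add: n2_minus_commute)
next
  case 5
  then show ?case using n2_triangle[of "alg_val e (vX 0) - alg_val e (vX 1)" "alg_val e (vX 1) - alg_val e (vX 2)"] by simp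
next
  case 8
  then show ?case
    using n2_triangle[of "alg_val e (vX 0) - alg_val e (vX 2)" "alg_val e (vX 1) - alg_val e (vX 3)"]
    by (simp add: algebra_simps)
next
  case 9
  then show ?case by (simp add: n2_minus_commute)
next
  case 10
  then show ?case by (simp add: n2_triangle3)
qed (simp_all add: n2_sc flip: sc_diff_left sc_diff_right complex_diff)

lemma sat_tracial_axiom: "tracial_axiom A \<Longrightarrow> wff D A \<Longrightarrow> good e \<Longrightarrow> sat M e A"
proof (induction rule: tracial_axiom.induct)
  case 9
  then show ?case by (simp add: norm_star flip: star_diff)
next
  case 7
  then show ?case by (simp add: tr_star_mult_self power2_eq_square)
next
  case 6
  then show ?case by (simp add: tr_commute[of "alg_val e (vX 0)"])
qed (simp_all add: norm_mult_ineq tr_add tr_sc tr_star tr_one n2_mult_le n2_le_norm cmod_tr_le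
      right_diff_distrib left_diff_distrib)

text \<open>\<open>polyx\<close> is a Horner scheme: each step splits off the constant term and
  shifts the remaining sum by one factor.\<close>

lemma alg_val_polyx:
  assumes "wt D (foldr (\<lambda>c s. (ratr c, zeror) \<odot> 1\<^sub>X +\<^sub>X t *\<^sub>X s) cs 0\<^sub>X)" "good e"
  shows "alg_val e (foldr (\<lambda>c s. (ratr c, zeror) \<odot> 1\<^sub>X +\<^sub>X t *\<^sub>X s) cs 0\<^sub>X)
    = (\<Sum>i<length cs. sc (of_rat (cs ! i)) (alg_val e t ^ i))"
  using assms
proof (induction cs)
  case (Cons c cs)
  have "Complex (of_rat c) 0 = of_rat c"
    by (cases c) (simp add: of_rat_rat flip: complex_of_real_def)
  with Cons show ?case
    by (simp add: sum.lessThan_Suc_shift sum_distrib_left sc_mult_right del: sum.lessThan_Suc)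
qed simp

lemma poly_map_of_rat:
  "poly (map_poly of_rat p) z = (\<Sum>i<length (coeffs p). of_rat (coeffs p ! i) * z ^ i)" for z :: complex
proof (cases "p = 0")
  case False
  have "poly (map_poly of_rat p) z = (\<Sum>i\<le>degree p. of_rat (coeff p i) * z ^ i)"
    by (simp add: poly_altdef degree_map_poly coeff_map_poly)
  also have "\<dots> = (\<Sum>i<length (coeffs p). of_rat (coeffs p ! i) * z ^ i)"
    using False by (intro sum.cong) (auto simp: length_coeffs_degree coeffs_nth)
  finally show ?thesis .
qed simp

lemma sat_ball_axiom:
  assumes "admissible q" "ball_axiom q A" "wff D A" "good e"
  shows "sat M e A"
  using assms(2)
proof cases
  case (1 n k)
  define x where "x = alg_val e (vX 0)"
  define m where "m = max (norm x) (real n)"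
  define t where "t = (recipr (maxr \<parallel>vX 0\<parallel> (natr (num_trm n))), zeror) \<odot> vX 0"
  define cs where "cs = coeffs (q n k)"
  have m: "m \<ge> 1" "norm x \<le> m" using 1(2) by (auto simp: m_def)
  have A: "A = (\<parallel>polyx (q n k) t\<parallel> \<le>\<^sub>r oner)" using 1(1) by (simp add: t_def)
  have wp: "wt D (foldr (\<lambda>c s. (ratr c, zeror) \<odot> 1\<^sub>X +\<^sub>X t *\<^sub>X s) cs 0\<^sub>X)"
    using assms(3) unfolding A wff_ler_iff by (simp add: polyx_def cs_def)
  have "cs \<noteq> [] \<Longrightarrow> wt D t"
    using wp by (cases cs) auto
  show ?thesis
  \<comment> \<open>For the zero polynomial the argument \<open>t\<close> does not occur in the
    formula, so nothing is known about its typing.\<close>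
  proof (cases "cs = []")
    case True
    with assms(3,4) show ?thesis
      by (simp add: A polyx_def cs_def)
  next
    case False
    with wp have wt: "wt D t" by (cases cs) auto
    have nm: "nat_val e (num_trm n) = n" using wt assms(4) by (simp add: nat_val_def t_def)
    \<comment> \<open>Since \<open>n \<ge> 1\<close>, also \<open>m \<ge> 1\<close>, and the
      truncation at 1 in \<open>recipr\<close> has no effect.\<close>
    have T: "alg_val e t = sc (Complex (1 / m) 0) x"
      using wt assms(4) nm m(1) by (simp add: t_def x_def m_def max_absorb1)
    have nT: "norm (alg_val e t) \<le> 1"
      unfolding T norm_sc using m by (simp add: complex_norm divide_le_eq)
    \<comment> \<open>The bound on the circle comes from the clause of \<open>admissible\<close>
      about the complex disc.\<close>
    have "norm (\<Sum>i<length cs. sc (of_rat (cs ! i)) (alg_val e t ^ i)) \<le> 1"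
    proof (rule von_Neumann_inequality[OF nT])
      fix z :: complex assume "cmod z = 1"
      then show "cmod (\<Sum>i<length cs. of_rat (cs ! i) * z ^ i) \<le> 1"
        using assms(1) 1(2) unfolding admissible_def cs_def poly_map_of_rat[symmetric] by auto
    qed
    moreover have "alg_val e (polyx (q n k) t) = (\<Sum>i<length cs. sc (of_rat (cs ! i)) (alg_val e t ^ i))"
      unfolding polyx_def cs_def[symmetric] by (rule alg_val_polyx[OF wp assms(4)])
    ultimately show ?thesis
      using assms(3,4) unfolding A by simp
  qed
qed

end

section \<open>Soundness of the logical axioms and rules\<close>

lemma sat_cong: "(\<And>v. v \<in> fvf A \<Longrightarrow> e v = e' v) \<Longrightarrow> sat M e A = sat M e' A"
proof (induction A arbitrary: e e')
  case (Eq s t)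
  then have "tval M e s = tval M e' s" "tval M e t = tval M e' t" by (auto intro!: tval_cong)
  then show ?case by simp
next
  case (And A B)
  from And.IH(1)[of e e'] And.IH(2)[of e e'] And.prems show ?case by simp
next
  case (Or A B)
  from Or.IH(1)[of e e'] Or.IH(2)[of e e'] Or.prems show ?case by simp
next
  case (Imp A B)
  from Imp.IH(1)[of e e'] Imp.IH(2)[of e e'] Imp.prems show ?case by simp
next
  case (Forall v A)
  have "sat M (e(v := a)) A = sat M (e'(v := a)) A" for a
    by (rule Forall.IH) (use Forall.prems in auto)
  then show ?case by simp
next
  case (Exists v A)
  have "sat M (e(v := a)) A = sat M (e'(v := a)) A" for a
    by (rule Exists.IH) (use Exists.prems in auto)
  then show ?case by simp
qed

lemma sat_upd_notin: "v \<notin> fvf A \<Longrightarrow> sat M (e(v := a)) A = sat M e A"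
  by (rule sat_cong) auto

lemma tval_substt: "tval M e (substt \<sigma> t) = tval M (\<lambda>v. tval M e (\<sigma> v)) t"
  by (induction t) auto

text \<open>Under \<open>free_for\<close> a bound variable does not occur in the terms substituted
  for the free variables of its scope, so reassigning it leaves their values unchanged.\<close>

lemma sat_substf:
  "free_for \<sigma> A \<Longrightarrow> sat M e (substf \<sigma> A) = sat M (\<lambda>v. tval M e (\<sigma> v)) A"
proof (induction A arbitrary: \<sigma> e)
  case (Forall v A)
  have "sat M (e(v := a)) (substf (\<sigma>(v := Var v)) A) = sat M ((\<lambda>w. tval M e (\<sigma> w))(v := a)) A" for a
  proof -
    have "sat M (e(v := a)) (substf (\<sigma>(v := Var v)) A)
        = sat M (\<lambda>w. tval M (e(v := a)) ((\<sigma>(v := Var v)) w)) A"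
      by (rule Forall.IH) (use Forall.prems in \<open>simp add: fun_upd_def\<close>)
    also have "\<dots> = sat M ((\<lambda>w. tval M e (\<sigma> w))(v := a)) A"
      by (rule sat_cong) (use Forall.prems in auto)
    finally show ?thesis .
  qed
  then show ?case by simp
next
  case (Exists v A)
  have "sat M (e(v := a)) (substf (\<sigma>(v := Var v)) A) = sat M ((\<lambda>w. tval M e (\<sigma> w))(v := a)) A" for a
  proof -
    have "sat M (e(v := a)) (substf (\<sigma>(v := Var v)) A)
        = sat M (\<lambda>w. tval M (e(v := a)) ((\<sigma>(v := Var v)) w)) A"
      by (rule Exists.IH) (use Exists.prems in \<open>simp add: fun_upd_def\<close>)
    also have "\<dots> = sat M ((\<lambda>w. tval M e (\<sigma> w))(v := a)) A"
      by (rule sat_cong) (use Exists.prems in auto)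
    finally show ?thesis .
  qed
  then show ?case by simp
qed (simp_all add: tval_substt)

lemma sat_sub1:
  assumes "free_for (sub1 v t) A"
  shows "sat M e (substf (sub1 v t) A) = sat M (e(v := tval M e t)) A"
proof -
  have "(\<lambda>w. tval M e (sub1 v t w)) = e(v := tval M e t)" by auto
  then show ?thesis by (simp only: sat_substf[OF assms])
qed

text \<open>Covers the induction schema, where \<open>x\<close> is replaced by \<open>zero\<close>
  and by \<open>suc (Var x)\<close>.\<close>

lemma free_for_no_new_vars: "(\<And>w. fvt (\<sigma> w) \<subseteq> {w}) \<Longrightarrow> free_for \<sigma> A"
proof (induction A arbitrary: \<sigma>)
  case (Forall v A)
  have "free_for (\<sigma>(v := Var v)) A" by (rule Forall.IH) (use Forall.prems in auto)
  with Forall.prems show ?case by fastforce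
next
  case (Exists v A)
  have "free_for (\<sigma>(v := Var v)) A" by (rule Exists.IH) (use Exists.prems in auto)
  with Exists.prems show ?case by fastforce
qed auto

lemma free_for_qfree: "qfree A \<Longrightarrow> free_for \<sigma> A"
  by (induction A) auto

lemma wt_substt: "v \<in> fvt s \<Longrightarrow> wt D (substt \<sigma> s) \<Longrightarrow> wt D (\<sigma> v)"
  by (induction s) auto

text \<open>Only the instance is known to be well-formed; a free occurrence of \<open>v\<close> puts
  \<open>\<sigma> v\<close> into it, and so the types of that term into \<open>D\<close>.\<close>

lemma wff_substf: "v \<in> fvf A \<Longrightarrow> wff D (substf \<sigma> A) \<Longrightarrow> wt D (\<sigma> v)"
proof (induction A arbitrary: \<sigma>)
  case (Forall w A)
  then show ?case by (force split: if_splits)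
next
  case (Exists w A)
  then show ?case by (force split: if_splits)
qed (auto dest: wt_substt)

section \<open>Quantifiers over tuples of variables\<close>

primrec upds :: "(var \<Rightarrow> 'u) \<Rightarrow> var list \<Rightarrow> 'u list \<Rightarrow> var \<Rightarrow> 'u" where
  "upds e [] as = e"
| "upds e (x # xs) as = upds (e(x := hd as)) xs (tl as)"

lemma upds_notin: "v \<notin> set xs \<Longrightarrow> upds e xs as v = e v"
  by (induction xs arbitrary: e as) auto

lemma upds_nth: "distinct xs \<Longrightarrow> length as = length xs \<Longrightarrow> i < length xs \<Longrightarrow> upds e xs as (xs ! i) = as ! i"
proof (induction xs arbitrary: e as i)
  case (Cons x xs)
  then obtain b bs where as: "as = b # bs" by (cases as) auto
  show ?case
  proof (cases i)
    case 0
    with Cons as show ?thesis by (simp add: upds_notin)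
  next
    case (Suc j)
    with Cons as show ?thesis by simp
  qed
qed simp

abbreviation elements :: "(ty \<Rightarrow> 'u set) \<Rightarrow> 'u list \<Rightarrow> var list \<Rightarrow> bool" where
  "elements C as xs \<equiv> list_all2 (\<lambda>a x. a \<in> C (snd x)) as xs"

lemma elements_Cons:
  "elements C cs (x # xs) \<longleftrightarrow> (\<exists>a as. cs = a # as \<and> a \<in> C (snd x) \<and> elements C as xs)"
  by (auto simp: list_all2_Cons2)

lemma sat_foldr_Forall:
  "sat M e (foldr Forall xs A) \<longleftrightarrow> (\<forall>as. elements (mcar M) as xs \<longrightarrow> sat M (upds e xs as) A)"
proof (induction xs arbitrary: e)
  case (Cons x xs)
  have "(\<forall>cs. elements (mcar M) cs (x # xs) \<longrightarrow> P cs) \<longleftrightarrow>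
      (\<forall>a\<in>mcar M (snd x). \<forall>as. elements (mcar M) as xs \<longrightarrow> P (a # as))" for P
    unfolding elements_Cons by blast
  from this[of "\<lambda>cs. sat M (upds e (x # xs) cs) A"] show ?case
    by (simp only: foldr.simps comp_apply sat.simps Cons upds.simps list.sel)
qed simp

lemma sat_foldr_Exists:
  "sat M e (foldr Exists xs A) \<longleftrightarrow> (\<exists>as. elements (mcar M) as xs \<and> sat M (upds e xs as) A)"
proof (induction xs arbitrary: e)
  case (Cons x xs)
  have "(\<exists>cs. elements (mcar M) cs (x # xs) \<and> P cs) \<longleftrightarrow>
      (\<exists>a\<in>mcar M (snd x). \<exists>as. elements (mcar M) as xs \<and> P (a # as))" for P
    unfolding elements_Cons by blast
  from this[of "\<lambda>cs. sat M (upds e (x # xs) cs) A"] show ?case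
    by (simp only: foldr.simps comp_apply sat.simps Cons upds.simps list.sel)
qed simp

lemma wff_foldr_Forall: "wff D (foldr Forall xs A) \<longleftrightarrow> (\<forall>x\<in>set xs. snd x \<in> D) \<and> wff D A"
  by (induction xs) auto

lemma wff_foldr_Exists: "wff D (foldr Exists xs A) \<longleftrightarrow> (\<forall>x\<in>set xs. snd x \<in> D) \<and> wff D A"
  by (induction xs) auto

context tracial_model begin

lemma sat_logic_axiom:
  assumes "logic_axiom A" "wff D A" "good e"
  shows "sat M e A"
  using assms
proof (induction rule: logic_axiom.induct)
  case (8 t v A)
  have v: "snd v \<in> D" using 8 by simp
  show ?case
  proof (cases "v \<in> fvf A")
    case True
    then have "wt D t" using wff_substf[OF True, of D "sub1 v t"] 8 by simp
    then have "val e t \<in> car U (snd v)" using 8 val_in by metis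
    with 8 show ?thesis by (auto simp: sat_sub1)
  next
    \<comment> \<open>The instance does not contain \<open>t\<close>, so \<open>t\<close> may have
      types outside \<open>D\<close>; any element of the nonempty carrier takes its place.\<close>
    case False
    obtain a where "a \<in> car U (snd v)" using car_nonempty[OF v] by blast
    with 8 False show ?thesis by (auto simp: sat_sub1 sat_upd_notin)
  qed
next
  case (9 t v A)
  have v: "snd v \<in> D" using 9 by simp
  show ?case
  proof (cases "v \<in> fvf A")
    case True
    then have "wt D t" using wff_substf[OF True, of D "sub1 v t"] 9 by simp
    then have "val e t \<in> car U (snd v)" using 9 val_in by metis
    with 9 show ?thesis by (auto simp: sat_sub1)
  next
    case False
    obtain a where "a \<in> car U (snd v)" using car_nonempty[OF v] by blast
    with 9 False show ?thesis by (auto simp: sat_sub1 sat_upd_notin)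
  qed
qed auto

text \<open>The carrier of type 0 consists of the standard numerals only, so induction on natural
  numbers applies to an arbitrary formula.\<close>

lemma sat_induction:
  assumes "good e" "x = (n, Nt)" and D: "T1 \<in> D"
    and "sat M e (substf (sub1 x zero) A)"
    and "sat M e (Forall x (A \<^bold>\<rightarrow> substf (sub1 x (suc (Var x))) A))"
  shows "sat M e (Forall x A)"
proof -
  have zero: "sat M (e(x := num U 0)) A"
  proof -
    have "free_for (sub1 x zero) A" by (rule free_for_no_new_vars) auto
    from assms(4)[unfolded sat_sub1[OF this]] show ?thesis by simp
  qed
  have suc: "sat M (e(x := num U (Suc k))) A" if "sat M (e(x := num U k)) A" for k
  proof -
    have "free_for (sub1 x (suc (Var x))) A" by (rule free_for_no_new_vars) auto
    moreover have "sat M (e(x := num U k)) (substf (sub1 x (suc (Var x))) A)"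
      using assms(2,5) that by auto
    ultimately show ?thesis using D by (simp add: sat_sub1)
  qed
  have "sat M (e(x := num U k)) A" for k
    by (induction k) (use zero suc in \<open>auto simp: fun_upd_def\<close>)
  then show ?thesis using assms(2) num_the_num by (simp, metis)
qed

lemma wt_apps_headD: "wt D (apps s ts) \<Longrightarrow> wt D s"
proof (induction ts arbitrary: s)
  case (Cons t ts)
  from Cons.IH[of "s \<cdot> t"] Cons.prems show ?case by simp
qed simp

lemma wt_apps_Cst_headD: "wt D (apps (Cst c) ts) \<Longrightarrow> cty c \<in> D"
  using wt_apps_headD[of "Cst c" ts] by simp

lemma wt_apps_argD: "wt D (apps s ts) \<Longrightarrow> t \<in> set ts \<Longrightarrow> wt D t"
proof (induction ts arbitrary: s)
  case (Cons u ts)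
  from Cons.IH[of "s \<cdot> u"] wt_apps_headD[of "s \<cdot> u" ts] Cons.prems show ?case by auto
qed simp

lemma recursor_values:
  assumes "good e" "i < length \<rho>s" "cty (Rec \<rho>s i) \<in> D"
    and ys: "ys = map (\<lambda>k. Var (k, \<rho>s ! k)) [0..<length \<rho>s]"
    and zs: "zs = map (\<lambda>k. Var (length \<rho>s + k, stepty \<rho>s (\<rho>s ! k))) [0..<length \<rho>s]"
    and x: "val e x = num U n"
  shows "val e (apps (Cst (Rec \<rho>s i)) (x # ys @ zs)) = rec_val U (map (val e) ys) (map (val e) zs) n ! i"
proof -
  have D: "fns (Nt # \<rho>s @ map (stepty \<rho>s) \<rho>s) (\<rho>s ! i) \<in> D" using assms(3) by (simp only: cty.simps)
  have ty: "\<rho>s ! k \<in> D" "stepty \<rho>s (\<rho>s ! k) \<in> D" if "k < length \<rho>s" for k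
    using fns_typesD(2)[OF D, of "\<rho>s ! k"] fns_typesD(2)[OF D, of "stepty \<rho>s (\<rho>s ! k)"] that by auto
  have "list_all2 (\<lambda>x \<rho>. x \<in> car U \<rho>) (map (val e) ys) \<rho>s"
    unfolding ys by (rule list_all2_all_nthI) (simp_all add: ty good_in[OF assms(1)])
  moreover have "list_all2 (\<lambda>x \<rho>. x \<in> car U \<rho>) (map (val e) zs) (map (stepty \<rho>s) \<rho>s)"
    unfolding zs by (rule list_all2_all_nthI)
      (simp_all add: ty good_in[OF assms(1)] del: foldr_append foldr.simps)
  ultimately have "foldl (app U) (cst_int U sc star tr (Rec \<rho>s i)) (num U n # map (val e) ys @ map (val e) zs)
      = rec_val U (map (val e) ys) (map (val e) zs) n ! i"
    by (rule foldl_Rec[OF assms(2,3)])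
  then show ?thesis
    by (simp only: foldl_App_tval tval.simps list.map map_append x assoc_model_simps)
qed

lemma sat_arith_axiom:
  assumes "arith_axiom A" "wff D A" "good e"
  shows "sat M e A"
  using assms
proof (induction rule: arith_axiom.induct)
  case (induction x n A)
  show ?case
  proof (cases "x \<in> fvf A")
    case True
    have "wff D (substf (sub1 x (suc (Var x))) A)" using induction by simp
    from wff_substf[OF True this] have "T1 \<in> D" by simp
    with induction sat_induction[of e x n A] show ?thesis by (simp del: sat.simps(5))
  next
    case False
    have "free_for (sub1 x zero) A" by (rule free_for_no_new_vars) auto
    with False show ?thesis by (simp add: sat_sub1 sat_upd_notin)
  qed
next
  case (pi x \<rho> y \<tau>)
  have D: "cty (Pi \<rho> \<tau>) \<in> D" "\<rho> \<in> D" "\<tau> \<in> D"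
    using wff_eqfD[OF pi.prems(1)] pi.hyps by auto
  show ?case
    unfolding sat_eqf[OF pi.prems] using D pi.hyps good_in[OF pi.prems(2)]
    by (simp add: app_Pi)
next
  case (sigma x \<delta> \<rho> \<tau> y z)
  have D: "cty (Sig \<delta> \<rho> \<tau>) \<in> D" "Fn \<delta> (Fn \<rho> \<tau>) \<in> D" "Fn \<delta> \<rho> \<in> D" "\<delta> \<in> D"
    using wff_eqfD[OF sigma.prems(1)] sigma.hyps by auto
  show ?case
    unfolding sat_eqf[OF sigma.prems] using D sigma.hyps good_in[OF sigma.prems(2)]
    by (simp add: app_Sig)
next
  case (rec_zero i \<rho>s ys zs)
  have w: "wt D (apps (Cst (Rec \<rho>s i)) (zero # ys @ zs))"
    using wff_eqfD[OF rec_zero.prems(1)] by blast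
  have D: "cty (Rec \<rho>s i) \<in> D" by (rule wt_apps_Cst_headD[OF w])
  have "val e zero = num U 0" by simp
  from recursor_values[OF rec_zero.prems(2) rec_zero.hyps(1) D rec_zero.hyps(2,3) this]
  show ?case
    unfolding sat_eqf[OF rec_zero.prems] using rec_zero.hyps by simp
next
  case (rec_suc i \<rho>s x ys zs)
  have x: "val e x = num U (nat_val e x)"
    using rec_suc.hyps(2) rec_suc.prems(2) by (intro val_Nt) auto
  have w: "wt D (apps (Cst (Rec \<rho>s i)) (suc x # ys @ zs))"
    "wt D (apps (zs ! i) (map (\<lambda>k. apps (Cst (Rec \<rho>s k)) (x # ys @ zs)) [0..<length \<rho>s] @ [x]))"
    using wff_eqfD[OF rec_suc.prems(1)] by blast+
  \<comment> \<open>All simultaneous recursors occur as arguments on the right-hand side, which puts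
    their types into \<open>D\<close>.\<close>
  have D: "cty (Rec \<rho>s k) \<in> D" if "k < length \<rho>s" for k
  proof -
    have "wt D (apps (Cst (Rec \<rho>s k)) (x # ys @ zs))"
      by (rule wt_apps_argD[OF w(2)]) (use that in auto)
    then show ?thesis by (rule wt_apps_Cst_headD)
  qed
  have "wt D (suc x)" by (rule wt_apps_argD[OF w(1)]) simp
  then have sx: "val e (suc x) = num U (Suc (nat_val e x))"
    using x by simp
  have "length ys = length \<rho>s" "length zs = length \<rho>s" using rec_suc.hyps by auto
  have "map (val e) (map (\<lambda>k. apps (Cst (Rec \<rho>s k)) (x # ys @ zs)) [0..<length \<rho>s])
      = map (\<lambda>k. rec_val U (map (val e) ys) (map (val e) zs) (nat_val e x) ! k) [0..<length \<rho>s]"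
    using recursor_values[OF rec_suc.prems(2) _ D rec_suc.hyps(3,4) x] by simp
  also have "\<dots> = rec_val U (map (val e) ys) (map (val e) zs) (nat_val e x)"
    using \<open>length ys = length \<rho>s\<close> \<open>length zs = length \<rho>s\<close>
    by (intro nth_equalityI) (cases "nat_val e x"; simp)+
  finally have args: "map (val e) (map (\<lambda>k. apps (Cst (Rec \<rho>s k)) (x # ys @ zs)) [0..<length \<rho>s])
      = rec_val U (map (val e) ys) (map (val e) zs) (nat_val e x)" .
  have "val e (apps (Cst (Rec \<rho>s i)) (suc x # ys @ zs)) =
      foldl (app U) (val e (zs ! i)) (rec_val U (map (val e) ys) (map (val e) zs) (nat_val e x) @ [num U (nat_val e x)])"
    unfolding recursor_values[OF rec_suc.prems(2) rec_suc.hyps(1) D[OF rec_suc.hyps(1)] rec_suc.hyps(3,4) sx]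
    using rec_suc.hyps(1) \<open>length zs = length \<rho>s\<close> by simp
  then show ?case
    unfolding sat_eqf[OF rec_suc.prems]
    by (simp only: foldl_App_tval map_append args list.map x assoc_model_simps)
qed (use val_Nt[of "vN 0" e] val_Nt[of "vN 1" e] in auto)

text \<open>Choice on the metalevel gives the witnesses as functions of the tuple \<open>as\<close>,
  and a full function space contains each of them.\<close>

lemma sat_qfac_axiom:
  assumes "qfac_axiom A" "wff D A" and e: "good e"
  shows "sat M e A"
  using assms(1,2)
proof cases
  case (1 A' xs ys Ys \<sigma>)
  note A = 1(1) and qf = 1(2) and dist = 1(3) and fresh = 1(4) and tys = 1(5) and \<sigma> = 1(6)
  have D: "\<And>v. v \<in> set xs \<Longrightarrow> snd v \<in> D" "\<And>v. v \<in> set ys \<Longrightarrow> snd v \<in> D" "\<And>v. v \<in> set Ys \<Longrightarrow> snd v \<in> D"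
    using assms(2) unfolding A by (auto simp: wff_foldr_Forall wff_foldr_Exists)
  have len: "length Ys = length ys" using tys by (metis length_map)
  have Ys_ty: "snd (Ys ! i) = fns (map snd xs) (snd (ys ! i))" if "i < length ys" for i
    using arg_cong[OF tys, of "\<lambda>l. l ! i"] that len by simp
  have "sat M e (foldr Exists Ys (foldr Forall xs (substf \<sigma> A')))"
    if prem: "sat M e (foldr Forall xs (foldr Exists ys A'))"
  proof -
    have "\<forall>as. \<exists>bs. elements (car U) as xs \<longrightarrow> elements (car U) bs ys \<and> sat M (upds (upds e xs as) ys bs) A'"
      using prem by (auto simp: sat_foldr_Forall sat_foldr_Exists)
    then obtain B where B: "\<And>as. elements (car U) as xs \<Longrightarrow>
        elements (car U) (B as) ys \<and> sat M (upds (upds e xs as) ys (B as)) A'"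
      by metis
    \<comment> \<open>The curried component \<open>i\<close> of the choice function, as an element
      of the carrier for the variable \<open>Ys ! i\<close>.\<close>
    define F where "F i = funs_code U (map snd xs) (snd (ys ! i)) (\<lambda>as. B as ! i)" for i
    have el: "elements (car U) as xs" if "list_all2 (\<lambda>x \<rho>. x \<in> car U \<rho>) as (map snd xs)" for as
      using that by (simp add: list_all2_map2)
    have D_i: "fns (map snd xs) (snd (ys ! i)) \<in> D" if "i < length ys" for i
      using D(3)[of "Ys ! i"] Ys_ty[OF that] that len by simp
    have B_i: "B as ! i \<in> car U (snd (ys ! i))"
      if "i < length ys" "list_all2 (\<lambda>x \<rho>. x \<in> car U \<rho>) as (map snd xs)" for i as
      using B[OF el[OF that(2)]] that(1) list_all2_nthD2 by blast
    define Fs where "Fs = map F [0..<length ys]"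
    have Fs_el: "elements (car U) Fs Ys"
    proof (rule list_all2_all_nthI)
      fix i assume "i < length Fs"
      then have i: "i < length ys" by (simp add: Fs_def)
      then show "Fs ! i \<in> car U (snd (Ys ! i))"
        using funs_code_in[OF D_i[OF i] B_i[OF i]] by (simp add: Fs_def F_def Ys_ty)
    qed (simp add: Fs_def len)
    have "sat M (upds (upds e Ys Fs) xs as) (substf \<sigma> A')" if as: "elements (car U) as xs" for as
    proof -
      let ?e = "upds (upds e Ys Fs) xs as"
      have as': "list_all2 (\<lambda>x \<rho>. x \<in> car U \<rho>) as (map snd xs)"
        using as by (simp add: list_all2_map2)
      have las: "length as = length xs" using as by (auto dest: list_all2_lengthD)
      have lB: "length (B as) = length ys" using B[OF as] by (auto dest: list_all2_lengthD)
      \<comment> \<open>Distinctness keeps the three blocks of variables apart, and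
        \<open>A'\<close> does not mention \<open>Ys\<close>; so evaluating the substituted terms
        gives back the assignment that satisfies \<open>A'\<close>.\<close>
      have eqv: "val ?e (\<sigma> v) = upds (upds e xs as) ys (B as) v" if v: "v \<in> fvf A'" for v
      proof (cases "v \<in> set ys")
        case True
        then obtain i where i: "i < length ys" "v = ys ! i" by (auto simp: in_set_conv_nth)
        have "map_of (zip ys Ys) (ys ! i) = Some (Ys ! i)"
          using i dist len by (intro map_of_zip_nth) auto
        then have "val ?e (\<sigma> v) = foldl (app U) (?e (Ys ! i)) (map ?e xs)"
          by (simp add: \<sigma> i foldl_App_tval comp_def)
        also have "map ?e xs = as"
          using las dist by (intro nth_equalityI) (simp_all add: upds_nth)
        also have "?e (Ys ! i) = upds e Ys Fs (Ys ! i)"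
          using dist i len by (intro upds_notin) (auto dest: nth_mem)
        also have "\<dots> = F i"
          using dist i len by (subst upds_nth) (auto simp: Fs_def)
        also have "foldl (app U) (F i) as = B as ! i"
          unfolding F_def by (rule foldl_funs_code[OF D_i[OF i(1)] B_i[OF i(1)] as'])
        also have "\<dots> = upds (upds e xs as) ys (B as) v"
          using i lB dist by (simp add: upds_nth)
        finally show ?thesis .
      next
        case False
        then have "map_of (zip ys Ys) v = None"
          using len by (simp add: map_of_zip_is_None)
        then have "val ?e (\<sigma> v) = ?e v" by (simp add: \<sigma>)
        also have "\<dots> = upds e xs as v"
        proof (cases "v \<in> set xs")
          case True
          then obtain i where "i < length xs" "v = xs ! i" by (auto simp: in_set_conv_nth)
          then show ?thesis using las dist by (simp add: upds_nth)
        next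
          case False
          moreover have "v \<notin> set Ys" using fresh v by auto
          ultimately show ?thesis by (simp add: upds_notin)
        qed
        also have "\<dots> = upds (upds e xs as) ys (B as) v"
          using False by (simp add: upds_notin)
        finally show ?thesis .
      qed
      have "sat M ?e (substf \<sigma> A') = sat M (upds (upds e xs as) ys (B as)) A'"
        unfolding sat_substf[OF free_for_qfree[OF qf]] by (rule sat_cong) (rule eqv)
      with B[OF as] show ?thesis by simp
    qed
    with Fs_el show ?thesis
      by (auto simp: sat_foldr_Forall sat_foldr_Exists)
  qed
  then show ?thesis unfolding A by simp
qed

text \<open>The premises are assumed under every good assignment, because the quantifier rules
  evaluate them at \<open>e(v := a)\<close>.\<close>

lemma sat_rule:
  assumes "rule_inst P A" "\<forall>B\<in>P. wff D B" "wff D A"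
    and prem: "\<And>B e. B \<in> P \<Longrightarrow> good e \<Longrightarrow> sat M e B" and e: "good e"
  shows "sat M e A"
  using assms
proof (induction rule: rule_inst.induct)
  case (all_intro v B A)
  have "sat M (e(v := a)) A" if "sat M e B" "a \<in> car U (snd v)" for a
  proof -
    have "sat M (e(v := a)) (B \<^bold>\<rightarrow> A)"
      by (rule all_intro.prems(3)) (use that all_intro.prems(4) in \<open>auto simp: good_def\<close>)
    with that all_intro.hyps show ?thesis by (simp add: sat_upd_notin)
  qed
  then show ?case by simp
next
  case (ex_elim v B A)
  have "sat M e B" if "sat M (e(v := a)) A" "a \<in> car U (snd v)" for a
  proof -
    have "sat M (e(v := a)) (A \<^bold>\<rightarrow> B)"
      by (rule ex_elim.prems(3)) (use that ex_elim.prems(4) in \<open>auto simp: good_def\<close>)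
    with that ex_elim.hyps show ?thesis by (simp add: sat_upd_notin)
  qed
  then show ?case by auto
next
  case (qf_er A s x t r)
  show ?case
  proof (simp, rule impI)
    assume "sat M e A"
    then have "sat M e (eqf (snd x) s t)" using qf_er by fastforce
    \<comment> \<open>Equality inside the language is identity of values, so both substitutions into
      \<open>r\<close> evaluate under the same assignment.\<close>
    then have st: "val e s = val e t"
      using sat_eqf[of "snd x" s t e] qf_er by simp
    have "val e (substt (sub1 x s) r) = val e (substt (sub1 x t) r)"
      unfolding tval_substt by (rule tval_cong) (simp add: st)
    then show "sat M e (eqf (ty_of r) (substt (sub1 x s) r) (substt (sub1 x t) r))"
      using sat_eqf qf_er.prems by simp
  qed
next
  case (mp A B)
  from mp(3)[of A e] mp(3)[of "A \<^bold>\<rightarrow> B" e] mp(4) show ?case by simp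
next
  case (syll A B E)
  from syll(3)[of "A \<^bold>\<rightarrow> B" e] syll(3)[of "B \<^bold>\<rightarrow> E" e] syll(4) show ?case by simp
qed auto

end

theorem theorem3p2:
  fixes sc :: "complex \<Rightarrow> 'a::{real_normed_algebra_1, banach} \<Rightarrow> 'a"
    and star :: "'a \<Rightarrow> 'a"
    and tr :: "'a \<Rightarrow> complex"
    and scp :: "complex \<Rightarrow> 'p::banach \<Rightarrow> 'p"
    and J :: "'a \<Rightarrow> 'p \<Rightarrow>\<^sub>L complex"
    and U :: "('u, 'a) universe"
    and q :: "nat \<Rightarrow> nat \<Rightarrow> rat poly"
  assumes "tracial_von_neumann_algebra sc star scp J tr"
    and "full_universe U"
    and "admissible q"
  shows "is_model (tys U) (assoc_model U sc star tr) (TvNm q (tys U))"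
proof -
  interpret tracial_model U sc star tr scp J
    using assms(1,2) by (intro tracial_model.intro full_universe_model.intro)
  have good_iff: "(\<forall>v. snd v \<in> D \<longrightarrow> e v \<in> mcar M (snd v)) \<longleftrightarrow> good e" for e
    by (simp add: good_def)
  have "sat M e A" if A: "A \<in> fst (TvNm q D)" and e: "good e" for A e
  proof -
    have "wff D A" and cases: "logic_axiom A \<or> arith_axiom A \<or> qfac_axiom A \<or> algebra_axiom A \<or>
        normed_axiom ninf A \<or> normed_axiom (\<lambda>s. Cst (VN Norm2) \<cdot> s) A \<or> tracial_axiom A \<or> ball_axiom q A \<or>
        (\<exists>B. A = B \<^bold>\<or> Neg B) \<or> (\<exists>c. A = majf (vnty c) (Cst (VN c)) (Cst (Maj c)))"
      using A unfolding TvNm_def TvNc_def TvNi_def by auto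
    note w = \<open>wff D A\<close>
    from cases show ?thesis
    proof (elim disjE)
      show "sat M e A" if "\<exists>c. A = majf (vnty c) (Cst (VN c)) (Cst (Maj c))"
      proof -
        from that obtain c where c: "A = majf (vnty c) (Cst (VN c)) (Cst (Maj c))" by blast
        have "vnty c \<in> D" "hatty (vnty c) \<in> D"
          using wff_majfD[of "vnty c" "Cst (VN c)" "Cst (Maj c)"] w c by auto
        then show ?thesis
          using sat_majf[OF w[unfolded c] e] majorizes_VN[of c] by (simp add: c cst_int.simps)
      qed
    qed (use w e assms(3) sat_logic_axiom sat_arith_axiom sat_qfac_axiom sat_algebra_axiom
        sat_normed_axiom_ninf sat_normed_axiom_n2 sat_tracial_axiom sat_ball_axiom in auto)
  qed
  moreover have "sat M e A" if "(P, A) \<in> rules D" "\<forall>B\<in>P. valid D M B" "good e" for P A e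
    using that sat_rule[of P A e] unfolding rules_def valid_def good_iff by blast
  ultimately show ?thesis
    unfolding is_model_def valid_def good_iff
    using cst_in by (auto simp: TvNm_def TvNc_def TvNi_def valid_def good_iff)
qed

end
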